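(* Let $\alpha>0$ and let $\mathfrak{y}_\alpha$ be the probability measure on $\mathbb{R}_+$ whose $S$-transform is $S_{\mathfrak{y}_\alpha}(z)=\exp(-\alpha z)$. Then: (1) $\mathcal{R}_{\mathfrak{y}_\alpha}(z)=\frac{-W_0(-\alpha z)}{\alpha z}$ and $R_{\mathfrak{y}_\alpha}(z)=-\frac1\alpha W_0(-\alpha z)$. (2) $\mathfrak{y}_\alpha$ is both $\boxplus$-infinitely divisible and $\boxtimes$-infinitely divisible. (3) The free cumulant sequence of $\mathfrak{y}_\alpha$ is $\left\{\frac{(\alpha n)^{n-1}}{n!}\right\}_{n\in\mathbb{N}}$. (4) The Lévy measure of $\mathfrak{y}_\alpha$ is \[ \nu_{\mathfrak{y}_\alpha}(ds)=\frac{1}{\alpha\pi}\,s\,f^{-1}(\alpha/s)\,1_{[0,\alpha e]}(s)\,ds, \] where $f(u)=u\csc u\,\exp(-u\cot u)$. (5) For $t>0$: $\mathfrak{y}_\alpha^{\boxplus t}=D_t\big(\mathfrak{y}_\alpha^{\boxtimes 1/t}\big)$ and $\mathfrak{y}_\alpha^{\boxtimes t}=D_t\big(\mathfrak{y}_\alpha^{\boxplus 1/t}\big)$.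
   Context: $S$-transform: for a probability measure $\mu\neq\delta_0$ on $\mathbb{R}_+$, $\Psi_\mu(z)=\int\frac{xz}{1-xz}\mu(dx)$ and $S_\mu(z)=\frac{(z+1)\Psi_\mu^{-1}(z)}{z}$ near $0$ in $\Psi_\mu(i\mathbb{C}^+)$. For a probability measure $\mu$ on $\mathbb{R}$ with Cauchy transform $G_\mu(z)=\int\frac{\mu(dx)}{z-x}$, the $R$- and $\mathcal{R}$-transforms are $R_\mu(z)=z\mathcal{R}_\mu(z)=zG_\mu^{-1}(z)-1$ (defined for $1/z$ in a truncated cone $\{x+iy: y>\beta,\ |y|>\alpha' x\}$); these identities are understood on the domain of definition near $0$. The free cumulants $\kappa_n$ are the coefficients in $R_\mu(z)=\sum_{n\ge1}\kappa_nz^n$. $W_0$ is the principal branch of the Lambert $W$ function, $W_0(z)e^{W_0(z)}=z$. $\mu$ is $\boxplus$-infinitely divisible (resp. $\boxtimes$-) if for each $n$ it is the $n$-fold $\boxplus$ (resp. $\boxtimes$) power of some probability measure; $\mu^{\boxplus t},\mu^{\boxtimes t}$ for real $t>0$ are the convolution powers, characterized by $S_{\mu^{\boxplus t}}(z)=\frac1tS_\mu(z/t)$ and $S_{\mu^{\boxtimes t}}=S_\mu^t$. A $\boxplus$-infinitely divisible $\mu$ has a Lévy–Khintchine representation $\mathcal{R}_\mu(z)=b_\mu+\int_{\mathbb{R}}\frac{z}{1-tz}\nu_\mu(dt)$ with unique $b_\mu\in\mathbb{R}$ and finite measure $\nu_\mu$, the Lévy measure. $D_c(\mu)(B)=\mu(c^{-1}B)$.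 $f^{-1}$ denotes the inverse of $f$ restricted to $(0,\pi)$, which is a bijection $(0,\pi)\to(1/e,\infty)$. *)

theory Defs
  imports "HOL-Probability.Probability"
begin

definition prob_on_R :: "real measure \<Rightarrow> bool" where
  "prob_on_R \<mu> \<longleftrightarrow> prob_space \<mu> \<and> sets \<mu> = sets borel"

definition prob_on_Rplus :: "real measure \<Rightarrow> bool" where
  "prob_on_Rplus \<mu> \<longleftrightarrow> prob_on_R \<mu> \<and> emeasure \<mu> {0..} = 1"

definition dilate :: "real \<Rightarrow> real measure \<Rightarrow> real measure" where
  "dilate c \<mu> = distr \<mu> borel (\<lambda>x. c * x)"

definition cauchy_transform :: "real measure \<Rightarrow> complex \<Rightarrow> complex" where
  "cauchy_transform \<mu> z = integral\<^sup>L \<mu> (\<lambda>x. 1 / (z - complex_of_real x))"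

definition Psi_transform :: "real measure \<Rightarrow> complex \<Rightarrow> complex" where
  "Psi_transform \<mu> z = integral\<^sup>L \<mu> (\<lambda>x. complex_of_real x * z / (1 - complex_of_real x * z))"

text \<open>i C^+ = { i z : Im z > 0 } = { w : Re w < 0 }.\<close>
definition iCplus :: "complex set" where
  "iCplus = {w. Re w < 0}"

text \<open>S is the S-transform of mu near 0 in Psi_mu(iC^+):
  S(w) = (w+1)/w * Psi_mu^{-1}(w) for w in Psi_mu(iC^+) near 0, i.e.
  S(Psi_mu z) = (Psi_mu z + 1)/Psi_mu z * z for z in iC^+ with Psi_mu z near 0.\<close>
definition S_transform_rel :: "real measure \<Rightarrow> (complex \<Rightarrow> complex) \<Rightarrow> bool" where
  "S_transform_rel \<mu> S \<longleftrightarrow>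
     (\<exists>\<epsilon>>0. \<forall>z\<in>iCplus. 0 < cmod (Psi_transform \<mu> z) \<and> cmod (Psi_transform \<mu> z) < \<epsilon> \<longrightarrow>
        S (Psi_transform \<mu> z) = (Psi_transform \<mu> z + 1) * z / Psi_transform \<mu> z)"

definition trunc_cone :: "real \<Rightarrow> real \<Rightarrow> complex set" where
  "trunc_cone a b = {w. Im w > b \<and> a * \<bar>Re w\<bar> < Im w}"

text \<open>R is the R-transform of mu: R(z) = z G_mu^{-1}(z) - 1 for 1/z in a truncated cone,
  where G_mu^{-1} is the inverse of G_mu restricted to a truncated cone on which G_mu is injective.\<close>
definition R_transform_rel :: "real measure \<Rightarrow> (complex \<Rightarrow> complex) \<Rightarrow> bool" where
  "R_transform_rel \<mu> R \<longleftrightarrow>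
     (\<exists>a b a' b'. a > 0 \<and> b > 0 \<and> a' > 0 \<and> b' > 0 \<and>
        inj_on (cauchy_transform \<mu>) (trunc_cone a b) \<and>
        (\<forall>w\<in>trunc_cone a' b'. \<exists>v\<in>trunc_cone a b.
            cauchy_transform \<mu> v = 1 / w \<and> R (1 / w) = (1 / w) * v - 1))"

definition calR_transform_rel :: "real measure \<Rightarrow> (complex \<Rightarrow> complex) \<Rightarrow> bool" where
  "calR_transform_rel \<mu> Rc \<longleftrightarrow> R_transform_rel \<mu> (\<lambda>z. z * Rc z)"

definition free_cumulants_rel :: "real measure \<Rightarrow> (nat \<Rightarrow> real) \<Rightarrow> bool" where
  "free_cumulants_rel \<mu> \<kappa> \<longleftrightarrow>
     (\<exists>R r. r > 0 \<and> R_transform_rel \<mu> R \<and>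
        (\<forall>z. cmod z < r \<longrightarrow> (\<lambda>n. complex_of_real (\<kappa> (Suc n)) * z ^ Suc n) sums R z))"

definition free_add_power :: "real measure \<Rightarrow> real \<Rightarrow> real measure \<Rightarrow> bool" where
  "free_add_power \<mu> t \<rho> \<longleftrightarrow> prob_on_R \<rho> \<and>
     (\<exists>R. R_transform_rel \<mu> R \<and> R_transform_rel \<rho> (\<lambda>z. complex_of_real t * R z))"

definition free_mult_power :: "real measure \<Rightarrow> real \<Rightarrow> real measure \<Rightarrow> bool" where
  "free_mult_power \<mu> t \<rho> \<longleftrightarrow> prob_on_Rplus \<rho> \<and> \<rho> \<noteq> return borel 0 \<and>
     (\<exists>S. S_transform_rel \<mu> S \<and> S_transform_rel \<rho> (\<lambda>w. S w powr complex_of_real t))"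

text \<open>mu is boxplus-infinitely divisible: for each n, mu = nu boxplus ... boxplus nu (n times),
  i.e. R_mu = n R_nu.\<close>
definition free_add_inf_div :: "real measure \<Rightarrow> bool" where
  "free_add_inf_div \<mu> \<longleftrightarrow>
     (\<forall>n::nat. n \<ge> 1 \<longrightarrow> (\<exists>\<nu>. prob_on_R \<nu> \<and>
        (\<exists>R. R_transform_rel \<nu> R \<and> R_transform_rel \<mu> (\<lambda>z. of_nat n * R z))))"

text \<open>mu is boxtimes-infinitely divisible: for each n, mu is the n-fold boxtimes power of some nu
  on R_+, i.e. S_mu = S_nu^n.\<close>
definition free_mult_inf_div :: "real measure \<Rightarrow> bool" where
  "free_mult_inf_div \<mu> \<longleftrightarrow>
     (\<forall>n::nat. n \<ge> 1 \<longrightarrow> (\<exists>\<nu>. prob_on_Rplus \<nu> \<and> \<nu> \<noteq> return borel 0 \<and>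
        (\<exists>S. S_transform_rel \<nu> S \<and> S_transform_rel \<mu> (\<lambda>w. S w ^ n))))"

definition levy_measure_rel :: "real measure \<Rightarrow> real measure \<Rightarrow> bool" where
  "levy_measure_rel \<mu> \<nu> \<longleftrightarrow> finite_measure \<nu> \<and> sets \<nu> = sets borel \<and>
     (\<exists>b::real. calR_transform_rel \<mu>
        (\<lambda>z. complex_of_real b + integral\<^sup>L \<nu> (\<lambda>t. z / (1 - complex_of_real t * z))))"

text \<open>Principal branch W_0 of the Lambert W function. z \<mapsto> z e^z is univalent (starlike) on the
  open unit disc, and the unit disc lies in the range of the principal branch; so on the image of
  the unit disc (which contains the disc of radius 1/e) W_0(z) is the unique solution w of
  w e^w = z with |w| < 1. Outside that image this definition is unspecified.\<close>
definition LambertW0 :: "complex \<Rightarrow> complex" where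
  "LambertW0 z = (THE w. cmod w < 1 \<and> w * exp w = z)"

definition f_fun :: "real \<Rightarrow> real" where
  "f_fun u = u / sin u * exp (- u * cot u)"

text \<open>Inverse of f restricted to (0, pi), a bijection (0,pi) -> (1/e, infinity).\<close>
definition f_inv :: "real \<Rightarrow> real" where
  "f_inv y = (THE u. 0 < u \<and> u < pi \<and> f_fun u = y)"

end

theory Submission
  imports Defs "HOL-Complex_Analysis.Complex_Analysis"
begin

text \<open>
  Write $G$ for the Cauchy transform of $\mu$ and put $\psi(v) = v G(v) - 1$. The hypothesis
  on the S-transform says $G = \psi e^{-\alpha\psi}$ near infinity, so by the identity theorem it
  holds off the support. Hence the R-transform is the solution $R$ of $u = R e^{-\alpha R}$,
  that is, the tree series $\sum_n (\alpha n)^{n-1} u^n / n!$ by Lagrange inversion.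

  The convolution powers of $\mu$ are dilations of measures of the same kind with another $\alpha$,
  and these have to be constructed for every $\alpha > 0$. The function
  $X(w) = (1+w) e^{\alpha w} / w$ is real on a closed curve around $0$ and $-1$. Integrating
  $X^n$ along the upper half of this curve gives the Lagrange coefficients as the moments of a
  positive measure. Since $X^n$ has a single pole, it suffices to apply the fundamental theorem of
  calculus to a primitive of $X^n$ minus its residue term. The same argument with $e^w / w$ on the
  curve $w = u \cot u + i u$ evaluates $\int_0^\pi f(u)^{-n}\, du = \pi n^n / n!$, which identifies
  the moments of the Levy measure.
\<close>

section \<open>Stieltjes inversion and the Cauchy transform\<close>

text \<open>The relations in the statement fix S and R only on small sets: S at values of Psi, R at
  points 1/w with w high in a cone. No moments of y are assumed, so G cannot be expanded at infinity
  beforehand. Hence everything passes through one equation for G. It is read off on a negative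
  half-line, where Psi is real, and then continued. R comes out of it by injectivity of an auxiliary
  function near 0, and uniqueness of the additive powers by injectivity of G in cones.

  The curve has its origin in contour integration. The Lagrange coefficient of order n is 1/(2 pi i
  n) times the loop integral of X^n dw, and by parts this is minus 1/(2 pi i) times the loop
  integral of w X^n d(log X). If X is real on the loop, the two conjugate halves combine to 1/pi
  times the integral of Im w X^n d(log X) over the upper half, taken from left to right. This is the
  n-th moment of a positive measure as soon as X increases along that half, and this monotonicity is
  the inequality on which the construction rests.\<close>

lemma prob_on_R_real_distribution:
  assumes "prob_on_R \<mu>" shows "real_distribution \<mu>"
  using assms unfolding prob_on_R_def real_distribution_def real_distribution_axioms_def by auto

lemma prob_on_R_integrable_bounded:
  fixes f :: "real \<Rightarrow> 'b::{banach,second_countable_topology}"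
  assumes "prob_on_R \<mu>" "f \<in> borel_measurable borel" "AE x in \<mu>. norm (f x) \<le> B"
  shows "integrable \<mu> f"
proof -
  interpret prob_space \<mu> using assms by (simp add: prob_on_R_def)
  have "f \<in> borel_measurable \<mu>" using assms by (simp add: prob_on_R_def cong: measurable_cong_sets)
  thus ?thesis using assms(3) by (intro integrable_const_bound[where B=B]) auto
qed

lemma Im_cauchy_kernel:
  "Im (1 / (Complex t \<epsilon> - complex_of_real x)) = - (\<epsilon> / ((t - x)\<^sup>2 + \<epsilon>\<^sup>2))"
  by (simp add: Im_divide power2_eq_square)

text \<open>At height \<epsilon> > 0 the kernel is bounded by 1/\<epsilon>, so Fubini applies on a
  bounded segment, and the inner integral has an arctangent as primitive.\<close>

lemma Im_cauchy_transform_integral: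
  assumes \<mu>: "prob_on_R \<mu>" and e: "\<epsilon> > 0" and ab: "a \<le> b"
  shows "(LBINT t:{a..b}. Im (cauchy_transform \<mu> (Complex t \<epsilon>)))
     = - integral\<^sup>L \<mu> (\<lambda>x. arctan ((b - x) / \<epsilon>) - arctan ((a - x) / \<epsilon>))"
proof -
  interpret prob_space \<mu> using \<mu> by (simp add: prob_on_R_def)
  have sets[measurable_cong]: "sets \<mu> = sets borel" using \<mu> by (simp add: prob_on_R_def)
  interpret P: pair_sigma_finite lborel \<mu> ..
  define k where "k t x = - (\<epsilon> / ((t - x)\<^sup>2 + \<epsilon>\<^sup>2))" for t x :: real
  have kb: "\<bar>k t x\<bar> \<le> 1 / \<epsilon>" for t x
  proof -
    have "\<epsilon>\<^sup>2 \<le> (t - x)\<^sup>2 + \<epsilon>\<^sup>2" by simp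
    hence "\<epsilon> / ((t - x)\<^sup>2 + \<epsilon>\<^sup>2) \<le> \<epsilon> / \<epsilon>\<^sup>2" using e by (intro divide_left_mono) (auto intro!: mult_pos_pos add_nonneg_pos)
    thus ?thesis using e by (simp add: k_def power2_eq_square)
  qed
  have km[measurable]: "(\<lambda>(t, x). k t x) \<in> borel_measurable (lborel \<Otimes>\<^sub>M \<mu>)" unfolding k_def by measurable
  have ImG: "Im (cauchy_transform \<mu> (Complex t \<epsilon>)) = (\<integral>x. k t x \<partial>\<mu>)" for t
  proof -
    have nb: "norm (1 / (Complex t \<epsilon> - complex_of_real x)) \<le> 1 / \<epsilon>" for x
    proof -
      have "\<epsilon> \<le> norm (Complex t \<epsilon> - complex_of_real x)"
        using abs_Im_le_cmod[of "Complex t \<epsilon> - complex_of_real x"] e by simp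
      thus ?thesis using e by (simp add: norm_divide frac_le)
    qed
    have "integrable \<mu> (\<lambda>x. 1 / (Complex t \<epsilon> - complex_of_real x))"
      by (rule prob_on_R_integrable_bounded[OF \<mu>, where B="1/\<epsilon>"]) (use nb in auto)
    thus ?thesis unfolding cauchy_transform_def k_def Im_cauchy_kernel[symmetric] by (simp only: integral_Im)
  qed
  have int: "integrable (lborel \<Otimes>\<^sub>M \<mu>) (\<lambda>(t, x). indicator {a..b} t *\<^sub>R k t x)"
  proof (rule Bochner_Integration.integrable_bound[where f="\<lambda>(t,x). indicator {a..b} t * (1 / \<epsilon>)"])
    show "integrable (lborel \<Otimes>\<^sub>M \<mu>) (\<lambda>(t, x). indicator {a..b} t * (1 / \<epsilon>) :: real)"
    proof (rule P.Fubini_integrable)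
      show "integrable lborel (\<lambda>t. \<integral>x. norm (case (t, x) of (t, x) \<Rightarrow> indicat_real {a..b} t * (1 / \<epsilon>)) \<partial>\<mu>)"
        using e by (auto simp: prob_space emeasure_lborel_Icc_eq intro!: integrable_divide integrable_real_indicator)
      show "AE t in lborel. integrable \<mu> (\<lambda>x. case (t, x) of (t, x) \<Rightarrow> indicat_real {a..b} t * (1 / \<epsilon>))" by simp
    qed measurable
    show "AE p in lborel \<Otimes>\<^sub>M \<mu>. norm (case p of (t, x) \<Rightarrow> indicat_real {a..b} t *\<^sub>R k t x)
       \<le> norm (case p of (t, x) \<Rightarrow> indicat_real {a..b} t * (1 / \<epsilon>))"
      using kb e by (auto simp: indicator_def split: prod.splits)
  qed measurable
  have "(LBINT t:{a..b}. Im (cauchy_transform \<mu> (Complex t \<epsilon>))) = (\<integral>t. (\<integral>x. indicator {a..b} t *\<^sub>R k t x \<partial>\<mu>) \<partial>lborel)"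
    unfolding set_lebesgue_integral_def ImG by simp
  also have "\<dots> = (\<integral>x. (\<integral>t. indicator {a..b} t *\<^sub>R k t x \<partial>lborel) \<partial>\<mu>)"
    using P.Fubini_integral[OF int] by simp
  also have "(\<lambda>x. \<integral>t. indicator {a..b} t *\<^sub>R k t x \<partial>lborel) = (\<lambda>x. - (arctan ((b - x) / \<epsilon>) - arctan ((a - x) / \<epsilon>)))"
  proof
    fix x
    have d: "((\<lambda>t. - arctan ((t - x) / \<epsilon>)) has_vector_derivative k t x) (at t within {a..b})" for t
    proof -
      have "((\<lambda>t. - arctan ((t - x) / \<epsilon>)) has_real_derivative - (inverse (1 + ((t - x) / \<epsilon>)\<^sup>2) * (1 / \<epsilon>))) (at t within {a..b})"
        using e by (auto intro!: derivative_eq_intros)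
      also have "- (inverse (1 + ((t - x) / \<epsilon>)\<^sup>2) * (1 / \<epsilon>)) = k t x"
      proof -
        have "1 + ((t - x) / \<epsilon>)\<^sup>2 = ((t - x)\<^sup>2 + \<epsilon>\<^sup>2) / \<epsilon>\<^sup>2" using e by (simp add: field_simps)
        thus ?thesis using e unfolding k_def by (simp add: power2_eq_square)
      qed
      finally show ?thesis by (simp add: has_real_derivative_iff_has_vector_derivative)
    qed
    have c: "continuous_on {a..b} (\<lambda>t. k t x)" unfolding k_def
      using e by (auto intro!: continuous_intros simp: add_nonneg_eq_0_iff)
    have "(\<integral>t. indicator {a..b} t *\<^sub>R k t x \<partial>lborel) = - arctan ((b - x) / \<epsilon>) - - arctan ((a - x) / \<epsilon>)"
      by (rule integral_FTC_Icc[OF ab d c])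
    thus "(\<integral>t. indicator {a..b} t *\<^sub>R k t x \<partial>lborel) = - (arctan ((b - x) / \<epsilon>) - arctan ((a - x) / \<epsilon>))" by simp
  qed
  finally show ?thesis by (simp only: Bochner_Integration.integral_minus)
qed

lemma arctan_scaled_limit:
  "(\<lambda>n. arctan (c * real (Suc n))) \<longlonglongrightarrow> (pi / 2) * sgn c"
proof -
  have f: "filterlim (\<lambda>n. c * real (Suc n)) at_top sequentially" if "c > 0" for c
    using that by (intro filterlim_tendsto_pos_mult_at_top[OF tendsto_const] filterlim_compose[OF filterlim_real_sequentially filterlim_Suc]) auto
  consider "c > 0" | "c = 0" | "c < 0" by linarith
  thus ?thesis
  proof cases
    case 1
    thus ?thesis using filterlim_compose[OF tendsto_arctan_at_top f[of c]] by simp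
  next
    case 3
    have "(\<lambda>n. - arctan ((- c) * real (Suc n))) \<longlonglongrightarrow> - (pi / 2)"
      using 3 by (intro tendsto_minus filterlim_compose[OF tendsto_arctan_at_top f[of "- c"]]) auto
    thus ?thesis using 3 by (simp add: arctan_minus del: of_nat_Suc)
  qed auto
qed

text \<open>
  The integral of the imaginary part of the Cauchy transform along a horizontal segment is the
  integral of a difference of arctangents. It tends to the mass of the projected segment with
  weight $1/2$ at the end points, and the distribution function is recovered from the right.
\<close>

theorem cauchy_transform_eq_imp_eq:
  assumes \<mu>: "prob_on_R \<mu>" and \<nu>: "prob_on_R \<nu>"
    and eq: "\<And>v. Im v > 0 \<Longrightarrow> cauchy_transform \<mu> v = cauchy_transform \<nu> v"
  shows "\<mu> = \<nu>"
proof -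
  define h where "h a b x = (pi / 2) * (sgn (b - x) - sgn (a - x))" for a b x :: real
  have lim: "(\<lambda>n. integral\<^sup>L \<rho> (\<lambda>x. arctan ((b - x) * real (Suc n)) - arctan ((a - x) * real (Suc n)))) \<longlonglongrightarrow> integral\<^sup>L \<rho> (h a b)"
    if "prob_on_R \<rho>" for \<rho> a b
  proof (rule integral_dominated_convergence[where w="\<lambda>_. pi"])
    interpret prob_space \<rho> using that by (simp add: prob_on_R_def)
    have [measurable_cong]: "sets \<rho> = sets borel" using that by (simp add: prob_on_R_def)
    show "h a b \<in> borel_measurable \<rho>" unfolding h_def by measurable
    show "(\<lambda>x. arctan ((b - x) * real (Suc i)) - arctan ((a - x) * real (Suc i))) \<in> borel_measurable \<rho>" for i
      by measurable
    show "AE x in \<rho>. (\<lambda>n. arctan ((b - x) * real (Suc n)) - arctan ((a - x) * real (Suc n))) \<longlonglongrightarrow> h a b x"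
      unfolding h_def right_diff_distrib by (intro AE_I2 tendsto_diff arctan_scaled_limit)
    have "\<bar>arctan u - arctan v\<bar> \<le> pi" for u v
      using arctan_bounded[of u] arctan_bounded[of v] by linarith
    thus "AE x in \<rho>. norm (arctan ((b - x) * real (Suc i)) - arctan ((a - x) * real (Suc i))) \<le> pi" for i
      by simp
    show "integrable \<rho> (\<lambda>_. pi)" by simp
  qed
  have heq: "integral\<^sup>L \<mu> (h a b) = integral\<^sup>L \<nu> (h a b)" if "a \<le> b" for a b
  proof -
    have "integral\<^sup>L \<mu> (\<lambda>x. arctan ((b - x) * real (Suc n)) - arctan ((a - x) * real (Suc n)))
       = integral\<^sup>L \<nu> (\<lambda>x. arctan ((b - x) * real (Suc n)) - arctan ((a - x) * real (Suc n)))" for n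
    proof -
      have e: "1 / real (Suc n) > 0" by simp
      have "(LBINT t:{a..b}. Im (cauchy_transform \<mu> (Complex t (1 / real (Suc n)))))
         = (LBINT t:{a..b}. Im (cauchy_transform \<nu> (Complex t (1 / real (Suc n)))))"
        using eq e by (intro set_lebesgue_integral_cong) auto
      thus ?thesis unfolding Im_cauchy_transform_integral[OF \<mu> e that] Im_cauchy_transform_integral[OF \<nu> e that] by simp
    qed
    thus ?thesis using lim[OF \<mu>, of b a] lim[OF \<nu>, of b a] LIMSEQ_unique by auto
  qed
  have lim2: "(\<lambda>n. integral\<^sup>L \<rho> (h (- real (Suc n)) (b + 1 / real (Suc n)))) \<longlonglongrightarrow> pi * cdf \<rho> b"
    if "prob_on_R \<rho>" for \<rho> b
  proof -
    interpret real_distribution \<rho> using that by (rule prob_on_R_real_distribution)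
    have "(\<lambda>n. integral\<^sup>L \<rho> (h (- real (Suc n)) (b + 1 / real (Suc n)))) \<longlonglongrightarrow> integral\<^sup>L \<rho> (\<lambda>x. pi * indicator {..b} x)"
    proof (rule integral_dominated_convergence[where w="\<lambda>_. pi"])
      show "h (- real (Suc n)) (b + 1 / real (Suc n)) \<in> borel_measurable \<rho>" for n
        unfolding h_def by measurable
      show "AE x in \<rho>. (\<lambda>n. h (- real (Suc n)) (b + 1 / real (Suc n)) x) \<longlonglongrightarrow> pi * indicator {..b} x"
      proof (rule AE_I2)
        fix x
        have 1: "eventually (\<lambda>n. - real (Suc n) < x) sequentially"
        proof -
          have "eventually (\<lambda>n. - x < real n) sequentially" by (rule eventually_gt_at_top[THEN filterlim_real_sequentially[unfolded filterlim_iff, rule_format]])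
          thus ?thesis by eventually_elim auto
        qed
        have 2: "eventually (\<lambda>n. sgn (b + 1 / real (Suc n) - x) = (if x \<le> b then 1 else - 1)) sequentially"
        proof (cases "x \<le> b")
          case True
          have "b + 1 / real (Suc n) - x > 0" for n using True by (smt (verit) divide_pos_pos of_nat_0_less_iff zero_less_Suc)
          thus ?thesis using True by simp
        next
          case False
          have "eventually (\<lambda>n. 1 / real (Suc n) < x - b) sequentially"
            using order_tendstoD(2)[OF LIMSEQ_inverse_real_of_nat, of "x - b"] False by (simp add: inverse_eq_divide)
          thus ?thesis by eventually_elim (use False in auto)
        qed
        have "eventually (\<lambda>n. h (- real (Suc n)) (b + 1 / real (Suc n)) x = pi * indicator {..b} x) sequentially"
          using 1 2 by eventually_elim (auto simp: h_def indicator_def)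
        thus "(\<lambda>n. h (- real (Suc n)) (b + 1 / real (Suc n)) x) \<longlonglongrightarrow> pi * indicator {..b} x"
          by (rule tendsto_eventually)
      qed
      have "\<bar>(pi / 2) * (sgn u - sgn v)\<bar> \<le> pi" for u v :: real
        by (auto simp: sgn_real_def)
      thus "AE x in \<rho>. norm (h (- real (Suc n)) (b + 1 / real (Suc n)) x) \<le> pi" for n
        unfolding h_def by auto
    qed auto
    thus ?thesis by (simp add: cdf_def)
  qed
  have "cdf \<mu> b = cdf \<nu> b" for b
  proof -
    have ev: "eventually (\<lambda>n. integral\<^sup>L \<mu> (h (- real (Suc n)) (b + 1 / real (Suc n))) = integral\<^sup>L \<nu> (h (- real (Suc n)) (b + 1 / real (Suc n)))) sequentially"
    proof -
      have "eventually (\<lambda>n. - b < real n) sequentially" by (rule eventually_gt_at_top[THEN filterlim_real_sequentially[unfolded filterlim_iff, rule_format]])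
      thus ?thesis
      proof eventually_elim
        case (elim n)
        have "1 / real (Suc n) > 0" by simp
        with elim have "- real (Suc n) \<le> b + 1 / real (Suc n)" by linarith
        thus ?case by (rule heq)
      qed
    qed
    have "(\<lambda>n. integral\<^sup>L \<nu> (h (- real (Suc n)) (b + 1 / real (Suc n)))) \<longlonglongrightarrow> pi * cdf \<mu> b"
      using Lim_transform_eventually[OF lim2[OF \<mu>, of b] ev] .
    from LIMSEQ_unique[OF this lim2[OF \<nu>, of b]] show ?thesis by simp
  qed
  thus ?thesis by (intro cdf_unique prob_on_R_real_distribution \<mu> \<nu>) auto
qed

section \<open>Analyticity of the Cauchy transform off the support\<close>

lemma integrable_cauchy_kernel:
  assumes \<mu>: "prob_on_R \<mu>" and d: "d > 0" and AE: "AE x in \<mu>. d \<le> cmod (v - of_real x)"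
  shows "integrable \<mu> (\<lambda>x. 1 / (v - complex_of_real x))"
proof (rule prob_on_R_integrable_bounded[OF \<mu>])
  show "AE x in \<mu>. norm (1 / (v - complex_of_real x)) \<le> 1 / d"
    using AE by eventually_elim (use d in \<open>simp add: norm_divide frac_le\<close>)
qed simp

lemma integral_norm_bound_integral_AE:
  fixes f :: "'a \<Rightarrow> 'b::{banach,second_countable_topology}"
  assumes "integrable M f" "integrable M g" "AE x in M. norm (f x) \<le> g x"
  shows "norm (integral\<^sup>L M f) \<le> integral\<^sup>L M g"
  using assms by (intro order_trans[OF integral_norm_bound integral_mono_AE]) auto

text \<open>The remainder of the difference quotient of the kernel is exactly (v - v0) / ((v - x)
  (v0 - x)^2). Only a positive distance from v0 to almost every x enters, so one statement serves
  the upper half-plane and, for measures on R_+, the slit plane.\<close>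

lemma cauchy_transform_field_differentiable:
  assumes \<mu>: "prob_on_R \<mu>" and d: "d > 0" and AE: "AE x in \<mu>. d \<le> cmod (v0 - of_real x)"
  shows "cauchy_transform \<mu> field_differentiable (at v0)"
proof -
  interpret prob_space \<mu> using \<mu> by (simp add: prob_on_R_def)
  define D where "D = (\<integral>x. - 1 / (v0 - complex_of_real x)\<^sup>2 \<partial>\<mu>)"
  have intD: "integrable \<mu> (\<lambda>x. - 1 / (v0 - complex_of_real x)\<^sup>2)"
  proof (rule prob_on_R_integrable_bounded[OF \<mu>])
    show "AE x in \<mu>. norm (- 1 / (v0 - complex_of_real x)\<^sup>2) \<le> 1 / d\<^sup>2"
      using AE by eventually_elim (use d in \<open>simp add: norm_divide norm_power frac_le\<close>)
  qed simp
  have bound: "norm ((cauchy_transform \<mu> v - cauchy_transform \<mu> v0) / (v - v0) - D) \<le> norm (v - v0) * (2 / d ^ 3)"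
    if v: "v \<noteq> v0" "norm (v - v0) < d / 2" for v
  proof -
    have AEv: "AE x in \<mu>. d / 2 \<le> cmod (v - of_real x)"
      using AE
    proof eventually_elim
      case (elim x)
      have "cmod (v0 - of_real x) \<le> cmod (v - of_real x) + cmod (v - v0)"
        using norm_triangle_ineq4[of "v - of_real x" "v - v0"] by (simp add: algebra_simps)
      thus ?case using elim v by linarith
    qed
    have int: "integrable \<mu> (\<lambda>x. 1 / (v - complex_of_real x))" "integrable \<mu> (\<lambda>x. 1 / (v0 - complex_of_real x))"
      using d by (auto intro!: integrable_cauchy_kernel[OF \<mu> _ AEv] integrable_cauchy_kernel[OF \<mu> _ AE])
    have "(cauchy_transform \<mu> v - cauchy_transform \<mu> v0) / (v - v0) - D
      = (\<integral>x. (1 / (v - complex_of_real x) - 1 / (v0 - complex_of_real x)) / (v - v0) - (- 1 / (v0 - complex_of_real x)\<^sup>2) \<partial>\<mu>)"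
      unfolding cauchy_transform_def D_def using int intD by simp
    also have "norm \<dots> \<le> (\<integral>x. norm (v - v0) * (2 / d ^ 3) \<partial>\<mu>)"
    proof (rule integral_norm_bound_integral_AE)
      show "AE x in \<mu>. norm ((1 / (v - complex_of_real x) - 1 / (v0 - complex_of_real x)) / (v - v0) - (- 1 / (v0 - complex_of_real x)\<^sup>2))
         \<le> norm (v - v0) * (2 / d ^ 3)"
        using AE AEv
      proof eventually_elim
        case (elim x)
        have nz: "v - of_real x \<noteq> 0" "v0 - of_real x \<noteq> 0" using elim d by auto
        have "(1 / (v - complex_of_real x) - 1 / (v0 - complex_of_real x)) / (v - v0) - (- 1 / (v0 - complex_of_real x)\<^sup>2)
          = (v - v0) / ((v - of_real x) * (v0 - of_real x)\<^sup>2)"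
          using nz v(1) by (simp add: divide_simps power2_eq_square) (simp add: algebra_simps)
        also have "norm \<dots> = norm (v - v0) / (norm (v - of_real x) * norm (v0 - of_real x) ^ 2)"
          by (simp add: norm_divide norm_mult norm_power)
        also have "\<dots> \<le> norm (v - v0) / ((d / 2) * d ^ 2)"
          using d elim by (intro divide_left_mono mult_mono power_mono mult_pos_pos) (auto intro: order.strict_trans2)
        also have "\<dots> = norm (v - v0) * (2 / d ^ 3)" by (simp add: power3_eq_cube power2_eq_square)
        finally show ?case .
      qed
      show "integrable \<mu> (\<lambda>x. (1 / (v - complex_of_real x) - 1 / (v0 - complex_of_real x)) / (v - v0) - (- 1 / (v0 - complex_of_real x)\<^sup>2))"
        by (intro Bochner_Integration.integrable_diff Bochner_Integration.integrable_divide int intD)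
    qed simp
    finally show ?thesis by (simp add: prob_space)
  qed
  have "((\<lambda>v. (cauchy_transform \<mu> v - cauchy_transform \<mu> v0) / (v - v0) - D) \<longlongrightarrow> 0) (at v0)"
  proof (rule Lim_null_comparison)
    show "\<forall>\<^sub>F v in at v0. norm ((cauchy_transform \<mu> v - cauchy_transform \<mu> v0) / (v - v0) - D) \<le> norm (v - v0) * (2 / d ^ 3)"
      unfolding eventually_at using bound d by (intro exI[of _ "d / 2"]) (auto simp: dist_norm)
    have "((\<lambda>v. norm (v - v0) * (2 / d ^ 3)) \<longlongrightarrow> norm (v0 - v0) * (2 / d ^ 3)) (at v0)"
      by (intro tendsto_intros)
    thus "((\<lambda>v. norm (v - v0) * (2 / d ^ 3)) \<longlongrightarrow> 0) (at v0)" by simp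
  qed
  hence "(cauchy_transform \<mu> has_field_derivative D) (at v0)"
    unfolding has_field_derivative_iff by (simp add: LIM_zero_iff)
  thus ?thesis by (auto simp: field_differentiable_def)
qed

lemma cauchy_transform_holomorphic_upper:
  assumes "prob_on_R \<mu>" shows "cauchy_transform \<mu> holomorphic_on {v. Im v > 0}"
proof -
  have "cauchy_transform \<mu> field_differentiable (at v)" if "Im v > 0" for v
  proof (rule cauchy_transform_field_differentiable[OF assms that])
    have "Im v \<le> cmod (v - of_real x)" for x using abs_Im_le_cmod[of "v - of_real x"] by simp
    thus "AE x in \<mu>. Im v \<le> cmod (v - of_real x)" by simp
  qed
  thus ?thesis by (auto simp: holomorphic_on_def intro: field_differentiable_at_within)
qed

lemma prob_on_Rplus_AE:
  assumes "prob_on_Rplus \<mu>" shows "AE x in \<mu>. x \<ge> 0"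
proof -
  interpret prob_space \<mu> using assms by (simp add: prob_on_Rplus_def prob_on_R_def)
  have "{0..} \<in> sets \<mu>" using assms by (simp add: prob_on_Rplus_def prob_on_R_def)
  hence "AE x in \<mu>. x \<in> {0..}" using assms
    by (intro AE_prob_1) (simp add: prob_on_Rplus_def measure_def)
  thus ?thesis by simp
qed

lemma prob_on_Rplus_imp_prob_on_R: "prob_on_Rplus \<mu> \<Longrightarrow> prob_on_R \<mu>"
  by (simp add: prob_on_Rplus_def)

abbreviation slit_plane :: "complex set" where "slit_plane \<equiv> - complex_of_real ` {0..}"

lemma dist_nonneg_axis:
  assumes "v \<in> slit_plane"
  obtains d where "d > 0" "\<And>x. x \<ge> 0 \<Longrightarrow> d \<le> cmod (v - of_real x)"
proof (cases "Im v = 0")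
  case True
  hence "Re v < 0" using assms by (metis Compl_iff atLeast_iff complex_is_Real_iff imageI linorder_not_le of_real_Re)
  thus ?thesis using that[of "- Re v"] abs_Re_le_cmod[of "v - of_real x" for x]
    by (smt (verit) Re_complex_of_real minus_complex.sel(1))
next
  case False
  thus ?thesis using that[of "\<bar>Im v\<bar>"] abs_Im_le_cmod[of "v - of_real x" for x] by simp
qed

lemma cauchy_transform_holomorphic_slit:
  assumes "prob_on_Rplus \<mu>" shows "cauchy_transform \<mu> holomorphic_on slit_plane"
proof -
  have "cauchy_transform \<mu> field_differentiable (at v)" if v: "v \<in> slit_plane" for v
  proof -
    obtain d where "d > 0" "\<And>x. x \<ge> 0 \<Longrightarrow> d \<le> cmod (v - of_real x)" using dist_nonneg_axis[OF v] by blast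
    thus ?thesis
      using prob_on_Rplus_AE[OF assms] prob_on_Rplus_imp_prob_on_R[OF assms]
      by (intro cauchy_transform_field_differentiable[of _ d]) (auto elim: eventually_mono)
  qed
  thus ?thesis by (auto simp: holomorphic_on_def intro: field_differentiable_at_within)
qed

section \<open>The function v G(v) - 1: relation to Psi and decay in cones\<close>

lemma mult_cauchy_transform_eq:
  assumes \<mu>: "prob_on_R \<mu>" and d: "d > 0" and AE: "AE x in \<mu>. d \<le> cmod (v - of_real x)"
  shows "v * cauchy_transform \<mu> v - 1 = (\<integral>x. of_real x / (v - complex_of_real x) \<partial>\<mu>)"
proof -
  interpret prob_space \<mu> using \<mu> by (simp add: prob_on_R_def)
  have sets: "sets \<mu> = sets borel" using \<mu> by (simp add: prob_on_R_def)
  have "v * cauchy_transform \<mu> v - 1 = (\<integral>x. v * (1 / (v - complex_of_real x)) - 1 \<partial>\<mu>)"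
    unfolding cauchy_transform_def using integrable_cauchy_kernel[OF assms]
    by (simp add: prob_space del: times_divide_eq_right)
  also have "\<dots> = (\<integral>x. of_real x / (v - complex_of_real x) \<partial>\<mu>)"
  proof (rule integral_cong_AE)
    show "AE x in \<mu>. v * (1 / (v - complex_of_real x)) - 1 = of_real x / (v - complex_of_real x)"
      using AE
    proof eventually_elim
      case (elim x)
      have "v - of_real x \<noteq> 0" using elim d by auto
      thus ?case by (simp add: divide_simps)
    qed
  qed (auto simp: measurable_cong_sets[OF sets refl])
  finally show ?thesis .
qed

text \<open>Under z = 1/v the integrands of Psi and of v G(v) - 1 coincide; through this identity
  information on S reaches the Cauchy transform.\<close>

lemma Psi_transform_eq:
  assumes \<mu>: "prob_on_R \<mu>" and d: "d > 0" and AE: "AE x in \<mu>. d \<le> cmod (v - of_real x)" and v: "v \<noteq> 0"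
  shows "Psi_transform \<mu> (1 / v) = v * cauchy_transform \<mu> v - 1"
proof -
  have "complex_of_real x * (1 / v) / (1 - complex_of_real x * (1 / v)) = of_real x / (v - of_real x)" for x
    using v by (simp add: divide_simps)
  thus ?thesis unfolding mult_cauchy_transform_eq[OF assms(1-3)] Psi_transform_def by (simp only:)
qed

lemma Psi_transform_eq_slit:
  assumes \<mu>: "prob_on_Rplus \<mu>" and v: "v \<in> slit_plane"
  shows "Psi_transform \<mu> (1 / v) = v * cauchy_transform \<mu> v - 1"
proof -
  obtain d where "d > 0" "\<And>x. x \<ge> 0 \<Longrightarrow> d \<le> cmod (v - of_real x)" using dist_nonneg_axis[OF v] by blast
  moreover have "v \<noteq> 0" using v by (metis Compl_iff atLeast_iff imageI of_real_0 order_refl)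
  ultimately show ?thesis
    using prob_on_Rplus_AE[OF \<mu>] prob_on_Rplus_imp_prob_on_R[OF \<mu>]
    by (intro Psi_transform_eq[of _ d]) (auto elim: eventually_mono)
qed

text \<open>Takes the place of a first moment divided by b, since no first moment is assumed; the
  truncation makes dominated convergence available. The level 3 is the bound for |x / (v - x)| in
  the cone |Re v| < Im v.\<close>

lemma integral_min_scaled_tendsto_0:
  assumes "prob_on_R \<mu>"
  shows "((\<lambda>b. \<integral>x. min 3 (\<bar>x\<bar> / b) \<partial>\<mu>) \<longlongrightarrow> 0) at_top"
proof -
  interpret prob_space \<mu> using assms by (simp add: prob_on_R_def)
  have [measurable_cong]: "sets \<mu> = sets borel" using assms by (simp add: prob_on_R_def)
  have "((\<lambda>b. \<integral>x. min 3 (\<bar>x\<bar> / b) \<partial>\<mu>) \<longlongrightarrow> (\<integral>x. 0 \<partial>\<mu>)) at_top"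
  proof (rule integral_dominated_convergence_at_top[where w="\<lambda>_. 3"])
    show "AE x in \<mu>. ((\<lambda>b. min 3 (\<bar>x\<bar> / b)) \<longlongrightarrow> 0) at_top"
    proof (rule AE_I2)
      fix x
      have "((\<lambda>b. min 3 (\<bar>x\<bar> / b)) \<longlongrightarrow> min 3 (0::real)) at_top"
      proof (rule tendsto_min[OF tendsto_const])
        show "((\<lambda>b. \<bar>x\<bar> / b) \<longlongrightarrow> 0) at_top"
          by (rule tendsto_divide_0[OF tendsto_const filterlim_at_top_imp_at_infinity[OF filterlim_ident]])
      qed
      thus "((\<lambda>b. min 3 (\<bar>x\<bar> / b)) \<longlongrightarrow> 0) at_top" by simp
    qed
    show "\<forall>\<^sub>F b in at_top. AE x in \<mu>. norm (min 3 (\<bar>x\<bar> / b)) \<le> 3"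
      using eventually_gt_at_top[of 0] by eventually_elim auto
  qed auto
  thus ?thesis by simp
qed

lemma mult_cauchy_transform_cone_limit:
  assumes \<mu>: "prob_on_R \<mu>" and e: "e > 0"
  shows "\<exists>b>0. \<forall>v\<in>trunc_cone 1 b. cmod (v * cauchy_transform \<mu> v - 1) < e"
proof -
  interpret prob_space \<mu> using \<mu> by (simp add: prob_on_R_def)
  have [measurable_cong]: "sets \<mu> = sets borel" using \<mu> by (simp add: prob_on_R_def)
  have "\<forall>\<^sub>F b in at_top. (\<integral>x. min 3 (\<bar>x\<bar> / b) \<partial>\<mu>) < e"
    using order_tendstoD(2)[OF integral_min_scaled_tendsto_0[OF \<mu>] e] .
  hence "\<forall>\<^sub>F b in at_top. b > 0 \<and> (\<integral>x. min 3 (\<bar>x\<bar> / b) \<partial>\<mu>) < e"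
    by (rule eventually_conj[OF eventually_gt_at_top])
  then obtain b where b: "b > 0" "(\<integral>x. min 3 (\<bar>x\<bar> / b) \<partial>\<mu>) < e"
    using eventually_happens'[OF trivial_limit_at_top_linorder] by blast
  have "cmod (v * cauchy_transform \<mu> v - 1) < e" if v: "v \<in> trunc_cone 1 b" for v
  proof -
    have Im: "Im v > b" "\<bar>Re v\<bar> < Im v" using v by (auto simp: trunc_cone_def)
    have nv: "cmod v \<le> 2 * Im v" using cmod_le[of v] Im b by linarith
    have low: "Im v \<le> cmod (v - of_real x)" for x using abs_Im_le_cmod[of "v - of_real x"] by simp
    have kb: "norm (of_real x / (v - complex_of_real x)) \<le> min 3 (\<bar>x\<bar> / b)" for x
    proof -
      have p: "cmod (v - of_real x) > 0" using low[of x] Im b by linarith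
      have "\<bar>x\<bar> \<le> cmod (v - of_real x) + cmod v"
        using norm_triangle_ineq4[of v "v - of_real x"] by simp
      hence "\<bar>x\<bar> \<le> 3 * cmod (v - of_real x)" using low[of x] nv by linarith
      hence "\<bar>x\<bar> / cmod (v - of_real x) \<le> 3" using p by (simp add: divide_simps)
      moreover have "\<bar>x\<bar> / cmod (v - of_real x) \<le> \<bar>x\<bar> / b"
        using p b low[of x] Im by (intro divide_left_mono) auto
      ultimately show ?thesis by (simp add: norm_divide)
    qed
    have "v * cauchy_transform \<mu> v - 1 = (\<integral>x. of_real x / (v - complex_of_real x) \<partial>\<mu>)"
      using Im b low by (intro mult_cauchy_transform_eq[OF \<mu>, of "Im v"]) auto
    also have "norm \<dots> \<le> (\<integral>x. min 3 (\<bar>x\<bar> / b) \<partial>\<mu>)"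
    proof (rule integral_norm_bound_integral_AE)
      show "integrable \<mu> (\<lambda>x. of_real x / (v - complex_of_real x))"
        by (rule prob_on_R_integrable_bounded[OF \<mu>, where B=3]) (use kb in auto)
      show "integrable \<mu> (\<lambda>x. min 3 (\<bar>x\<bar> / b))"
        by (rule prob_on_R_integrable_bounded[OF \<mu>, where B=3]) (use b in auto)
    qed (use kb in auto)
    finally show ?thesis using b by linarith
  qed
  thus ?thesis using b by blast
qed

section \<open>Dilations\<close>

lemma cauchy_transform_dilate:
  assumes "prob_on_R \<mu>" "t > 0"
  shows "cauchy_transform (dilate t \<mu>) v = cauchy_transform \<mu> (v / of_real t) / of_real t"
proof -
  have sets: "sets \<mu> = sets borel" using assms by (simp add: prob_on_R_def)
  have m: "(\<lambda>x. t * x) \<in> measurable \<mu> borel" by (simp add: measurable_cong_sets[OF sets refl])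
  have "cauchy_transform (dilate t \<mu>) v = (\<integral>x. 1 / (v - complex_of_real (t * x)) \<partial>\<mu>)"
    unfolding cauchy_transform_def dilate_def by (rule integral_distr[OF m]) simp
  also have "(\<lambda>x. 1 / (v - complex_of_real (t * x))) = (\<lambda>x. (1 / (v / of_real t - complex_of_real x)) / of_real t)"
  proof
    fix x
    have "v / of_real t - complex_of_real x = (v - complex_of_real (t * x)) / of_real t"
      using assms(2) by (simp add: field_simps)
    thus "1 / (v - complex_of_real (t * x)) = (1 / (v / of_real t - complex_of_real x)) / of_real t"
      using assms(2) by simp
  qed
  finally show ?thesis unfolding cauchy_transform_def by (simp only: integral_divide_zero)
qed

lemma prob_on_R_dilate:
  assumes "prob_on_R \<mu>" shows "prob_on_R (dilate t \<mu>)"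
proof -
  have sets: "sets \<mu> = sets borel" using assms by (simp add: prob_on_R_def)
  have m: "(\<lambda>x. t * x) \<in> measurable \<mu> borel" by (simp add: measurable_cong_sets[OF sets refl])
  thus ?thesis using assms prob_space.prob_space_distr[OF _ m] by (simp add: prob_on_R_def dilate_def)
qed

lemma dilate_dilate:
  assumes "prob_on_R \<mu>" shows "dilate s (dilate t \<mu>) = dilate (s * t) \<mu>"
proof -
  have sets: "sets \<mu> = sets borel" using assms by (simp add: prob_on_R_def)
  have m: "(\<lambda>x. t * x) \<in> measurable \<mu> borel" by (simp add: measurable_cong_sets[OF sets refl])
  show ?thesis unfolding dilate_def by (subst distr_distr[OF _ m]) (auto simp: comp_def fun_eq_iff intro!: arg_cong[where f="distr \<mu> borel"])
qed

lemma dilate_1: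
  assumes "prob_on_R \<mu>" shows "dilate 1 \<mu> = \<mu>"
  using assms distr_id2[of borel \<mu>] by (simp add: dilate_def prob_on_R_def)

section \<open>Lagrange inversion and the Lambert function\<close>

text \<open>For H = X/F this coefficient is the formal residue of H'/H^j, which is 1 for the
  logarithmic derivative (j = 1) and 0 for j > 1, where H'/H^j is itself a derivative. In power
  series terms the series is F^(j-1) - X F' F^(j-2), and its coefficient cancels because (F^(j-1))'
  = (j-1) F' F^(j-2).\<close>

lemma fps_nth_power_times_deriv_divide:
  fixes F :: "'a::field_char_0 fps"
  assumes "fps_nth F 0 \<noteq> 0" and "j \<ge> 1"
  shows "fps_nth (F ^ j * fps_deriv (fps_X * inverse F)) (j - 1) = (if j = 1 then 1 else 0)"
proof -
  have inv: "F * inverse F = 1" "inverse F * F = 1"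
    using assms by (auto simp: mult.commute[of F] inverse_mult_eq_1)
  have d: "fps_deriv (fps_X * inverse F) = inverse F - fps_X * fps_deriv F * inverse F ^ 2"
    using assms by (simp add: fps_inverse_deriv power2_eq_square algebra_simps)
  obtain i where j: "j = Suc i" using assms(2) by (cases j) auto
  have Fj: "F ^ j * inverse F = F ^ i"
    using inv by (simp add: j mult.assoc mult.left_commute[of _ "F ^ i"])
  have e: "F ^ j * fps_deriv (fps_X * inverse F) = F ^ i - fps_X * (fps_deriv F * (F ^ i * inverse F))"
  proof -
    have "F ^ j * (fps_X * fps_deriv F * inverse F ^ 2) = fps_X * (fps_deriv F * ((F ^ j * inverse F) * inverse F))"
      unfolding power2_eq_square by (simp only: mult_ac)
    thus ?thesis unfolding d right_diff_distrib by (simp only: Fj)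
  qed
  show ?thesis
  proof (cases i)
    case 0
    then show ?thesis unfolding e by (simp add: j)
  next
    case (Suc l)
    have F2: "F ^ i * inverse F = F ^ l"
      using inv by (simp add: Suc mult.assoc mult.left_commute[of _ "F ^ l"])
    have pd: "fps_deriv (F ^ i) = of_nat i * fps_deriv F * F ^ l"
      unfolding fps_deriv_power fps_of_nat by (simp add: Suc)
    have "fps_nth (fps_deriv (F ^ i)) l = of_nat i * fps_nth (fps_deriv F * F ^ l) l"
      unfolding pd by (simp only: mult.assoc fps_of_nat[symmetric] fps_mult_left_const_nth)
    hence "of_nat i * fps_nth (F ^ i) i = of_nat i * fps_nth (fps_deriv F * F ^ l) l"
      unfolding fps_deriv_nth using Suc by (simp del: of_nat_Suc power_Suc)
    hence "fps_nth (F ^ i) i = fps_nth (fps_deriv F * F ^ l) l"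
      using Suc by (simp del: of_nat_Suc power_Suc)
    then show ?thesis unfolding e F2 by (simp add: j Suc)
  qed
qed

text \<open>
  With $H = X/F$ and $g$ its compositional inverse, multiply $(g' \circ H)\, H' = 1$ by $F^n$.
  Since $F H = X$, the previous lemma kills every term of the coefficient of $X^{n-1}$ but one.
\<close>

theorem fps_lagrange_inversion:
  fixes F :: "'a::field_char_0 fps"
  assumes F0: "fps_nth F 0 \<noteq> 0" and n: "n \<ge> 1"
  shows "of_nat n * fps_nth (fps_inv (fps_X * inverse F)) n = fps_nth (F ^ n) (n - 1)"
proof -
  define H where "H = fps_X * inverse F"
  define g where "g = fps_inv H"
  have H0: "fps_nth H 0 = 0" and H1: "fps_nth H 1 \<noteq> 0" using F0 by (auto simp: H_def)
  have gH: "g oo H = fps_X" unfolding g_def by (rule fps_inv[OF H0 H1])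
  have FH: "F ^ k * H ^ k = fps_X ^ k" for k
  proof -
    have "F * H = fps_X" using inverse_mult_eq_1'[OF F0] by (simp add: H_def mult.left_commute[of F])
    thus ?thesis by (metis power_mult_distrib)
  qed
  have one: "(fps_deriv g oo H) * fps_deriv H = 1"
    using fps_compose_deriv[OF H0, of g] gH by simp
  \<comment> \<open>Cutting g' after n terms leaves a finite sum. The tail X^n (...) becomes H^n
    (...) under composition and, times F^n, again a multiple of X^n, which is invisible in the
    coefficient of X^(n-1).\<close>
  have split: "fps_deriv g = (\<Sum>k<n. fps_const (of_nat (Suc k) * fps_nth g (Suc k)) * fps_X ^ k)
      + fps_X ^ n * fps_shift n (fps_deriv g)"
  proof (rule fps_ext)
    fix m
    show "fps_nth (fps_deriv g) m = fps_nth ((\<Sum>k<n. fps_const (of_nat (Suc k) * fps_nth g (Suc k)) * fps_X ^ k)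
      + fps_X ^ n * fps_shift n (fps_deriv g)) m"
      by (auto simp: fps_sum_nth fps_X_power_mult_nth fps_X_power_nth if_distrib cong: if_cong)
  qed
  have comp: "fps_deriv g oo H = (\<Sum>k<n. fps_const (of_nat (Suc k) * fps_nth g (Suc k)) * H ^ k)
      + H ^ n * (fps_shift n (fps_deriv g) oo H)"
    by (subst split) (simp add: fps_compose_add_distrib fps_compose_sum_distrib
        fps_compose_mult_distrib[OF H0] fps_compose_power[OF H0, symmetric] fps_X_fps_compose_startby0[OF H0])
  have "F ^ n = F ^ n * ((fps_deriv g oo H) * fps_deriv H)" by (simp add: one)
  also have "\<dots> = (\<Sum>k<n. fps_const (of_nat (Suc k) * fps_nth g (Suc k)) * (F ^ n * H ^ k * fps_deriv H))
      + (F ^ n * H ^ n) * ((fps_shift n (fps_deriv g) oo H) * fps_deriv H)"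
    unfolding comp by (simp add: distrib_left distrib_right sum_distrib_left sum_distrib_right mult_ac)
  also have "\<dots> = (\<Sum>k<n. fps_const (of_nat (Suc k) * fps_nth g (Suc k)) * (fps_X ^ k * (F ^ (n - k) * fps_deriv H)))
      + fps_X ^ n * ((fps_shift n (fps_deriv g) oo H) * fps_deriv H)"
  proof -
    have "F ^ n * H ^ k * fps_deriv H = fps_X ^ k * (F ^ (n - k) * fps_deriv H)" if "k < n" for k
    proof -
      have "F ^ n = F ^ (n - k) * F ^ k" using that by (simp flip: power_add)
      thus ?thesis by (simp add: FH[symmetric] mult_ac)
    qed
    hence "(\<Sum>k<n. fps_const (of_nat (Suc k) * fps_nth g (Suc k)) * (F ^ n * H ^ k * fps_deriv H))
       = (\<Sum>k<n. fps_const (of_nat (Suc k) * fps_nth g (Suc k)) * (fps_X ^ k * (F ^ (n - k) * fps_deriv H)))"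
      by (intro sum.cong) auto
    thus ?thesis by (simp only: FH)
  qed
  finally have Fn: "F ^ n = (\<Sum>k<n. fps_const (of_nat (Suc k) * fps_nth g (Suc k)) * (fps_X ^ k * (F ^ (n - k) * fps_deriv H)))
      + fps_X ^ n * ((fps_shift n (fps_deriv g) oo H) * fps_deriv H)" .
  have "fps_nth (F ^ n) (n - 1) =
    (\<Sum>k<n. of_nat (Suc k) * fps_nth g (Suc k) * fps_nth (F ^ (n - k) * fps_deriv H) (n - 1 - k))"
  proof -
    have "fps_nth (fps_const c * (fps_X ^ k * B)) (n - 1) = c * fps_nth B (n - 1 - k)" if "k < n" for c k and B :: "'a fps"
      using that by (simp add: fps_X_power_mult_nth)
    moreover have "fps_nth (fps_X ^ n * B) (n - 1) = 0" for B :: "'a fps"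
      using n by (simp add: fps_X_power_mult_nth)
    ultimately show ?thesis
      by (subst Fn) (auto simp: fps_sum_nth simp del: of_nat_Suc intro!: sum.cong)
  qed
  also have "\<dots> = (\<Sum>k<n. of_nat (Suc k) * fps_nth g (Suc k) * (if n - k = 1 then 1 else 0))"
  proof (rule sum.cong[OF refl])
    fix k assume "k \<in> {..<n}"
    hence k: "n - 1 - k = (n - k) - 1" "n - k \<ge> 1" by auto
    show "of_nat (Suc k) * fps_nth g (Suc k) * fps_nth (F ^ (n - k) * fps_deriv H) (n - 1 - k)
      = of_nat (Suc k) * fps_nth g (Suc k) * (if n - k = 1 then 1 else 0)"
      unfolding k(1) H_def fps_nth_power_times_deriv_divide[OF F0 k(2)] ..
  qed
  also have "\<dots> = (\<Sum>k\<in>{n - 1}. of_nat (Suc k) * fps_nth g (Suc k))"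
    using n by (intro sum.mono_neutral_cong_right) auto
  also have "\<dots> = of_nat n * fps_nth g n" using n by simp
  finally show ?thesis by (simp add: g_def H_def)
qed

text \<open>The m n are the coefficients of the compositional inverse of X/F, so g has that
  expansion at 0, and the formal equation for the inverse holds for the functions near 0. Used for
  the tree series and for the moment series of the constructed measures.\<close>

lemma lagrange_inversion_eval:
  fixes \<phi> :: "complex \<Rightarrow> complex"
  assumes F: "\<phi> has_fps_expansion F" and F0: "fps_nth F 0 \<noteq> 0"
    and m: "\<And>n. n \<ge> 1 \<Longrightarrow> of_nat n * m n = fps_nth (F ^ n) (n - 1)" and m0: "m 0 = 0"
    and r: "r > 0" and sums: "\<And>z. norm z < r \<Longrightarrow> (\<lambda>n. m n * z ^ n) sums g z"
  shows "\<exists>\<delta>>0. \<forall>z. norm z < \<delta> \<longrightarrow> g z = z * \<phi> (g z)"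
proof -
  define H where "H = fps_X * inverse F"
  have H0: "fps_nth H 0 = 0" and H1: "fps_nth H 1 \<noteq> 0" using F0 by (auto simp: H_def)
  have mi: "fps_nth (fps_inv H) n = m n" for n
  proof (cases "n = 0")
    case True thus ?thesis by (simp add: m0 fps_inv_def)
  next
    case False
    hence n: "n \<ge> 1" by simp
    have "of_nat n * fps_nth (fps_inv H) n = of_nat n * m n"
      using fps_lagrange_inversion[OF F0 n] m[OF n] by (simp add: H_def)
    thus ?thesis using False by simp
  qed
  have "Abs_fps m = fps_inv H" by (rule fps_ext) (simp add: mi)
  moreover have "g has_fps_expansion Abs_fps m"
    using r sums by (intro has_fps_expansionI eventually_nhds_ball[THEN eventually_mono]) auto
  ultimately have g: "g has_fps_expansion fps_inv H" by simp
  have g0: "fps_nth (fps_inv H) 0 = 0" by (simp add: fps_inv_def)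
  have eq: "fps_inv H = fps_X * (F oo fps_inv H)"
  proof -
    have "F * H = fps_X" using inverse_mult_eq_1'[OF F0] by (simp add: H_def mult.left_commute[of F])
    hence "(F oo fps_inv H) * (H oo fps_inv H) = fps_X oo fps_inv H"
      by (simp flip: fps_compose_mult_distrib[OF g0])
    thus ?thesis by (simp add: fps_inv_right[OF H0 H1] fps_X_fps_compose_startby0[OF g0] mult.commute)
  qed
  have "(\<lambda>z. z * (\<phi> \<circ> g) z) has_fps_expansion fps_X * (F oo fps_inv H)"
    by (rule has_fps_expansion_mult[OF has_fps_expansion_fps_X has_fps_expansion_compose[OF F g g0]])
  hence "(\<lambda>z. g z - z * (\<phi> \<circ> g) z) has_fps_expansion (fps_inv H - fps_X * (F oo fps_inv H))"
    by (rule has_fps_expansion_diff[OF g])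
  hence "(\<lambda>z. g z - z * (\<phi> \<circ> g) z) has_fps_expansion 0" using eq by simp
  hence "eventually (\<lambda>z. g z - z * (\<phi> \<circ> g) z = 0) (nhds 0)" by (simp add: has_fps_expansion_0_iff)
  thus ?thesis unfolding eventually_nhds_metric by (auto simp: dist_norm)
qed

text \<open>
  For $w = e^a$ the value $w e^w$ is $e^{a + e^a}$, and the exponential function is a strict
  contraction on the left half-plane.
\<close>

lemma mult_exp_inj_on_unit_disc:
  fixes w1 w2 :: complex
  assumes "norm w1 < 1" "norm w2 < 1" "w1 * exp w1 = w2 * exp w2"
  shows "w1 = w2"
proof (cases "w1 = 0 \<or> w2 = 0")
  case True thus ?thesis using assms(3) by auto
next
  case False
  have "exp (Ln w1 + w1) = exp (Ln w2 + w2)" using False assms(3) by (simp add: exp_add)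
  then obtain n :: int where n: "Ln w1 + w1 = Ln w2 + w2 + (of_int (2 * n) * pi) * \<i>"
    by (auto simp: exp_eq)
  define a where "a = Ln w1"
  \<comment> \<open>Absorbing the period into b keeps exp b = w2 and turns the equation into a + exp
    a = b + exp b.\<close>
  define b where "b = Ln w2 + (of_int (2 * n) * pi) * \<i>"
  have ea: "exp a = w1" using False by (simp add: a_def)
  have eb: "exp b = w2" using False exp_eq[of b "Ln w2"] by (auto simp: b_def)
  have eq: "a - b = exp b - exp a" using n unfolding ea eb by (simp add: a_def b_def algebra_simps)
  have "exp (Re a) < 1" "exp (Re b) < 1" using assms ea eb by (auto simp flip: norm_exp_eq_Re)
  define m where "m = max (Re a) (Re b)"
  have m: "m < 0" using \<open>exp (Re a) < 1\<close> \<open>exp (Re b) < 1\<close> by (simp add: m_def)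
  have "norm (exp b - exp a) \<le> exp m * norm (b - a)"
  proof (rule field_differentiable_bound[where S = "{z. Re z \<le> m}"])
    show "convex {z. Re z \<le> m}" by (rule convex_halfspace_Re_le)
    show "(exp has_field_derivative exp z) (at z within {z. Re z \<le> m})" for z
      by (rule DERIV_exp[THEN has_field_derivative_at_within])
  qed (auto simp: m_def)
  hence "norm (a - b) \<le> exp m * norm (a - b)" unfolding eq[symmetric] by (simp add: norm_minus_commute)
  moreover have "exp m < 1" using m by simp
  ultimately have "norm (a - b) = 0"
    using mult_strict_right_mono[of "exp m" 1 "norm (a - b)"] by (metis linorder_not_less mult_1 norm_ge_zero order_le_less)
  thus ?thesis using ea eb by simp
qed

lemma LambertW0_eqI:
  assumes "norm w < 1" "w * exp w = z"
  shows "LambertW0 z = w"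
  unfolding LambertW0_def using assms mult_exp_inj_on_unit_disc by (intro the_equality) auto

text \<open>The case distinction is needed because the formula would give $0^0 = 1$ for $n = 0$.\<close>

definition tree_coeff :: "real \<Rightarrow> nat \<Rightarrow> real" where
  "tree_coeff \<alpha> n = (if n = 0 then 0 else (\<alpha> * real n) ^ (n - 1) / fact n)"

text \<open>Near 0 this is -W_0(-\<alpha> u)/\<alpha>. For \<alpha> = 1 it is the exponential
  generating function of rooted labelled trees.\<close>

definition tree_fun :: "real \<Rightarrow> complex \<Rightarrow> complex" where
  "tree_fun \<alpha> u = (\<Sum>n. complex_of_real (tree_coeff \<alpha> n) * u ^ n)"

text \<open>A single term of the exponential series is at most its sum. This replaces Stirling's
  formula and gives convergence of the tree series for |u| < 1/(\<alpha> e).\<close>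

lemma power_self_le_fact_exp: "real n ^ n \<le> fact n * exp (real n)"
proof -
  have "(\<lambda>k. real n ^ k / fact k) sums exp (real n)"
    using exp_converges[of "real n"] by (simp add: field_simps)
  hence "(\<Sum>k\<in>{n}. real n ^ k / fact k) \<le> exp (real n)"
    by (intro sum_le_suminf[of _ "{n}", THEN order_trans]) (auto simp: sums_iff)
  thus ?thesis by (simp add: field_simps)
qed

lemma tree_coeff_bound:
  assumes "\<alpha> > 0"
  shows "0 \<le> tree_coeff \<alpha> n" "tree_coeff \<alpha> n \<le> (\<alpha> * exp 1) ^ n / \<alpha>"
proof -
  show "0 \<le> tree_coeff \<alpha> n" using assms by (simp add: tree_coeff_def)
  show "tree_coeff \<alpha> n \<le> (\<alpha> * exp 1) ^ n / \<alpha>"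
  proof (cases n)
    case 0 thus ?thesis using assms by (simp add: tree_coeff_def)
  next
    case (Suc k)
    have "(\<alpha> * real n) ^ k * \<alpha> \<le> (\<alpha> * real n) ^ n"
      using assms Suc by (simp add: mult.commute mult_le_cancel_left1 mult_left_mono)
    also have "\<dots> \<le> \<alpha> ^ n * (fact n * exp (real n))"
      unfolding power_mult_distrib using power_self_le_fact_exp[of n] assms by (intro mult_left_mono) auto
    also have "\<dots> = fact n * (\<alpha> * exp 1) ^ n"
      by (simp add: power_mult_distrib exp_of_nat_mult[symmetric])
    finally show ?thesis using assms Suc
      by (simp add: tree_coeff_def field_simps del: fact_Suc power_Suc of_nat_Suc)
  qed
qed

lemma tree_fun_sums:
  assumes "\<alpha> > 0" "norm u < 1 / (\<alpha> * exp 1)"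
  shows "(\<lambda>n. complex_of_real (tree_coeff \<alpha> n) * u ^ n) sums tree_fun \<alpha> u"
proof -
  have "summable (\<lambda>n. complex_of_real (tree_coeff \<alpha> n) * u ^ n)"
  proof (rule summable_comparison_test')
    show "summable (\<lambda>n. (\<alpha> * exp 1 * norm u) ^ n / \<alpha>)"
      using assms by (intro summable_divide summable_geometric) (auto simp: field_simps abs_mult)
    show "norm (complex_of_real (tree_coeff \<alpha> n) * u ^ n) \<le> (\<alpha> * exp 1 * norm u) ^ n / \<alpha>" for n
      using mult_right_mono[OF tree_coeff_bound(2)[OF assms(1), of n], of "norm u ^ n"] tree_coeff_bound(1)[OF assms(1), of n]
      by (simp add: norm_mult norm_power power_mult_distrib)
  qed
  thus ?thesis unfolding tree_fun_def by (rule summable_sums)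
qed

lemma tree_fun_holomorphic:
  assumes "\<alpha> > 0" shows "tree_fun \<alpha> holomorphic_on ball 0 (1 / (\<alpha> * exp 1))"
  using tree_fun_sums[OF assms] by (intro power_series_holomorphic[where a="\<lambda>n. complex_of_real (tree_coeff \<alpha> n)"]) auto

lemma tree_fun_0 [simp]: "tree_fun \<alpha> 0 = 0"
proof -
  have "(\<lambda>n. complex_of_real (tree_coeff \<alpha> n) * 0 ^ n) = (\<lambda>_. 0)"
    by (auto simp: fun_eq_iff tree_coeff_def power_0_left)
  thus ?thesis unfolding tree_fun_def by simp
qed

text \<open>Lagrange inversion for exp(\<alpha> w): the coefficient of order n - 1 of exp(n \<alpha>
  w) is (n \<alpha>)^(n-1) / (n-1)!.\<close>

lemma tree_fun_eq:
  assumes "\<alpha> > 0"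
  shows "\<exists>\<delta>>0. \<forall>u. norm u < \<delta> \<longrightarrow> tree_fun \<alpha> u = u * exp (of_real \<alpha> * tree_fun \<alpha> u)"
proof (rule lagrange_inversion_eval[where F = "fps_exp (of_real \<alpha>)" and r = "1 / (\<alpha> * exp 1)"])
  show "(\<lambda>u. exp (complex_of_real \<alpha> * u)) has_fps_expansion fps_exp (complex_of_real \<alpha>)"
    by (rule has_fps_expansion_exp)
  fix n :: nat assume n: "n \<ge> 1"
  have "complex_of_real (real n * tree_coeff \<alpha> n) = complex_of_real ((real n * \<alpha>) ^ (n - 1) / fact (n - 1))"
    using n by (cases n) (auto simp: tree_coeff_def field_simps simp del: of_nat_Suc)
  thus "of_nat n * complex_of_real (tree_coeff \<alpha> n) = fps_nth (fps_exp (complex_of_real \<alpha>) ^ n) (n - 1)"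
    by (simp add: fps_exp_power_mult)
qed (use assms tree_fun_sums in \<open>auto simp: tree_coeff_def\<close>)

lemma tree_fun_eventually:
  assumes "\<alpha> > 0"
  obtains r where "r > 0" "continuous_on (ball 0 r) (tree_fun \<alpha>)"
    "\<And>u. norm u < r \<Longrightarrow> u = tree_fun \<alpha> u * exp (- of_real \<alpha> * tree_fun \<alpha> u)"
    "\<And>u. norm u < r \<Longrightarrow> (\<lambda>n. complex_of_real (tree_coeff \<alpha> n) * u ^ n) sums tree_fun \<alpha> u"
    "\<And>u. norm u < r \<Longrightarrow> LambertW0 (- of_real \<alpha> * u) = - of_real \<alpha> * tree_fun \<alpha> u"
proof -
  define r0 where "r0 = 1 / (\<alpha> * exp 1)"
  have r0: "r0 > 0" using assms by (simp add: r0_def)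
  obtain \<delta> where \<delta>: "\<delta> > 0" "\<And>u. norm u < \<delta> \<Longrightarrow> tree_fun \<alpha> u = u * exp (of_real \<alpha> * tree_fun \<alpha> u)"
    using tree_fun_eq[OF assms] by auto
  have cont: "continuous_on (ball 0 r0) (tree_fun \<alpha>)"
    using tree_fun_holomorphic[OF assms] unfolding r0_def by (rule holomorphic_on_imp_continuous_on)
  hence "isCont (tree_fun \<alpha>) 0" using r0 by (simp add: continuous_on_eq_continuous_at)
  hence "tree_fun \<alpha> \<midarrow>0\<rightarrow> 0" by (simp add: isCont_def)
  \<comment> \<open>This radius keeps \<alpha> times the tree function inside the unit disc, where
    \<open>LambertW0\<close> is characterised.\<close>
  then obtain d where d: "d > 0" "\<And>u. u \<noteq> 0 \<Longrightarrow> norm u < d \<Longrightarrow> norm (tree_fun \<alpha> u) < 1 / \<alpha>"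
    using assms LIM_eq[of "tree_fun \<alpha>" 0 0] by (metis diff_zero zero_less_divide_1_iff)
  define r where "r = min r0 (min \<delta> d)"
  show ?thesis
  proof (rule that)
    show "r > 0" using r0 \<delta>(1) d(1) by (simp add: r_def)
    show "continuous_on (ball 0 r) (tree_fun \<alpha>)" by (rule continuous_on_subset[OF cont]) (auto simp: r_def)
    fix u :: complex assume u: "norm u < r"
    show e: "u = tree_fun \<alpha> u * exp (- of_real \<alpha> * tree_fun \<alpha> u)"
    proof -
      have "tree_fun \<alpha> u = u * exp (of_real \<alpha> * tree_fun \<alpha> u)" using \<delta>(2) u by (simp add: r_def)
      hence "tree_fun \<alpha> u * exp (- of_real \<alpha> * tree_fun \<alpha> u)
        = u * (exp (of_real \<alpha> * tree_fun \<alpha> u) * exp (- of_real \<alpha> * tree_fun \<alpha> u))"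
        by (metis mult.assoc)
      thus ?thesis by (simp flip: exp_add)
    qed
    show "(\<lambda>n. complex_of_real (tree_coeff \<alpha> n) * u ^ n) sums tree_fun \<alpha> u"
      using u by (intro tree_fun_sums assms) (auto simp: r_def r0_def)
    show "LambertW0 (- of_real \<alpha> * u) = - of_real \<alpha> * tree_fun \<alpha> u"
    proof (rule LambertW0_eqI)
      show "norm (- complex_of_real \<alpha> * tree_fun \<alpha> u) < 1"
        using d(2)[of u] u assms by (cases "u = 0") (auto simp: norm_mult field_simps r_def)
      show "- complex_of_real \<alpha> * tree_fun \<alpha> u * exp (- complex_of_real \<alpha> * tree_fun \<alpha> u) = - complex_of_real \<alpha> * u"
        by (subst (3) e) simp
    qed
  qed
qed

section \<open>The functional equation of the Cauchy transform\<close>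

text \<open>
  For $t = 1$ this is the functional equation of the measure with S-transform $e^{-\beta z}$, for
  other $t$ that of its additive power with exponent $t$.
\<close>

definition cauchy_fe_at :: "real \<Rightarrow> real \<Rightarrow> real measure \<Rightarrow> complex \<Rightarrow> bool" where
  "cauchy_fe_at \<beta> t \<mu> v \<longleftrightarrow> (let \<eta> = (v * cauchy_transform \<mu> v - 1) / of_real t
     in cauchy_transform \<mu> v = \<eta> * exp (- of_real \<beta> * \<eta>))"

text \<open>The inverse of G will have the form w (1 + s) with small s, and such factors must not
  leave the cone. In the narrower cone |w| \<le> c Im w, so the choice of \<delta> gives (1 + a) |w
  s| \<le> Im w / 4, which the doubled parameters absorb.\<close>

lemma trunc_cone_perturb:
  assumes "a > 0" "b > 0"
  shows "\<exists>\<delta>>0. \<forall>w\<in>trunc_cone (2 * a) (2 * b). \<forall>s. cmod s \<le> \<delta> \<longrightarrow> w * (1 + s) \<in> trunc_cone a b"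
proof (intro exI conjI ballI allI impI)
  define c where "c = 1 + 1 / (2 * a)"
  have c: "c > 0" using assms by (simp add: c_def add_pos_pos)
  show "1 / (4 * (1 + a) * c) > 0" using assms c by simp
  fix w s :: complex
  assume w: "w \<in> trunc_cone (2 * a) (2 * b)" and s: "cmod s \<le> 1 / (4 * (1 + a) * c)"
  have I: "Im w > 2 * b" "2 * a * \<bar>Re w\<bar> < Im w" using w by (auto simp: trunc_cone_def)
  have "\<bar>Re w\<bar> \<le> Im w / (2 * a)" using I assms by (simp add: field_simps)
  hence nw: "cmod w \<le> c * Im w" using cmod_le[of w] I assms by (simp add: c_def algebra_simps)
  have "cmod (w * s) \<le> (c * Im w) * (1 / (4 * (1 + a) * c))"
    unfolding norm_mult using nw s I assms c by (intro mult_mono) auto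
  also have "\<dots> = Im w / (4 * (1 + a))" using c by simp
  finally have "(1 + a) * cmod (w * s) \<le> Im w / 4" using assms by (simp add: field_simps)
  hence ws: "cmod (w * s) + a * cmod (w * s) \<le> Im w / 4" by (simp add: algebra_simps)
  have nn: "0 \<le> a * cmod (w * s)" using assms by simp
  have "a * \<bar>Re (w * s)\<bar> \<le> a * cmod (w * s)" "\<bar>Im (w * s)\<bar> \<le> cmod (w * s)"
    using abs_Re_le_cmod[of "w * s"] abs_Im_le_cmod[of "w * s"] assms by (simp_all add: mult_left_mono del: times_complex.sel)
  moreover have "a * \<bar>Re w + Re (w * s)\<bar> \<le> a * \<bar>Re w\<bar> + a * \<bar>Re (w * s)\<bar>"
    using assms abs_triangle_ineq[of "Re w" "Re (w * s)"] by (metis distrib_left mult_left_mono order_less_imp_le)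
  ultimately have "Im w + Im (w * s) > b" "a * \<bar>Re w + Re (w * s)\<bar> < Im w + Im (w * s)"
    using I ws nn assms by linarith+
  moreover have "w * (1 + s) = w + w * s" by (simp add: algebra_simps)
  ultimately show "w * (1 + s) \<in> trunc_cone a b" by (simp add: trunc_cone_def)
qed

lemma trunc_cone_mono: "w \<in> trunc_cone a b \<Longrightarrow> a' \<le> a \<Longrightarrow> b' \<le> b \<Longrightarrow> w \<in> trunc_cone a' b'"
  unfolding trunc_cone_def by (auto intro: le_less_trans[OF mult_right_mono])

lemma trunc_cone_norm_inverse:
  assumes "w \<in> trunc_cone a b" "b > 0"
  shows "cmod (1 / w) < 1 / b" "w \<noteq> 0"
proof -
  have "b < cmod w" using assms abs_Im_le_cmod[of w] by (auto simp: trunc_cone_def)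
  thus "cmod (1 / w) < 1 / b" "w \<noteq> 0" using assms by (auto simp: norm_divide intro!: divide_strict_left_mono mult_pos_pos)
qed

text \<open>Put \<eta> = (v G(v) - 1)/t. The functional equation gives K(\<eta>) = G(v) / (v G(v)) =
  1/v. For v = w (1 + t T(1/w)) the equation of T gives K(T(1/w)) = 1/v too, and K is injective near
  0; hence \<eta> = T(1/w) and G(v) = 1/w. Injectivity of G follows from that of z e^z on the unit
  disc: G(v) determines \<eta>, and then v = (1 + t \<eta>) / G(v).\<close>

lemma cauchy_fe_inverse:
  assumes \<mu>: "prob_on_R \<mu>" and fe: "\<forall>v. Im v > 0 \<longrightarrow> cauchy_fe_at \<beta> t \<mu> v"
    and t: "t > 0" and \<beta>: "\<beta> > 0"
  obtains b c where "b > 0" "c > 0" "inj_on (cauchy_transform \<mu>) (trunc_cone 1 b)"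
    "\<forall>w\<in>trunc_cone 2 c. w * (1 + of_real t * tree_fun \<beta> (1 / w)) \<in> trunc_cone 1 b"
    "\<forall>w\<in>trunc_cone 2 c. cauchy_transform \<mu> (w * (1 + of_real t * tree_fun \<beta> (1 / w))) = 1 / w"
    "\<forall>w\<in>trunc_cone 2 c. isCont (tree_fun \<beta>) (1 / w)"
proof -
  define T where "T = tree_fun \<beta>"
  obtain r where r: "r > 0" "continuous_on (ball 0 r) T" "\<And>u. cmod u < r \<Longrightarrow> u = T u * exp (- of_real \<beta> * T u)"
    unfolding T_def by (rule tree_fun_eventually[OF \<beta>]) blast
  have cont: "isCont T u" if "cmod u < r" for u using r that by (simp add: continuous_on_eq_continuous_at)
  have T: "isCont T 0" "T 0 = 0" using cont[of 0] r(1) by (auto simp: T_def)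
  define K where "K \<eta> = \<eta> * exp (- of_real \<beta> * \<eta>) / (1 + of_real t * \<eta>)" for \<eta> :: complex
  have nz: "1 + of_real t * \<eta> \<noteq> 0" if "cmod \<eta> < 1 / t" for \<eta> :: complex
  proof
    assume "1 + of_real t * \<eta> = 0"
    hence "cmod (of_real t * \<eta>) = cmod (- 1 :: complex)" by (metis add_eq_0_iff2 add.commute)
    thus False using that t by (simp add: norm_mult field_simps)
  qed
  have Kd: "(K has_field_derivative 1) (at 0)"
    unfolding K_def using t by (auto intro!: derivative_eq_intros)
  have "K holomorphic_on ball 0 (1 / t)"
    unfolding K_def by (intro holomorphic_intros) (use nz in auto)
  moreover have "0 \<in> ball 0 (1 / t)" "deriv K 0 \<noteq> 0" using t DERIV_imp_deriv[OF Kd] by simp_all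
  ultimately obtain r0 where r0: "r0 > 0" "ball 0 r0 \<subseteq> ball (0::complex) (1 / t)" "inj_on K (ball 0 r0)"
    by (rule has_complex_derivative_locally_injective[where f = K and \<xi> = 0 and S = "ball 0 (1 / t)", OF _ _ open_ball]) (rule that)
  \<comment> \<open>The three bounds put \<eta> into the disc where K is injective, keep G away from
    0, and put \<beta> \<eta> into the unit disc.\<close>
  define e where "e = min (t * r0) (min (1 / 2) (t / \<beta>))"
  have e: "e > 0" using t \<beta> r0 by (simp add: e_def)
  obtain b where b: "b > 0" "\<And>v. v \<in> trunc_cone 1 b \<Longrightarrow> cmod (v * cauchy_transform \<mu> v - 1) < e"
    using mult_cauchy_transform_cone_limit[OF \<mu> e] by blast
  define \<eta> where "\<eta> v = (v * cauchy_transform \<mu> v - 1) / of_real t" for v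
  have \<eta>: "cmod (\<eta> v) < r0" "cmod (\<beta> * \<eta> v) < 1" "v * cauchy_transform \<mu> v = 1 + of_real t * \<eta> v"
      "cauchy_transform \<mu> v = \<eta> v * exp (- of_real \<beta> * \<eta> v)" "cauchy_transform \<mu> v \<noteq> 0" "v \<noteq> 0"
    if v: "v \<in> trunc_cone 1 b" for v
  proof -
    have 1: "cmod (v * cauchy_transform \<mu> v - 1) < t * r0" "cmod (v * cauchy_transform \<mu> v - 1) < 1 / 2"
       "cmod (v * cauchy_transform \<mu> v - 1) < t / \<beta>"
      using b(2)[OF v] by (auto simp: e_def)
    show "cmod (\<eta> v) < r0" using 1 t \<beta> by (simp add: \<eta>_def norm_divide divide_simps mult.commute)
    have "cmod (\<beta> * \<eta> v) = \<beta> * cmod (v * cauchy_transform \<mu> v - 1) / t"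
      unfolding norm_mult \<eta>_def norm_divide using \<beta> t by simp
    also have "\<dots> < 1" using 1(3) t \<beta> by (simp add: divide_simps mult.commute)
    finally show "cmod (\<beta> * \<eta> v) < 1" .
    show "v * cauchy_transform \<mu> v = 1 + of_real t * \<eta> v" using t by (simp add: \<eta>_def)
    have "Im v > 0" using v b by (auto simp: trunc_cone_def)
    from fe this have "cauchy_fe_at \<beta> t \<mu> v" by blast
    thus "cauchy_transform \<mu> v = \<eta> v * exp (- of_real \<beta> * \<eta> v)"
      by (simp add: cauchy_fe_at_def \<eta>_def Let_def)
    show "cauchy_transform \<mu> v \<noteq> 0" using 1(2) by auto
    show "v \<noteq> 0" using \<open>Im v > 0\<close> by auto
  qed
  obtain \<delta> where \<delta>: "\<delta> > 0" "\<And>w s. w \<in> trunc_cone (2 * 1) (2 * b) \<Longrightarrow> cmod s \<le> \<delta> \<Longrightarrow> w * (1 + s) \<in> trunc_cone 1 b"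
    using trunc_cone_perturb[OF zero_less_one b(1)] by blast
  define m where "m = min (r0 / 2) (\<delta> / t)"
  have m: "m > 0" using r0 \<delta> t by (simp add: m_def)
  obtain d where d: "d > 0" "\<And>u. cmod u < d \<Longrightarrow> cmod (T u) < m"
    using T(1) m unfolding continuous_at_eps_delta by (auto simp: T(2) dist_norm)
  define c where "c = max (2 * b) (1 / min d r)"
  have c: "c > 0" "2 * b \<le> c" "1 / c \<le> d" "1 / c \<le> r"
  proof -
    have "1 / c \<le> 1 / (1 / min d r)" using d(1) r(1) b(1) by (intro divide_left_mono mult_pos_pos) (auto simp: c_def less_max_iff_disj)
    thus "1 / c \<le> d" "1 / c \<le> r" by auto
  qed (use b in \<open>auto simp: c_def\<close>)
  have main: "w * (1 + of_real t * T (1 / w)) \<in> trunc_cone 1 b"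
      "cauchy_transform \<mu> (w * (1 + of_real t * T (1 / w))) = 1 / w" "isCont T (1 / w)" if w: "w \<in> trunc_cone 2 c" for w
  proof -
    define u where "u = 1 / w"
    have u: "cmod u < d" "cmod u < r" "w \<noteq> 0"
      using trunc_cone_norm_inverse[OF w c(1)] c by (auto simp: u_def)
    show "isCont T (1 / w)" using cont u(2) by (simp add: u_def)
    have Tu: "cmod (T u) < r0" "cmod (of_real t * T u) \<le> \<delta>"
      using d(2)[OF u(1)] t r0(1) by (auto simp: m_def norm_mult field_simps)
    define v where "v = w * (1 + of_real t * T u)"
    have "w \<in> trunc_cone (2 * 1) (2 * b)" using trunc_cone_mono[OF w, of 2 "2 * b"] c by simp
    hence v: "v \<in> trunc_cone 1 b" unfolding v_def using Tu by (intro \<delta>(2))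
    thus "w * (1 + of_real t * T (1 / w)) \<in> trunc_cone 1 b" by (simp add: v_def u_def)
    have "K (\<eta> v) = cauchy_transform \<mu> v / (v * cauchy_transform \<mu> v)"
      unfolding K_def \<eta>(3)[OF v] by (subst \<eta>(4)[OF v, symmetric]) simp
    also have "\<dots> = 1 / v" using \<eta>(5)[OF v] by simp
    also have "\<dots> = u / (1 + of_real t * T u)" using u(3) by (simp add: v_def u_def)
    also have "\<dots> = K (T u)" unfolding K_def using r(3)[OF u(2)] by metis
    finally have "\<eta> v = T u" using inj_onD[OF r0(3)] \<eta>(1)[OF v] Tu(1) by auto
    hence "cauchy_transform \<mu> v = T u * exp (- of_real \<beta> * T u)" using \<eta>(4)[OF v] by simp
    also have "\<dots> = u" using r(3)[OF u(2)] by simp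
    finally show "cauchy_transform \<mu> (w * (1 + of_real t * T (1 / w))) = 1 / w" by (simp add: v_def u_def)
  qed
  have inj: "inj_on (cauchy_transform \<mu>) (trunc_cone 1 b)"
  proof (rule inj_onI)
    fix v1 v2 assume v: "v1 \<in> trunc_cone 1 b" "v2 \<in> trunc_cone 1 b" and eq: "cauchy_transform \<mu> v1 = cauchy_transform \<mu> v2"
    have "- of_real \<beta> * \<eta> v1 = - of_real \<beta> * \<eta> v2"
    proof (rule mult_exp_inj_on_unit_disc)
      show "cmod (- of_real \<beta> * \<eta> v1) < 1" "cmod (- of_real \<beta> * \<eta> v2) < 1"
        using \<eta>(2)[OF v(1)] \<eta>(2)[OF v(2)] by (simp_all only: mult_minus_left norm_minus_cancel)
      have "\<eta> v1 * exp (- of_real \<beta> * \<eta> v1) = \<eta> v2 * exp (- of_real \<beta> * \<eta> v2)"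
        using eq \<eta>(4)[OF v(1)] \<eta>(4)[OF v(2)] by metis
      thus "- of_real \<beta> * \<eta> v1 * exp (- of_real \<beta> * \<eta> v1) = - of_real \<beta> * \<eta> v2 * exp (- of_real \<beta> * \<eta> v2)"
        by (simp only: mult.assoc)
    qed
    hence "\<eta> v1 = \<eta> v2" using \<beta> by simp
    hence "v1 * cauchy_transform \<mu> v1 = v2 * cauchy_transform \<mu> v1" using \<eta>(3)[OF v(1)] \<eta>(3)[OF v(2)] eq by simp
    thus "v1 = v2" using \<eta>(5)[OF v(1)] by simp
  qed
  show ?thesis using that[OF b(1) c(1) inj] main unfolding T_def by blast
qed

text \<open>Points 1/w with w in a truncated cone are nonzero and as small as desired, so comparison
  with the tree function on a punctured disc suffices. The Lambert form, the tree series, its real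
  multiples and the Levy integral are all treated this way.\<close>

lemma R_transform_relI:
  assumes \<mu>: "prob_on_R \<mu>" and fe: "\<forall>v. Im v > 0 \<longrightarrow> cauchy_fe_at \<beta> t \<mu> v"
    and t: "t > 0" and \<beta>: "\<beta> > 0"
    and R: "r > 0" "\<And>u. u \<noteq> 0 \<Longrightarrow> cmod u < r \<Longrightarrow> R u = of_real t * tree_fun \<beta> u"
  shows "R_transform_rel \<mu> R"
proof -
  obtain b c where bc: "b > 0" "c > 0" "inj_on (cauchy_transform \<mu>) (trunc_cone 1 b)"
    "\<forall>w\<in>trunc_cone 2 c. w * (1 + of_real t * tree_fun \<beta> (1 / w)) \<in> trunc_cone 1 b"
    "\<forall>w\<in>trunc_cone 2 c. cauchy_transform \<mu> (w * (1 + of_real t * tree_fun \<beta> (1 / w))) = 1 / w"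
    "\<forall>w\<in>trunc_cone 2 c. isCont (tree_fun \<beta>) (1 / w)"
    by (rule cauchy_fe_inverse[OF \<mu> fe t \<beta>]) (rule that)
  define c' where "c' = max c (1 / r)"
  have c': "c' > 0" using bc by (simp add: c'_def)
  have "1 / c' \<le> 1 / (1 / r)" using R(1) bc(2) by (intro divide_left_mono mult_pos_pos) (auto simp: c'_def less_max_iff_disj)
  hence "1 / c' \<le> r" by simp
  show ?thesis unfolding R_transform_rel_def
  proof (intro exI conjI ballI)
    show "inj_on (cauchy_transform \<mu>) (trunc_cone 1 b)" by fact
    fix w assume w: "w \<in> trunc_cone 2 c'"
    hence w2: "w \<in> trunc_cone 2 c" by (rule trunc_cone_mono) (auto simp: c'_def)
    have "cmod (1 / w) < r" "w \<noteq> 0" using trunc_cone_norm_inverse[OF w c'] \<open>1 / c' \<le> r\<close> by auto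
    hence "R (1 / w) = 1 / w * (w * (1 + of_real t * tree_fun \<beta> (1 / w))) - 1" using R(2)[of "1 / w"] by simp
    thus "\<exists>v\<in>trunc_cone 1 b. cauchy_transform \<mu> v = 1 / w \<and> R (1 / w) = 1 / w * v - 1"
      using bc(4,5) w2 by blast
  qed (use bc c' in auto)
qed

section \<open>Analytic continuation and uniqueness of additive powers\<close>

lemma cauchy_fe_identity:
  assumes hol: "cauchy_transform \<mu> holomorphic_on S" and S: "open S" "connected S"
    and U: "U \<subseteq> S" "\<xi> \<in> S" "\<xi> islimpt U" and fe: "\<And>v. v \<in> U \<Longrightarrow> cauchy_fe_at \<beta> 1 \<mu> v" and v: "v \<in> S"
  shows "cauchy_fe_at \<beta> 1 \<mu> v"
proof -
  define f where "f v = cauchy_transform \<mu> v - (v * cauchy_transform \<mu> v - 1) * exp (- of_real \<beta> * (v * cauchy_transform \<mu> v - 1))" for v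
  have iff: "cauchy_fe_at \<beta> 1 \<mu> v \<longleftrightarrow> f v = 0" for v by (simp add: cauchy_fe_at_def f_def Let_def)
  have "f holomorphic_on S" unfolding f_def by (intro holomorphic_intros hol)
  from analytic_continuation[OF this S U _ v] fe show ?thesis by (simp add: iff)
qed

lemma cauchy_transform_unique_on_image:
  assumes \<mu>: "prob_on_R \<mu>" and \<nu>: "prob_on_R \<nu>"
    and U: "\<xi> islimpt U" "Im \<xi> > 0" "\<And>v. v \<in> U \<Longrightarrow> Im v > 0"
    and eq: "\<And>v. v \<in> U \<Longrightarrow> cauchy_transform \<mu> v = cauchy_transform \<nu> v"
  shows "\<mu> = \<nu>"
proof (rule cauchy_transform_eq_imp_eq[OF \<mu> \<nu>])
  fix v :: complex assume "Im v > 0"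
  have "(\<lambda>v. cauchy_transform \<mu> v - cauchy_transform \<nu> v) holomorphic_on {v. Im v > 0}"
    by (intro holomorphic_intros cauchy_transform_holomorphic_upper \<mu> \<nu>)
  from analytic_continuation[OF this open_halfspace_Im_gt convex_connected[OF convex_halfspace_Im_gt], of U \<xi> v]
  have "cauchy_transform \<mu> v - cauchy_transform \<nu> v = 0" using U eq \<open>Im v > 0\<close> by auto
  thus "cauchy_transform \<mu> v = cauchy_transform \<nu> v" by simp
qed

text \<open>The R witnessing the power is known only through some inverse branch of the Cauchy
  transform of y on some cone. Injectivity on that cone forces R(1/w) = T(1/w) for w high enough, so
  the transforms of \<rho> and \<mu> agree at all points w (1 + t T(1/w)). These accumulate in the
  upper half-plane, and the identity theorem with Stieltjes inversion finishes.\<close>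

lemma free_add_power_unique:
  assumes y: "prob_on_R y" "\<forall>v. Im v > 0 \<longrightarrow> cauchy_fe_at \<beta> 1 y v"
    and \<mu>: "prob_on_R \<mu>" "\<forall>v. Im v > 0 \<longrightarrow> cauchy_fe_at \<beta> t \<mu> v"
    and t: "t > 0" and \<beta>: "\<beta> > 0" and \<rho>: "free_add_power y t \<rho>"
  shows "\<rho> = \<mu>"
proof -
  obtain r1 where r1: "r1 > 0" "continuous_on (ball 0 r1) (tree_fun \<beta>)"
    by (rule tree_fun_eventually[OF \<beta>])
  have cont0: "isCont (tree_fun \<beta>) 0" using r1 by (simp add: continuous_on_eq_continuous_at)
  obtain b c where bc: "b > 0" "c > 0" "inj_on (cauchy_transform y) (trunc_cone 1 b)"
    "\<forall>w\<in>trunc_cone 2 c. w * (1 + of_real 1 * tree_fun \<beta> (1 / w)) \<in> trunc_cone 1 b"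
    "\<forall>w\<in>trunc_cone 2 c. cauchy_transform y (w * (1 + of_real 1 * tree_fun \<beta> (1 / w))) = 1 / w"
    "\<forall>w\<in>trunc_cone 2 c. isCont (tree_fun \<beta>) (1 / w)"
    by (rule cauchy_fe_inverse[OF y zero_less_one \<beta>]) (rule that)
  obtain b' c' where bc': "b' > 0" "c' > 0" "inj_on (cauchy_transform \<mu>) (trunc_cone 1 b')"
    "\<forall>w\<in>trunc_cone 2 c'. w * (1 + of_real t * tree_fun \<beta> (1 / w)) \<in> trunc_cone 1 b'"
    "\<forall>w\<in>trunc_cone 2 c'. cauchy_transform \<mu> (w * (1 + of_real t * tree_fun \<beta> (1 / w))) = 1 / w"
    "\<forall>w\<in>trunc_cone 2 c'. isCont (tree_fun \<beta>) (1 / w)"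
    by (rule cauchy_fe_inverse[OF \<mu> t \<beta>]) (rule that)
  from \<rho> obtain R where \<rho>R: "prob_on_R \<rho>" "R_transform_rel y R" "R_transform_rel \<rho> (\<lambda>z. of_real t * R z)"
    by (auto simp: free_add_power_def)
  from \<rho>R(2) obtain a1 b1 a1' b1' where 1: "a1 > 0" "b1 > 0" "inj_on (cauchy_transform y) (trunc_cone a1 b1)"
    "\<And>w. w \<in> trunc_cone a1' b1' \<Longrightarrow> \<exists>v\<in>trunc_cone a1 b1. cauchy_transform y v = 1 / w \<and> R (1 / w) = (1 / w) * v - 1"
    unfolding R_transform_rel_def by blast
  from \<rho>R(3) obtain a2 b2 a2' b2' where 2: "a2 > 0" "b2 > 0"
    "\<And>w. w \<in> trunc_cone a2' b2' \<Longrightarrow> \<exists>v\<in>trunc_cone a2 b2. cauchy_transform \<rho> v = 1 / w \<and> of_real t * R (1 / w) = (1 / w) * v - 1"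
    unfolding R_transform_rel_def by blast
  obtain \<delta> where \<delta>: "\<delta> > 0" "\<And>w s. w \<in> trunc_cone (2 * a1) (2 * b1) \<Longrightarrow> cmod s \<le> \<delta> \<Longrightarrow> w * (1 + s) \<in> trunc_cone a1 b1"
    using trunc_cone_perturb[OF 1(1,2)] by blast
  obtain d where d: "d > 0" "\<And>u. cmod u < d \<Longrightarrow> cmod (tree_fun \<beta> u) < \<delta>"
    using cont0 \<delta>(1) unfolding continuous_at_eps_delta by (auto simp: dist_norm)
  \<comment> \<open>A cone inside all those provided so far. The summand 1/d of B makes T(1/w) so
    small that w (1 + T(1/w)) stays in the cone where the Cauchy transform of y is
    injective.\<close>
  define A where "A = 2 + 2 * a1 + \<bar>a1'\<bar> + \<bar>a2'\<bar>"
  define B where "B = c + c' + 2 * b1 + \<bar>b1'\<bar> + \<bar>b2'\<bar> + 1 / d"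
  have A: "2 \<le> A" "2 * a1 \<le> A" "a1' \<le> A" "a2' \<le> A" unfolding A_def using 1(1) by linarith+
  have B: "c \<le> B" "c' \<le> B" "2 * b1 \<le> B" "b1' \<le> B" "b2' \<le> B" "1 / d \<le> B" unfolding B_def using 1(2) bc(2) bc'(2) d(1) zero_less_divide_1_iff[of d] by linarith+
  have Bpos: "B > 0" using B bc by linarith
  define V where "V w = w * (1 + of_real t * tree_fun \<beta> (1 / w))" for w
  have V: "cauchy_transform \<rho> (V w) = 1 / w" "cauchy_transform \<mu> (V w) = 1 / w" "Im (V w) > 0" "isCont (tree_fun \<beta>) (1 / w)"
    if w: "w \<in> trunc_cone A B" for w
  proof -
    have w1: "w \<in> trunc_cone 2 c" "w \<in> trunc_cone 2 c'" "w \<in> trunc_cone (2 * a1) (2 * b1)"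
       "w \<in> trunc_cone a1' b1'" "w \<in> trunc_cone a2' b2'" using trunc_cone_mono[OF w] A B by auto
    have "cmod (1 / w) < 1 / B" "w \<noteq> 0" using trunc_cone_norm_inverse[OF w Bpos] .
    moreover have "1 / B \<le> d" using B(6) d(1) Bpos by (simp add: field_simps)
    ultimately have u: "cmod (1 / w) < d" "w \<noteq> 0" by auto
    show "isCont (tree_fun \<beta>) (1 / w)" using bc'(6) w1(2) by blast
    have v': "w * (1 + tree_fun \<beta> (1 / w)) \<in> trunc_cone a1 b1" using \<delta>(2)[OF w1(3)] d(2)[OF u(1)] by simp
    obtain v where v: "v \<in> trunc_cone a1 b1" "cauchy_transform y v = 1 / w" "R (1 / w) = (1 / w) * v - 1"
      using 1(4)[OF w1(4)] by blast
    have "cauchy_transform y v = cauchy_transform y (w * (1 + tree_fun \<beta> (1 / w)))" using bc(5) w1(1) v(2) by simp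
    hence "v = w * (1 + tree_fun \<beta> (1 / w))" using inj_onD[OF 1(3)] v(1) v' by blast
    hence R: "R (1 / w) = tree_fun \<beta> (1 / w)" using v(3) u(2) by simp
    obtain v2 where v2: "cauchy_transform \<rho> v2 = 1 / w" "of_real t * R (1 / w) = (1 / w) * v2 - 1"
      using 2(3)[OF w1(5)] by blast
    have "v2 = V w" using v2(2) u(2) unfolding R V_def by (simp add: field_simps)
    thus "cauchy_transform \<rho> (V w) = 1 / w" using v2 by simp
    show "cauchy_transform \<mu> (V w) = 1 / w" unfolding V_def using bc'(5) w1(2) by blast
    show "Im (V w) > 0" using bspec[OF bc'(4) w1(2)] bc'(1) by (auto simp: V_def trunc_cone_def)
  qed
  define w0 where "w0 = Complex 0 (B + 1)"
  have wn: "w0 + of_real s * \<i> \<in> trunc_cone A B" if "s \<ge> 0" for s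
    using that Bpos A by (simp add: trunc_cone_def w0_def)
  have w0: "w0 \<in> trunc_cone A B" using wn[of 0] by simp
  have nz: "w0 \<noteq> 0" by (rule trunc_cone_norm_inverse(2)[OF w0 Bpos])
  have c1: "isCont (\<lambda>w. 1 / w) w0" by (rule isCont_divide[OF continuous_const continuous_ident nz])
  have c2: "isCont (\<lambda>w. tree_fun \<beta> (1 / w)) w0" by (rule isCont_o2[OF c1 V(4)[OF w0]])
  have cV: "isCont V w0" unfolding V_def
    by (rule isCont_mult[OF continuous_ident isCont_add[OF continuous_const isCont_mult[OF continuous_const c2]]])
  \<comment> \<open>V is continuous at w0 and injective on the cone, because the transform of \<mu>
    sends V w to 1/w; so nearby points have different images close to V w0.\<close>
  have "V w0 islimpt (V ` trunc_cone A B)"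
    unfolding islimpt_approachable
  proof (intro allI impI)
    fix e :: real assume "e > 0"
    then obtain s where s: "s > 0" "\<And>w. dist w w0 < s \<Longrightarrow> dist (V w) (V w0) < e"
      using cV unfolding continuous_at_eps_delta by blast
    define w where "w = w0 + of_real (s / 2) * \<i>"
    have w: "w \<in> trunc_cone A B" unfolding w_def using s by (intro wn) simp
    have "dist w w0 < s" using s by (simp add: w_def dist_norm norm_mult)
    moreover have "V w \<noteq> V w0"
    proof
      assume "V w = V w0"
      hence "1 / w = 1 / w0" using V(2)[OF w] V(2)[OF w0] by metis
      hence "inverse w = inverse w0" by (simp only: inverse_eq_divide)
      hence "w = w0" by (rule inverse_eq_imp_eq)
      thus False using s(1) by (simp add: w_def)
    qed
    ultimately show "\<exists>x'\<in>V ` trunc_cone A B. x' \<noteq> V w0 \<and> dist x' (V w0) < e" using s(2) w by blast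
  qed
  thus ?thesis using V w0 by (intro cauchy_transform_unique_on_image[OF \<rho>R(1) \<mu>(1)]) auto
qed

text \<open>Dilation by t divides G by t and its argument by t, so v G(v) - 1 only changes its
  argument. Hence D_t of the measure with parameter \<beta>/t solves the equation of the additive
  power with exponent t and parameter \<beta>; this is the content of the duality between both kinds
  of powers.\<close>

lemma cauchy_fe_dilate:
  assumes "prob_on_R \<mu>" "t > 0" "cauchy_fe_at (\<beta> / t) 1 \<mu> (v / of_real t)"
  shows "cauchy_fe_at \<beta> t (dilate t \<mu>) v"
proof -
  define g where "g = cauchy_transform \<mu> (v / of_real t)"
  define p where "p = v / of_real t * g - 1"
  have e: "g = p * exp (- of_real (\<beta> / t) * p)"
    using assms(3) unfolding cauchy_fe_at_def Let_def of_real_1 div_by_1 g_def[symmetric] p_def[symmetric] .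
  have "g / of_real t = p / of_real t * exp (- of_real \<beta> * (p / of_real t))"
  proof -
    have "- complex_of_real (\<beta> / t) * p = - of_real \<beta> * (p / of_real t)" by simp
    with e have "g = p * exp (- of_real \<beta> * (p / of_real t))" by (simp only:)
    hence "g / of_real t = p * exp (- of_real \<beta> * (p / of_real t)) / of_real t" by (rule arg_cong)
    thus ?thesis by simp
  qed
  moreover have "v * (g / of_real t) - 1 = p" by (simp add: p_def)
  ultimately show ?thesis
    unfolding cauchy_fe_at_def Let_def cauchy_transform_dilate[OF assms(1,2)] g_def[symmetric] by simp
qed

section \<open>The S-transform on the negative axis\<close>

text \<open>This is -Psi(-r), with the sign chosen to make it nonnegative on R_+.\<close>

definition psi_neg :: "real measure \<Rightarrow> real \<Rightarrow> real" where
  "psi_neg \<mu> r = (\<integral>x. x * r / (1 + x * r) \<partial>\<mu>)"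

lemma psi_neg_integrand_bounds:
  assumes "(x::real) \<ge> 0" "r \<ge> 0"
  shows "0 \<le> x * r / (1 + x * r)" "x * r / (1 + x * r) \<le> 1" "x * r / (1 + x * r) \<le> x * r"
proof -
  have "0 \<le> x * r" using assms by simp
  thus "0 \<le> x * r / (1 + x * r)" "x * r / (1 + x * r) \<le> 1" "x * r / (1 + x * r) \<le> x * r"
    by (auto simp: divide_simps mult_le_cancel_left1 add_pos_nonneg)
qed

lemma psi_neg_integrable:
  assumes "prob_on_Rplus \<mu>" "r > 0"
  shows "integrable \<mu> (\<lambda>x. x * r / (1 + x * r))"
proof (rule prob_on_R_integrable_bounded[OF prob_on_Rplus_imp_prob_on_R[OF assms(1)]])
  show "AE x in \<mu>. norm (x * r / (1 + x * r)) \<le> 1"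
    using prob_on_Rplus_AE[OF assms(1)] by eventually_elim (use assms(2) psi_neg_integrand_bounds in force)
qed simp

lemma Psi_transform_neg:
  assumes "prob_on_Rplus \<mu>" "r > 0"
  shows "Psi_transform \<mu> (- complex_of_real r) = - complex_of_real (psi_neg \<mu> r)"
proof -
  have "complex_of_real x * - complex_of_real r / (1 - complex_of_real x * - complex_of_real r)
     = complex_of_real (- (x * r / (1 + x * r)))" for x by simp
  hence "Psi_transform \<mu> (- complex_of_real r) = (\<integral>x. complex_of_real (- (x * r / (1 + x * r))) \<partial>\<mu>)"
    unfolding Psi_transform_def by (simp only:)
  also have "\<dots> = complex_of_real (\<integral>x. - (x * r / (1 + x * r)) \<partial>\<mu>)"
    by (rule integral_complex_of_real)
  also have "(\<integral>x. - (x * r / (1 + x * r)) \<partial>\<mu>) = - psi_neg \<mu> r"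
    unfolding psi_neg_def by (rule Bochner_Integration.integral_minus)
  finally show ?thesis by simp
qed

text \<open>Here the exclusion of the point mass at 0 enters: a vanishing integral of a nonnegative
  function would force x = 0 almost surely. Positivity makes -r admissible in the S-relation, which
  requires a nonzero value of Psi.\<close>

lemma psi_neg_pos:
  assumes \<mu>: "prob_on_Rplus \<mu>" and ne: "\<mu> \<noteq> return borel 0" and r: "r > 0"
  shows "psi_neg \<mu> r > 0"
proof (rule ccontr)
  interpret prob_space \<mu> using \<mu> by (simp add: prob_on_Rplus_def prob_on_R_def)
  have sets: "sets \<mu> = sets borel" using \<mu> by (simp add: prob_on_Rplus_def prob_on_R_def)
  note AE = prob_on_Rplus_AE[OF \<mu>]
  have nn: "AE x in \<mu>. 0 \<le> x * r / (1 + x * r)"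
    using AE by eventually_elim (use r psi_neg_integrand_bounds(1) in auto)
  assume "\<not> psi_neg \<mu> r > 0"
  moreover have "psi_neg \<mu> r \<ge> 0" unfolding psi_neg_def by (rule integral_nonneg_AE[OF nn])
  ultimately have "psi_neg \<mu> r = 0" by simp
  hence "AE x in \<mu>. x * r / (1 + x * r) = 0"
    using integral_nonneg_eq_0_iff_AE[OF psi_neg_integrable[OF \<mu> r] nn] by (simp add: psi_neg_def)
  with AE have AE0: "AE x in \<mu>. x = 0"
  proof eventually_elim
    case (elim x)
    have "x * r \<ge> 0" using elim r by simp
    hence "1 + x * r \<noteq> 0" by linarith
    thus "x = 0" using elim r by simp
  qed
  have "\<mu> = return borel 0"
  proof (rule measure_eqI)
    fix A assume A: "A \<in> sets \<mu>"
    have "emeasure \<mu> A = emeasure \<mu> (if 0 \<in> A then space \<mu> else {})"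
      using AE0 A by (intro emeasure_eq_AE) (auto elim!: eventually_mono simp: sets sets_eq_imp_space_eq[OF sets])
    also have "\<dots> = emeasure (return borel 0) A" using A emeasure_space_1 by (simp add: sets)
    finally show "emeasure \<mu> A = emeasure (return borel 0) A" .
  qed (simp add: sets)
  thus False using ne by contradiction
qed

lemma psi_neg_small:
  assumes \<mu>: "prob_on_Rplus \<mu>" and e: "e > 0"
  shows "\<exists>r0>0. \<forall>r. 0 < r \<and> r < r0 \<longrightarrow> psi_neg \<mu> r < e"
proof -
  have "\<forall>\<^sub>F b in at_top. (\<integral>x. min 3 (\<bar>x\<bar> / b) \<partial>\<mu>) < e"
    using order_tendstoD(2)[OF integral_min_scaled_tendsto_0[OF prob_on_Rplus_imp_prob_on_R[OF \<mu>]] e] .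
  then obtain B where B: "\<And>b. b \<ge> B \<Longrightarrow> (\<integral>x. min 3 (\<bar>x\<bar> / b) \<partial>\<mu>) < e"
    unfolding eventually_at_top_linorder by blast
  define r0 where "r0 = 1 / max 1 B"
  have "psi_neg \<mu> r < e" if r: "0 < r" "r < r0" for r
  proof -
    have "1 / r0 < 1 / r" using r by (intro divide_strict_left_mono) auto
    hence b: "1 / r \<ge> B" by (simp add: r0_def)
    have "psi_neg \<mu> r \<le> (\<integral>x. min 3 (\<bar>x\<bar> / (1 / r)) \<partial>\<mu>)" unfolding psi_neg_def
    proof (rule integral_mono_AE)
      show "integrable \<mu> (\<lambda>x. min 3 (\<bar>x\<bar> / (1 / r)))"
        by (rule prob_on_R_integrable_bounded[OF prob_on_Rplus_imp_prob_on_R[OF \<mu>], where B=3]) (use r in auto)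
      show "AE x in \<mu>. x * r / (1 + x * r) \<le> min 3 (\<bar>x\<bar> / (1 / r))"
        using prob_on_Rplus_AE[OF \<mu>]
      proof eventually_elim
        case (elim x)
        show ?case using psi_neg_integrand_bounds[OF elim, of r] r elim by simp
      qed
    qed (rule psi_neg_integrable[OF \<mu> r(1)])
    thus ?thesis using B[OF b] by linarith
  qed
  thus ?thesis by (intro exI[of _ r0]) (auto simp: r0_def)
qed

lemma slit_neg: "r > 0 \<Longrightarrow> - complex_of_real r \<in> slit_plane"
  by (auto simp: complex_eq_iff)

lemma psi_neg_eq_cauchy:
  assumes "prob_on_Rplus \<mu>" "r > 0"
  defines "v \<equiv> - complex_of_real (1 / r)"
  shows "v * cauchy_transform \<mu> v - 1 = - complex_of_real (psi_neg \<mu> r)"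
proof -
  have "1 / v = - complex_of_real r" using assms(2) by (simp add: v_def)
  thus ?thesis using Psi_transform_eq_slit[OF assms(1), of v] slit_neg[of "1 / r"] Psi_transform_neg[OF assms(1,2)] assms(2)
    by (simp add: v_def)
qed

lemma continuous_on_psi_neg:
  assumes "prob_on_Rplus \<mu>" shows "continuous_on {0<..} (psi_neg \<mu>)"
proof -
  have "continuous_on {0<..} (\<lambda>r::real. cauchy_transform \<mu> (- complex_of_real (1 / r)))"
  proof (rule continuous_on_compose2[OF holomorphic_on_imp_continuous_on[OF cauchy_transform_holomorphic_slit[OF assms]]])
    show "continuous_on {0<..} (\<lambda>r. - complex_of_real (1 / r))" by (intro continuous_intros) auto
    show "(\<lambda>r. - complex_of_real (1 / r)) ` {0<..} \<subseteq> slit_plane"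
      by (intro image_subsetI slit_neg) simp
  qed
  hence "continuous_on {0<..} (\<lambda>r::real. Re (1 - (- complex_of_real (1 / r)) * cauchy_transform \<mu> (- complex_of_real (1 / r))))"
    by (intro continuous_intros) auto
  moreover have "Re (1 - (- complex_of_real (1 / r)) * cauchy_transform \<mu> (- complex_of_real (1 / r))) = psi_neg \<mu> r" if "r \<in> {0<..}" for r
  proof -
    have "1 - (- complex_of_real (1 / r)) * cauchy_transform \<mu> (- complex_of_real (1 / r)) = complex_of_real (psi_neg \<mu> r)"
      using psi_neg_eq_cauchy[OF assms, of r] that by (metis greaterThan_iff minus_diff_eq minus_minus)
    thus ?thesis by (metis Re_complex_of_real)
  qed
  ultimately show ?thesis by (rule continuous_on_eq)
qed

text \<open>On the ray z = -r the transform Psi is real, nonzero and tends to 0, so the relation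
  applies for all small r. This ray alone later determines the equation for G.\<close>

lemma S_transform_neg:
  assumes \<mu>: "prob_on_Rplus \<mu>" "\<mu> \<noteq> return borel 0" and S: "S_transform_rel \<mu> S"
  shows "\<exists>r0>0. \<forall>r. 0 < r \<and> r < r0 \<longrightarrow>
    S (- of_real (psi_neg \<mu> r)) = (1 - of_real (psi_neg \<mu> r)) * of_real r / of_real (psi_neg \<mu> r)"
proof -
  obtain \<epsilon> where \<epsilon>: "\<epsilon> > 0" "\<And>z. z \<in> iCplus \<Longrightarrow> 0 < cmod (Psi_transform \<mu> z) \<Longrightarrow> cmod (Psi_transform \<mu> z) < \<epsilon>
      \<Longrightarrow> S (Psi_transform \<mu> z) = (Psi_transform \<mu> z + 1) * z / Psi_transform \<mu> z"
    using S unfolding S_transform_rel_def by blast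
  obtain r0 where r0: "r0 > 0" "\<And>r. 0 < r \<Longrightarrow> r < r0 \<Longrightarrow> psi_neg \<mu> r < \<epsilon>"
    using psi_neg_small[OF \<mu>(1) \<epsilon>(1)] by blast
  have "S (- of_real (psi_neg \<mu> r)) = (1 - of_real (psi_neg \<mu> r)) * of_real r / of_real (psi_neg \<mu> r)"
    if r: "0 < r" "r < r0" for r
  proof -
    have "- complex_of_real r \<in> iCplus" using r by (simp add: iCplus_def)
    moreover have "cmod (- complex_of_real (psi_neg \<mu> r)) = psi_neg \<mu> r"
      using psi_neg_pos[OF \<mu> r(1)] by simp
    ultimately show ?thesis
      using \<epsilon>(2)[of "- complex_of_real r"] psi_neg_pos[OF \<mu> r(1)] r0(2)[OF r]
      unfolding Psi_transform_neg[OF \<mu>(1) r(1)] by simp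
  qed
  thus ?thesis using r0(1) by blast
qed

lemma open_connected_slit:
  "open slit_plane" "connected slit_plane"
proof -
  have "complex_of_real ` {0..} = {z. Im z = 0 \<and> 0 \<le> Re z}"
    by (auto simp: image_iff complex_eq_iff)
  hence "complex_of_real ` {0..} = {z. Im z = 0} \<inter> {z. 0 \<le> Re z}" by auto
  moreover have "closed ({z. Im z = 0} \<inter> {z. 0 \<le> Re z})"
    by (intro closed_Int closed_Collect_eq closed_Collect_le continuous_intros)
  ultimately have "closed (complex_of_real ` {0..})" by simp
  thus "open slit_plane" by (rule open_Compl)
  show "connected slit_plane"
    using starlike_imp_connected[OF starlike_slotted_complex_plane_right[of 0]] .
qed

text \<open>With v = -1/r and p = -Psi(-r) the S-relation reads p exp(\<beta> p) = (1 - p) r. Since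
  v G(v) - 1 = -p, this is the functional equation at v, valid on a half-line of negative reals and
  continued from there. S is required only on small negative arguments, as it may be arbitrary off
  the values of Psi.\<close>

lemma S_transform_imp_cauchy_fe:
  assumes \<mu>: "prob_on_Rplus \<mu>" "\<mu> \<noteq> return borel 0" and S: "S_transform_rel \<mu> S"
    and \<delta>: "\<delta> > 0" "\<And>p. 0 < p \<Longrightarrow> p < \<delta> \<Longrightarrow> S (- of_real p) = exp (of_real (\<beta> * p))"
    and v: "v \<in> slit_plane"
  shows "cauchy_fe_at \<beta> 1 \<mu> v"
proof -
  obtain r0 where r0: "r0 > 0" "\<And>r. 0 < r \<Longrightarrow> r < r0 \<Longrightarrow>
     S (- of_real (psi_neg \<mu> r)) = (1 - of_real (psi_neg \<mu> r)) * of_real r / of_real (psi_neg \<mu> r)"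
    using S_transform_neg[OF \<mu> S] by blast
  obtain r1 where r1: "r1 > 0" "\<And>r. 0 < r \<Longrightarrow> r < r1 \<Longrightarrow> psi_neg \<mu> r < \<delta>"
    using psi_neg_small[OF \<mu>(1) \<delta>(1)] by blast
  define M where "M = 1 / min r0 r1"
  have M: "M > 0" using r0(1) r1(1) by (simp add: M_def)
  have fe: "cauchy_fe_at \<beta> 1 \<mu> (- complex_of_real x)" if x: "x > M" for x
  proof -
    define r where "r = 1 / x"
    have "1 / x < 1 / M" using x M by (intro divide_strict_left_mono) auto
    hence r: "0 < r" "r < r0" "r < r1" using x M less_trans[OF M x] by (auto simp: r_def M_def)
    define p where "p = psi_neg \<mu> r"
    have p: "p > 0" "p < \<delta>" using psi_neg_pos[OF \<mu> r(1)] r1(2)[OF r(1,3)] by (auto simp: p_def)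
    have "exp (complex_of_real (\<beta> * p)) = (1 - of_real p) * of_real r / of_real p"
      using r0(2)[OF r(1,2)] \<delta>(2)[OF p] by (simp add: p_def)
    hence e: "of_real p * exp (complex_of_real (\<beta> * p)) = (1 - of_real p) * of_real r"
      using p by simp
    define u where "u = - complex_of_real x"
    have u: "u = - complex_of_real (1 / r)" "u * of_real r = - 1" using x M by (auto simp: u_def r_def)
    have q: "u * cauchy_transform \<mu> u - 1 = - of_real p"
      using psi_neg_eq_cauchy[OF \<mu>(1) r(1)] unfolding u(1) p_def .
    hence "u * cauchy_transform \<mu> u = 1 - of_real p" by (simp add: algebra_simps)
    hence "of_real r * (u * cauchy_transform \<mu> u) = of_real r * (1 - of_real p)" by simp
    hence "- cauchy_transform \<mu> u = of_real r * (1 - of_real p)"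
      using u(2) by (metis mult.assoc mult.commute mult_minus1)
    hence "cauchy_transform \<mu> u = - (of_real p * exp (complex_of_real (\<beta> * p)))"
      unfolding e by (metis minus_minus mult.commute)
    thus ?thesis unfolding cauchy_fe_at_def Let_def u_def[symmetric] q by simp
  qed
  show ?thesis
  proof (rule cauchy_fe_identity[OF cauchy_transform_holomorphic_slit[OF \<mu>(1)] open_connected_slit])
    show "(\<lambda>x. - complex_of_real x) ` {M<..} \<subseteq> slit_plane"
      using slit_neg M by auto
    show "- complex_of_real (M + 1) \<in> slit_plane" using slit_neg[of "M + 1"] M by auto
    show "- complex_of_real (M + 1) islimpt (\<lambda>x. - complex_of_real x) ` {M<..}"
      unfolding islimpt_approachable
    proof (intro allI impI)
      fix e :: real assume "e > 0"
      show "\<exists>x'\<in>(\<lambda>x. - complex_of_real x) ` {M<..}. x' \<noteq> - complex_of_real (M + 1) \<and> dist x' (- complex_of_real (M + 1)) < e"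
      proof (intro bexI conjI)
        show "- complex_of_real (M + 1 + e / 2) \<in> (\<lambda>x. - complex_of_real x) ` {M<..}"
          using \<open>e > 0\<close> by (intro imageI) simp
        show "- complex_of_real (M + 1 + e / 2) \<noteq> - complex_of_real (M + 1)" using \<open>e > 0\<close> by (simp add: complex_eq_iff)
        have "- complex_of_real (M + 1 + e / 2) - - complex_of_real (M + 1) = - complex_of_real (e / 2)" by simp
        thus "dist (- complex_of_real (M + 1 + e / 2)) (- complex_of_real (M + 1)) < e"
          unfolding dist_norm by (simp only: norm_minus_cancel norm_of_real) (use \<open>e > 0\<close> in simp)
      qed
    qed
  qed (use fe v in auto)
qed

text \<open>For Re z < 0 the point v = 1/z lies in the slit plane, and the equation for G is the
  S-relation solved for the exponential. S is compared with an exponential on a small disc only,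
  because in general a principal power of an exponential is an exponential only near 0.\<close>

lemma cauchy_fe_imp_S_transform:
  assumes \<mu>: "prob_on_Rplus \<mu>" and fe: "\<And>v. v \<in> slit_plane \<Longrightarrow> cauchy_fe_at \<beta> 1 \<mu> v"
    and S: "\<epsilon> > 0" "\<And>w. cmod w < \<epsilon> \<Longrightarrow> S w = exp (- of_real \<beta> * w)"
  shows "S_transform_rel \<mu> S"
  unfolding S_transform_rel_def
proof (intro exI[of _ \<epsilon>] conjI ballI impI S(1))
  fix z assume z: "z \<in> iCplus" and p: "0 < cmod (Psi_transform \<mu> z) \<and> cmod (Psi_transform \<mu> z) < \<epsilon>"
  define v where "v = 1 / z"
  have z0: "z \<noteq> 0" "1 / v = z" using z by (auto simp: iCplus_def v_def)
  have "Re v < 0" using z z0 by (simp add: v_def iCplus_def Re_divide divide_less_0_iff sum_power2_gt_zero_iff complex_eq_iff)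
  hence v: "v \<in> slit_plane" by (auto simp: complex_eq_iff)
  define \<psi> where "\<psi> = Psi_transform \<mu> z"
  have \<psi>: "\<psi> = v * cauchy_transform \<mu> v - 1" unfolding \<psi>_def using Psi_transform_eq_slit[OF \<mu> v] z0 by simp
  have "cauchy_transform \<mu> v = \<psi> * exp (- of_real \<beta> * \<psi>)"
    using fe[OF v] unfolding cauchy_fe_at_def Let_def of_real_1 div_by_1 \<psi>[symmetric] .
  moreover have "cauchy_transform \<mu> v = (\<psi> + 1) * z" unfolding \<psi> using z0(1) by (simp add: v_def)
  ultimately have "\<psi> * exp (- of_real \<beta> * \<psi>) = (\<psi> + 1) * z" by simp
  moreover have "\<psi> \<noteq> 0" using p by (auto simp: \<psi>_def)
  ultimately have "exp (- of_real \<beta> * \<psi>) = (\<psi> + 1) * z / \<psi>" by (simp add: eq_divide_eq mult.commute)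
  thus "S (Psi_transform \<mu> z) = (Psi_transform \<mu> z + 1) * z / Psi_transform \<mu> z"
    using S(2)[of \<psi>] p unfolding \<psi>_def by simp
qed

text \<open>Both functions are prescribed at the values of Psi. On the ray these fill an interval
  (-\<delta>, 0) by the intermediate value theorem, as \<open>psi_neg\<close> is continuous,
  positive and tends to 0.\<close>

lemma S_transform_determined_on_negatives:
  assumes \<mu>: "prob_on_Rplus \<mu>" "\<mu> \<noteq> return borel 0" and S: "S_transform_rel \<mu> S" "S_transform_rel \<mu> S'"
  shows "\<exists>\<delta>>0. \<forall>p. 0 < p \<and> p < \<delta> \<longrightarrow> S (- of_real p) = S' (- of_real p)"
proof -
  obtain r0 where r0: "r0 > 0" "\<And>r. 0 < r \<Longrightarrow> r < r0 \<Longrightarrow>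
     S (- of_real (psi_neg \<mu> r)) = (1 - of_real (psi_neg \<mu> r)) * of_real r / of_real (psi_neg \<mu> r)"
    using S_transform_neg[OF \<mu> S(1)] by blast
  obtain r1 where r1: "r1 > 0" "\<And>r. 0 < r \<Longrightarrow> r < r1 \<Longrightarrow>
     S' (- of_real (psi_neg \<mu> r)) = (1 - of_real (psi_neg \<mu> r)) * of_real r / of_real (psi_neg \<mu> r)"
    using S_transform_neg[OF \<mu> S(2)] by blast
  define r2 where "r2 = min r0 r1 / 2"
  have r2: "r2 > 0" "r2 < r0" "r2 < r1" using r0(1) r1(1) by (auto simp: r2_def min_def)
  have "S (- of_real p) = S' (- of_real p)" if p: "0 < p" "p < psi_neg \<mu> r2" for p
  proof -
    obtain r3 where r3: "r3 > 0" "\<And>r. 0 < r \<Longrightarrow> r < r3 \<Longrightarrow> psi_neg \<mu> r < p"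
      using psi_neg_small[OF \<mu>(1) p(1)] by blast
    define r4 where "r4 = min r3 r2 / 2"
    have r4: "r4 > 0" "r4 < r3" "r4 < r2" using r3(1) r2(1) by (auto simp: r4_def min_def)
    have "continuous_on {r4..r2} (psi_neg \<mu>)"
      by (rule continuous_on_subset[OF continuous_on_psi_neg[OF \<mu>(1)]]) (use r4(1) in auto)
    hence "\<exists>r\<ge>r4. r \<le> r2 \<and> psi_neg \<mu> r = p"
      using r3(2)[OF r4(1,2)] p r4 by (intro IVT') auto
    then obtain r where r: "r \<ge> r4" "r \<le> r2" "psi_neg \<mu> r = p" by blast
    show ?thesis using r0(2)[of r] r1(2)[of r] r r2 r4 by simp
  qed
  thus ?thesis using psi_neg_pos[OF \<mu> r2(1)] by blast
qed

section \<open>Primitives with a prescribed residue\<close>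

lemma primitive_of_shifted_power_series:
  fixes a :: "nat \<Rightarrow> real"
  assumes sums: "\<And>w::complex. (\<lambda>k. of_real (a k) * w ^ k) sums f w"
  shows "\<exists>Q. (\<forall>w. w \<noteq> 0 \<longrightarrow> (Q has_field_derivative (f w - of_real (a 0)) / w) (at w)) \<and>
     (\<forall>x::real. x \<noteq> 0 \<longrightarrow> Im (Q (of_real x)) = 0)"
proof -
  define b where "b k = (if k = 0 then 0 else a k / real k)" for k
  have summable: "summable (\<lambda>k. complex_of_real (b k) * w ^ k)" for w
  proof (rule summable_comparison_test')
    have "summable (\<lambda>k. norm (complex_of_real (a k) * of_real (norm w) ^ k))"
      by (rule powser_insidea[where x = "of_real (norm w + 1)"]) (use sums in \<open>auto simp: sums_iff simp del: of_real_add\<close>)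
    thus "summable (\<lambda>k. \<bar>a k\<bar> * norm w ^ k)" by (simp add: norm_mult norm_power)
    fix k
    have "\<bar>b k\<bar> \<le> \<bar>a k\<bar>" by (auto simp: b_def divide_le_eq mult_le_cancel_left1)
    thus "norm (complex_of_real (b k) * w ^ k) \<le> \<bar>a k\<bar> * norm w ^ k"
      by (simp add: norm_mult norm_power mult_right_mono)
  qed
  define Q where "Q w = (\<Sum>k. complex_of_real (b k) * w ^ k)" for w
  have "(Q has_field_derivative (f w - of_real (a 0)) / w) (at w)" if w: "w \<noteq> 0" for w
  proof -
    have "(Q has_field_derivative (\<Sum>k. diffs (\<lambda>k. complex_of_real (b k)) k * w ^ k)) (at w)"
      unfolding Q_def by (rule termdiffs_strong_converges_everywhere[OF summable])
    also have "(\<lambda>k. diffs (\<lambda>k. complex_of_real (b k)) k * w ^ k) = (\<lambda>k. of_real (a (Suc k)) * w ^ k)"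
      by (simp add: diffs_def b_def fun_eq_iff del: of_nat_Suc)
    also have "(\<lambda>k. of_real (a (Suc k)) * w ^ k) sums ((f w - of_real (a 0)) / w)"
    proof -
      have "(\<lambda>k. of_real (a (Suc k)) * w ^ Suc k) sums (f w - of_real (a 0))"
        using sums[of w] by (subst sums_Suc_iff) simp
      from sums_divide[OF this, of w] show ?thesis using w by simp
    qed
    hence "(\<Sum>k. of_real (a (Suc k)) * w ^ k) = (f w - of_real (a 0)) / w" by (simp add: sums_iff)
    finally show ?thesis .
  qed
  moreover have "Im (Q (of_real x)) = 0" for x :: real
  proof -
    have "(\<lambda>k. complex_of_real (b k) * of_real x ^ k) sums Q (of_real x)"
      unfolding Q_def by (rule summable_sums[OF summable])
    hence "(\<lambda>k. Im (complex_of_real (b k) * of_real x ^ k)) sums Im (Q (of_real x))" by (rule sums_Im)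
    hence "(\<lambda>k. 0) sums Im (Q (of_real x))" by (simp flip: of_real_power of_real_mult)
    thus ?thesis by (simp add: sums_iff)
  qed
  ultimately show ?thesis by blast
qed

text \<open>Induction on the order of the pole: the term a 0 / w^(n+2) is integrated explicitly and
  the rest divided by w once. Subtracting the residue term keeps the primitive single-valued on the
  punctured plane; each application adds the branch of the logarithm that suits its curve. Real
  coefficients make the primitive real on the real axis, so real end points contribute no imaginary
  part.\<close>

lemma primitive_modulo_residue:
  fixes a :: "nat \<Rightarrow> real"
  assumes "\<And>w::complex. (\<lambda>k. of_real (a k) * w ^ k) sums f w"
  shows "\<exists>Q. (\<forall>w. w \<noteq> 0 \<longrightarrow> (Q has_field_derivative f w / w ^ Suc n - of_real (a n) / w) (at w)) \<and>
     (\<forall>x::real. x \<noteq> 0 \<longrightarrow> Im (Q (of_real x)) = 0)"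
  using assms
proof (induction n arbitrary: a f)
  case 0
  show ?case using primitive_of_shifted_power_series[OF 0] by (simp add: diff_divide_distrib)
next
  case (Suc n)
  \<comment> \<open>The value at 0 is filled in so that the shifted series sums to f1 everywhere, as
    the induction hypothesis demands.\<close>
  define f1 where "f1 w = (if w = 0 then of_real (a 1) else (f w - of_real (a 0)) / w)" for w
  have "(\<lambda>k. of_real (a (Suc k)) * w ^ k) sums f1 w" for w :: complex
  proof (cases "w = 0")
    case True
    have "(\<lambda>k. of_real (a (Suc k)) * (0::complex) ^ k) sums (of_real (a (Suc 0)))"
      using powser_sums_zero[of "\<lambda>k. complex_of_real (a (Suc k))"] by simp
    thus ?thesis using True by (simp add: f1_def)
  next
    case False
    have "(\<lambda>k. of_real (a (Suc k)) * w ^ Suc k) sums (f w - of_real (a 0))"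
      using Suc.prems[of w] by (subst sums_Suc_iff) simp
    from sums_divide[OF this, of w] show ?thesis using False by (simp add: f1_def)
  qed
  from Suc.IH[of "\<lambda>k. a (Suc k)", OF this] obtain Q where
    Q: "\<And>w. w \<noteq> 0 \<Longrightarrow> (Q has_field_derivative f1 w / w ^ Suc n - of_real (a (Suc n)) / w) (at w)"
       "\<And>x::real. x \<noteq> 0 \<Longrightarrow> Im (Q (of_real x)) = 0" by auto
  define Q' where "Q' w = Q w - of_real (a 0 / real (Suc n)) * inverse w ^ Suc n" for w
  have "(Q' has_field_derivative f w / w ^ Suc (Suc n) - of_real (a (Suc n)) / w) (at w)" if w: "w \<noteq> 0" for w
  proof -
    have "((\<lambda>w. of_real (a 0 / real (Suc n)) * inverse w ^ Suc n) has_field_derivative - (of_real (a 0) / w ^ Suc (Suc n))) (at w)"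
    proof -
      have "of_real (a 0 / real (Suc n)) * ((1 + of_nat n) * (- (inverse w ^ Suc (Suc 0)) * inverse w ^ n))
        = - ((complex_of_real (a 0) / of_nat (Suc n)) * of_nat (Suc n) * inverse (w ^ Suc (Suc n)))"
        by (simp add: power_inverse)
      also have "\<dots> = - (of_real (a 0) / w ^ Suc (Suc n))"
        by (simp add: divide_inverse del: of_nat_Suc power_Suc)
      finally show ?thesis using DERIV_cmult[OF DERIV_power_Suc[OF DERIV_inverse[OF w]], of "of_real (a 0 / real (Suc n))" n] by metis
    qed
    from DERIV_diff[OF Q(1)[OF w] this] have "(Q' has_field_derivative (f1 w / w ^ Suc n - of_real (a (Suc n)) / w) - - (of_real (a 0) / w ^ Suc (Suc n))) (at w)"
      unfolding Q'_def .
    moreover have "f w / w ^ Suc (Suc n) = f1 w / w ^ Suc n + of_real (a 0) / w ^ Suc (Suc n)"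
      using w by (simp add: f1_def field_simps)
    ultimately show ?thesis by (simp add: algebra_simps)
  qed
  moreover have "Im (Q' (of_real x)) = 0" if "x \<noteq> 0" for x :: real
  proof -
    have "complex_of_real (a 0 / real (Suc n)) * inverse (of_real x) ^ Suc n = complex_of_real (a 0 / real (Suc n) * inverse x ^ Suc n)" by simp
    thus ?thesis unfolding Q'_def by (simp only: minus_complex.sel Im_complex_of_real Q(2)[OF that])
  qed
  ultimately show ?case by blast
qed

text \<open>The finite geometric sum is exact up to an integral bounded by q^n / (1 - q) times the
  total mass. It serves the constructed measure and the Levy measure, both of bounded
  support.\<close>

lemma sums_integral_geometric:
  fixes M :: "real measure"
  assumes M: "finite_measure M" "sets M = sets borel" and K: "AE x in M. 0 \<le> x \<and> x \<le> K" "K \<ge> 0"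
    and z: "K * cmod z < 1"
  shows "(\<lambda>n. of_real (\<integral>x. x ^ n \<partial>M) * z ^ n) sums (\<integral>x. 1 / (1 - of_real x * z) \<partial>M)"
proof -
  interpret finite_measure M by fact
  note [measurable_cong] = M(2)
  define q where "q = K * cmod z"
  have q: "0 \<le> q" "q < 1" using z K by (auto simp: q_def)
  have AEq: "AE x in M. cmod (of_real x * z) \<le> q"
    using K(1) by eventually_elim (auto simp: norm_mult q_def mult_right_mono)
  have int_pow: "integrable M (\<lambda>x. x ^ n)" for n
  proof (rule integrable_const_bound[where B = "K ^ n"])
    show "AE x in M. norm (x ^ n) \<le> K ^ n"
      using K(1) by eventually_elim (auto simp: power_mono norm_power)
  qed simp
  have kb: "AE x in M. norm ((of_real x * z) ^ n / (1 - of_real x * z)) \<le> q ^ n / (1 - q)" for n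
    using AEq
  proof eventually_elim
    case (elim x)
    have "1 - q \<le> cmod (1 - of_real x * z)" using norm_triangle_ineq2[of 1 "of_real x * z"] elim by simp
    thus ?case unfolding norm_divide norm_power using elim q by (intro frac_le power_mono) auto
  qed
  have int_k: "integrable M (\<lambda>x. (of_real x * z) ^ n / (1 - of_real x * z))" for n
    by (rule integrable_const_bound[OF kb]) simp
  have eq: "(\<Sum>k<n. of_real (\<integral>x. x ^ k \<partial>M) * z ^ k) = (\<integral>x. 1 / (1 - of_real x * z) \<partial>M) - (\<integral>x. (of_real x * z) ^ n / (1 - of_real x * z) \<partial>M)" for n
  proof -
    have "(\<Sum>k<n. of_real (\<integral>x. x ^ k \<partial>M) * z ^ k) = (\<Sum>k<n. (\<integral>x. of_real (x ^ k) * z ^ k \<partial>M))"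
      by (simp add: integral_complex_of_real[symmetric])
    also have "\<dots> = (\<integral>x. (\<Sum>k<n. of_real (x ^ k) * z ^ k) \<partial>M)"
      using int_pow by (subst Bochner_Integration.integral_sum) (auto simp del: of_real_power)
    also have "\<dots> = (\<integral>x. 1 / (1 - of_real x * z) - (of_real x * z) ^ n / (1 - of_real x * z) \<partial>M)"
    proof (rule integral_cong_AE)
      show "AE x in M. (\<Sum>k<n. of_real (x ^ k) * z ^ k) = 1 / (1 - of_real x * z) - (of_real x * z) ^ n / (1 - of_real x * z)"
        using AEq
      proof eventually_elim
        case (elim x)
        have ne: "of_real x * z \<noteq> 1" using elim q(2) by auto
        have "(\<Sum>k<n. of_real (x ^ k) * z ^ k) = (\<Sum>k<n. (of_real x * z) ^ k)" by (simp add: power_mult_distrib)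
        also have "\<dots> = (1 - (of_real x * z) ^ n) / (1 - of_real x * z)" using ne by (simp add: sum_gp_strict)
        finally show ?case by (simp add: diff_divide_distrib)
      qed
    qed measurable
    also have "\<dots> = (\<integral>x. 1 / (1 - of_real x * z) \<partial>M) - (\<integral>x. (of_real x * z) ^ n / (1 - of_real x * z) \<partial>M)"
      using int_k[of 0] int_k[of n] by (intro Bochner_Integration.integral_diff) auto
    finally show ?thesis .
  qed
  have lim: "(\<lambda>n. \<integral>x. (of_real x * z) ^ n / (1 - of_real x * z) \<partial>M) \<longlonglongrightarrow> 0"
  proof (rule Lim_null_comparison)
    show "\<forall>\<^sub>F n in sequentially. norm (\<integral>x. (of_real x * z) ^ n / (1 - of_real x * z) \<partial>M) \<le> q ^ n / (1 - q) * measure M (space M)"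
    proof (rule always_eventually, rule allI)
      fix n
      have "norm (\<integral>x. (of_real x * z) ^ n / (1 - of_real x * z) \<partial>M) \<le> (\<integral>x. q ^ n / (1 - q) \<partial>M)"
        by (rule integral_norm_bound_integral_AE[OF int_k _ kb]) simp
      thus "norm (\<integral>x. (of_real x * z) ^ n / (1 - of_real x * z) \<partial>M) \<le> q ^ n / (1 - q) * measure M (space M)"
        by (simp add: mult.commute)
    qed
    have "(\<lambda>n. q ^ n / (1 - q) * measure M (space M)) \<longlonglongrightarrow> 0 / (1 - q) * measure M (space M)"
      using q by (intro tendsto_intros LIMSEQ_realpow_zero) auto
    thus "(\<lambda>n. q ^ n / (1 - q) * measure M (space M)) \<longlonglongrightarrow> 0" by simp
  qed
  show ?thesis unfolding sums_def eq using tendsto_diff[OF tendsto_const lim] by simp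
qed

section \<open>Construction of the measures\<close>

text \<open>Both the monotonicity of \<open>cosh_of\<close> and that of X along the curve rest on
  this inequality.\<close>

lemma mult_cos_less_sin:
  assumes "0 < \<theta>" "\<theta> < pi"
  shows "\<theta> * cos \<theta> < sin \<theta>"
proof -
  have "sin 0 - 0 * cos 0 < sin \<theta> - \<theta> * cos \<theta>"
  proof (rule DERIV_pos_imp_increasing_open[OF assms(1)])
    fix t :: real assume t: "0 < t" "t < \<theta>"
    have "((\<lambda>t. sin t - t * cos t) has_real_derivative t * sin t) (at t)"
      by (auto intro!: derivative_eq_intros)
    moreover have "t * sin t > 0" using t assms by (intro mult_pos_pos sin_gt_zero) auto
    ultimately show "\<exists>y. ((\<lambda>t. sin t - t * cos t) has_real_derivative y) (at t) \<and> y > 0" by blast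
  qed (intro continuous_intros)
  thus ?thesis by simp
qed

text \<open>
  The curve on which $X(w) = (1+w) e^{\beta w} / w$ is real, in the coordinate
  $\omega = \log ((1+w)/w) = s - i\theta$. There $\log X = \omega + \beta w$ is real iff
  $\cosh s = \cos\theta + (\beta/2) (\sin\theta)/\theta$, which determines $\theta \in [0, \pi)$ for
  $|s| \le s_0$. At the ends $\theta = 0$ and $w$ is real.
\<close>

locale y_curve =
  fixes \<beta> :: real
  assumes \<beta>_pos: "\<beta> > 0"
begin

text \<open>Writing \<open>sinc\<close> includes \<theta> = 0, so the end points of the curve need
  no separate formula.\<close>

definition cosh_of :: "real \<Rightarrow> real" where "cosh_of \<theta> = cos \<theta> + (\<beta> / 2) * sinc \<theta>"
definition cosh_of_d :: "real \<Rightarrow> real" where "cosh_of_d \<theta> = - sin \<theta> + (\<beta> / 2) * ((\<theta> * cos \<theta> - sin \<theta>) / \<theta>\<^sup>2)"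
definition s0 :: real where "s0 = arcosh (1 + \<beta> / 2)"
definition angle :: "real \<Rightarrow> real" where "angle s = the_inv_into {0..pi} cosh_of (cosh s)"
definition omega :: "real \<Rightarrow> complex" where "omega s = Complex s (- angle s)"
definition path :: "real \<Rightarrow> complex" where "path s = 1 / (exp (omega s) - 1)"
definition ln_X :: "real \<Rightarrow> real" where "ln_X s = s + \<beta> * Re (path s)"
definition X_at :: "real \<Rightarrow> real" where "X_at s = exp (ln_X s)"
definition angle_d :: "real \<Rightarrow> real" where "angle_d s = sinh s / cosh_of_d (angle s)"
text \<open>The derivative of \<omega> + \<beta> w along the curve, with dw/d\<omega> = -w (1 + w).
  It is kept complex; that it is real is derived later from the reality of
  \<open>ln_X\<close>.\<close>

definition ln_X_d :: "real \<Rightarrow> complex" where "ln_X_d s = (1 - of_real \<beta> * (path s * (1 + path s))) * Complex 1 (- angle_d s)"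

section \<open>The angle as a function of s\<close>

lemma cosh_of_continuous: "continuous_on S cosh_of"
  unfolding cosh_of_def by (intro continuous_intros)

lemma cosh_of_deriv:
  assumes "0 < \<theta>" "\<theta> < pi"
  shows "(cosh_of has_real_derivative cosh_of_d \<theta>) (at \<theta>)"
proof (rule has_field_derivative_transform_within_open[where S = "{0<..<pi}" and f = "\<lambda>\<theta>. cos \<theta> + (\<beta> / 2) * (sin \<theta> / \<theta>)"])
  show "((\<lambda>\<theta>. cos \<theta> + (\<beta> / 2) * (sin \<theta> / \<theta>)) has_real_derivative cosh_of_d \<theta>) (at \<theta>)"
  proof -
    have "((\<lambda>\<theta>. sin \<theta> / \<theta>) has_real_derivative (\<theta> * cos \<theta> - sin \<theta>) / \<theta>\<^sup>2) (at \<theta>)"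
      using assms by (auto intro!: derivative_eq_intros simp: power2_eq_square mult.commute)
    from DERIV_add[OF DERIV_cos DERIV_cmult[OF this]] show ?thesis unfolding cosh_of_d_def .
  qed
qed (use assms in \<open>auto simp: cosh_of_def\<close>)

lemma cosh_of_d_neg:
  assumes "0 < \<theta>" "\<theta> < pi" shows "cosh_of_d \<theta> < 0"
proof -
  have "(\<theta> * cos \<theta> - sin \<theta>) / \<theta>\<^sup>2 < 0"
    using mult_cos_less_sin[OF assms] assms by (intro divide_neg_pos) auto
  hence "(\<beta> / 2) * ((\<theta> * cos \<theta> - sin \<theta>) / \<theta>\<^sup>2) < 0"
    using \<beta>_pos by (intro mult_pos_neg) auto
  thus ?thesis unfolding cosh_of_d_def using sin_gt_zero[OF assms] by linarith
qed

lemma cosh_of_decreasing: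
  assumes "0 \<le> a" "a < b" "b \<le> pi" shows "cosh_of b < cosh_of a"
  using assms cosh_of_deriv cosh_of_d_neg
  by (intro DERIV_neg_imp_decreasing_open[OF assms(2) _ cosh_of_continuous]) (meson le_less_trans less_le_trans)

lemma cosh_of_inj: "inj_on cosh_of {0..pi}"
  by (rule linorder_inj_onI) (use cosh_of_decreasing in \<open>force+\<close>)

lemma cosh_of_0: "cosh_of 0 = 1 + \<beta> / 2" and cosh_of_pi: "cosh_of pi = - 1"
  by (simp_all add: cosh_of_def)

lemma cosh_of_image: assumes "-1 \<le> y" "y \<le> 1 + \<beta> / 2" shows "y \<in> cosh_of ` {0..pi}"
proof -
  have "\<exists>x\<ge>0. x \<le> pi \<and> cosh_of x = y"
    by (rule IVT2') (use assms cosh_of_0 cosh_of_pi cosh_of_continuous in auto)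
  thus ?thesis by auto
qed

lemma s0_pos: "s0 > 0" and cosh_s0: "cosh s0 = 1 + \<beta> / 2"
  using \<beta>_pos by (auto simp: s0_def)

lemma cosh_le_s0: "\<bar>s\<bar> \<le> s0 \<Longrightarrow> cosh s \<le> 1 + \<beta> / 2"
  unfolding cosh_s0[symmetric] by (subst cosh_real_abs[symmetric], subst cosh_real_nonneg_le_iff) (use s0_pos in auto)

lemma cosh_less_s0: "\<bar>s\<bar> < s0 \<Longrightarrow> cosh s < 1 + \<beta> / 2"
  unfolding cosh_s0[symmetric] by (subst cosh_real_abs[symmetric], subst cosh_real_nonneg_less_iff) (use s0_pos in auto)

lemma angle_inv:
  assumes "- 1 \<le> y" "y \<le> 1 + \<beta> / 2"
  shows "the_inv_into {0..pi} cosh_of y \<in> {0..pi}" "cosh_of (the_inv_into {0..pi} cosh_of y) = y"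
  using the_inv_into_into[OF cosh_of_inj cosh_of_image[OF assms] order_refl] f_the_inv_into_f[OF cosh_of_inj cosh_of_image[OF assms]] by auto

lemma angle_bounds:
  assumes "\<bar>s\<bar> \<le> s0" shows "0 \<le> angle s" "angle s < pi" "cosh_of (angle s) = cosh s"
proof -
  have c: "- 1 \<le> cosh s" "cosh s \<le> 1 + \<beta> / 2" using cosh_le_s0[OF assms] cosh_real_ge_1[of s] by auto
  show k: "cosh_of (angle s) = cosh s" unfolding angle_def by (rule angle_inv(2)[OF c])
  show "0 \<le> angle s" using angle_inv(1)[OF c] by (simp add: angle_def)
  have "angle s \<noteq> pi" using k cosh_of_pi cosh_real_ge_1[of s] by auto
  thus "angle s < pi" using angle_inv(1)[OF c] by (simp add: angle_def)
qed

lemma angle_pos: assumes "\<bar>s\<bar> < s0" shows "0 < angle s"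
proof -
  have "angle s \<noteq> 0" using angle_bounds(3)[of s] cosh_of_0 cosh_less_s0[OF assms] assms by auto
  thus ?thesis using angle_bounds(1)[of s] assms by simp
qed

lemma angle_s0: "angle s0 = 0" "angle (- s0) = 0"
proof -
  have "the_inv_into {0..pi} cosh_of (cosh_of 0) = 0" by (rule the_inv_into_f_f[OF cosh_of_inj]) simp
  thus "angle s0 = 0" "angle (- s0) = 0" by (auto simp: angle_def cosh_s0 cosh_of_0)
qed

lemma inv_continuous: "continuous_on {-1..1 + \<beta> / 2} (the_inv_into {0..pi} cosh_of)"
proof (rule continuous_on_subset)
  show "continuous_on (cosh_of ` {0..pi}) (the_inv_into {0..pi} cosh_of)"
    by (rule continuous_on_inv_into[OF cosh_of_continuous compact_Icc cosh_of_inj])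
qed (use cosh_of_image in auto)

lemma angle_continuous: "continuous_on {- s0..s0} angle"
  unfolding angle_def
proof (rule continuous_on_compose2[OF inv_continuous])
  show "continuous_on {- s0..s0} (cosh :: real \<Rightarrow> real)" by (intro continuous_intros)
  show "cosh ` {- s0..s0} \<subseteq> {-1..1 + \<beta> / 2}"
  proof safe
    fix s assume "s \<in> {- s0..s0}"
    hence "\<bar>s\<bar> \<le> s0" by auto
    thus "cosh s \<in> {-1..1 + \<beta> / 2}" using cosh_le_s0 cosh_real_ge_1[of s] by auto
  qed
qed

text \<open>The derivative of \<open>cosh_of\<close> vanishes as \<theta> tends to 0, so the angle
  has vertical tangents at s = s0 and s = -s0. The later integrals therefore use derivatives in the
  open interval and continuity at its ends.\<close>

lemma angle_deriv:
  assumes "\<bar>s\<bar> < s0" shows "(angle has_real_derivative angle_d s) (at s)"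
proof -
  define g where "g = the_inv_into {0..pi} cosh_of"
  have c: "- 1 < cosh s" "cosh s < 1 + \<beta> / 2" using cosh_less_s0[OF assms] cosh_real_ge_1[of s] by linarith+
  have g: "g (cosh s) = angle s" by (simp add: g_def angle_def)
  have "isCont g (cosh s)"
  proof -
    have "continuous_on {- 1<..<1 + \<beta> / 2} g" unfolding g_def by (rule continuous_on_subset[OF inv_continuous]) auto
    thus ?thesis using c by (simp add: continuous_on_eq_continuous_at)
  qed
  hence "(g has_real_derivative inverse (cosh_of_d (angle s))) (at (cosh s))"
    using c cosh_of_deriv[of "angle s"] cosh_of_d_neg[of "angle s"] angle_pos[OF assms] angle_bounds(2)[of s] assms angle_inv(2)
    by (intro DERIV_inverse_function[where f = cosh_of and a = "-1" and b = "1 + \<beta> / 2"]) (auto simp: g g_def[symmetric])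
  moreover have "(cosh has_real_derivative sinh s) (at s)" by (auto intro!: derivative_eq_intros)
  ultimately have "((\<lambda>s. g (cosh s)) has_real_derivative inverse (cosh_of_d (angle s)) * sinh s) (at s)"
    by (rule DERIV_chain2[where f = g and g = cosh])
  thus ?thesis unfolding angle_def[abs_def] angle_d_def g_def by (simp add: divide_inverse mult.commute angle_def)
qed

lemma sinc_angle_pos: assumes "\<bar>s\<bar> \<le> s0" shows "sinc (angle s) > 0"
  using angle_bounds(1,2)[OF assms] sin_gt_zero[of "angle s"] by (cases "angle s = 0") auto

lemma cosh_diff: assumes "\<bar>s\<bar> \<le> s0"
  shows "cosh s - cos (angle s) = (\<beta> / 2) * sinc (angle s)" "cosh s - cos (angle s) > 0"
proof -
  show e: "cosh s - cos (angle s) = (\<beta> / 2) * sinc (angle s)"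
    using angle_bounds(3)[OF assms] unfolding cosh_of_def by linarith
  show "cosh s - cos (angle s) > 0" unfolding e using sinc_angle_pos[OF assms] \<beta>_pos by (intro mult_pos_pos) auto
qed

section \<open>Reality of X on the curve\<close>

lemma exp_omega: "exp (omega s) = Complex (exp s * cos (angle s)) (- (exp s * sin (angle s)))"
  by (simp add: omega_def complex_eq_iff Re_exp Im_exp)

lemma exp_omega_norm:
  "(exp s * cos (angle s) - 1)\<^sup>2 + (exp s * sin (angle s))\<^sup>2 = 2 * exp s * (cosh s - cos (angle s))"
proof -
  have c: "2 * exp s * cosh s = exp s * exp s + 1"
    unfolding cosh_def by (simp add: algebra_simps exp_minus)
  have "(e * C - 1)\<^sup>2 + (e * S)\<^sup>2 = e * e * (S\<^sup>2 + C\<^sup>2) - 2 * e * C + 1" for e C S :: real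
    by (simp add: power2_eq_square algebra_simps)
  hence "(exp s * cos (angle s) - 1)\<^sup>2 + (exp s * sin (angle s))\<^sup>2
    = exp s * exp s * ((sin (angle s))\<^sup>2 + (cos (angle s))\<^sup>2) - 2 * exp s * cos (angle s) + 1" .
  also have "exp s * exp s * ((sin (angle s))\<^sup>2 + (cos (angle s))\<^sup>2) - 2 * exp s * cos (angle s) + 1 = 2 * exp s * cosh s - 2 * exp s * cos (angle s)" unfolding c sin_cos_squared_add by simp
  finally show ?thesis by (simp add: algebra_simps)
qed

lemma exp_omega_neq_1: assumes "\<bar>s\<bar> \<le> s0" shows "exp (omega s) - 1 \<noteq> 0"
proof
  assume "exp (omega s) - 1 = 0"
  hence "exp s * cos (angle s) - 1 = 0" "exp s * sin (angle s) = 0" by (auto simp: exp_omega complex_eq_iff)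
  hence "2 * exp s * (cosh s - cos (angle s)) = 0" unfolding exp_omega_norm[symmetric] by simp
  thus False using cosh_diff(2)[OF assms] by simp
qed

lemma path_neq_0: assumes "\<bar>s\<bar> \<le> s0" shows "path s \<noteq> 0" "1 + path s \<noteq> 0" "exp (omega s) * path s = 1 + path s"
proof -
  show "path s \<noteq> 0" using exp_omega_neq_1[OF assms] by (simp add: path_def)
  show e: "exp (omega s) * path s = 1 + path s" using exp_omega_neq_1[OF assms] by (simp add: path_def field_simps)
  show "1 + path s \<noteq> 0" using \<open>path s \<noteq> 0\<close> by (simp flip: e)
qed

text \<open>The angle was chosen for this: the imaginary part -\<theta> of \<omega> cancels \<beta>
  Im w, which makes \<omega> + \<beta> w real.\<close>

lemma Im_path: assumes "\<bar>s\<bar> \<le> s0" shows "Im (path s) = angle s / \<beta>"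
proof -
  have "Im (path s) = (exp s * sin (angle s)) / ((exp s * cos (angle s) - 1)\<^sup>2 + (exp s * sin (angle s))\<^sup>2)"
    by (simp add: path_def exp_omega Im_divide)
  also have "\<dots> = sin (angle s) / (2 * (cosh s - cos (angle s)))" unfolding exp_omega_norm by simp
  also have "\<dots> = sin (angle s) / (\<beta> * sinc (angle s))" unfolding cosh_diff(1)[OF assms] by simp
  also have "\<dots> = angle s / \<beta>" using sinc_angle_pos[OF assms] by (cases "angle s = 0") auto
  finally show ?thesis .
qed

lemma Im_path_nonneg: "\<bar>s\<bar> \<le> s0 \<Longrightarrow> Im (path s) \<ge> 0"
  using Im_path angle_bounds(1) \<beta>_pos by simp

lemma of_real_ln_X: assumes "\<bar>s\<bar> \<le> s0" shows "of_real (ln_X s) = omega s + of_real \<beta> * path s"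
  using Im_path[OF assms] \<beta>_pos by (simp add: complex_eq_iff ln_X_def omega_def)

lemma of_real_X_at: assumes "\<bar>s\<bar> \<le> s0"
  shows "of_real (X_at s) = (1 + path s) * exp (of_real \<beta> * path s) / path s"
proof -
  have "complex_of_real (X_at s) = exp (omega s) * exp (of_real \<beta> * path s)"
    unfolding X_at_def exp_of_real[symmetric] of_real_ln_X[OF assms] exp_add ..
  also have "exp (omega s) = (1 + path s) / path s" using path_neq_0[OF assms] by (simp add: field_simps)
  finally show ?thesis by simp
qed

text \<open>The symmetry s -> -s acts on the curve as w -> -1 - conj w, hence the pair u and -1 - u.
  As s grows the curve leads through the upper half-plane from the left of -1 to the right of
  0.\<close>

lemma path_endpoints:
  obtains u where "u > 0" "path s0 = of_real u" "path (- s0) = of_real (- 1 - u)"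
proof
  have E: "exp s0 > 1" using s0_pos by simp
  show "1 / (exp s0 - 1) > 0" using E by simp
  show "path s0 = of_real (1 / (exp s0 - 1))" by (simp add: path_def exp_omega angle_s0 complex_eq_iff Re_divide Im_divide power2_eq_square)
  have "1 / (exp (- s0) - 1) = - 1 - 1 / (exp s0 - 1)" using E by (simp add: exp_minus field_simps)
  moreover have "path (- s0) = of_real (1 / (exp (- s0) - 1))" by (simp add: path_def exp_omega angle_s0 complex_eq_iff Re_divide Im_divide power2_eq_square)
  ultimately show "path (- s0) = of_real (- 1 - 1 / (exp s0 - 1))" by simp
qed

lemma omega_continuous: "continuous_on {- s0..s0} omega"
  unfolding omega_def Complex_eq by (intro continuous_intros angle_continuous)

lemma path_continuous: "continuous_on {- s0..s0} path"
  unfolding path_def using exp_omega_neq_1 by (intro continuous_intros omega_continuous) auto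

lemma X_at_continuous: "continuous_on {- s0..s0} X_at"
  unfolding X_at_def ln_X_def by (intro continuous_intros path_continuous)

lemma omega_deriv: assumes "\<bar>s\<bar> < s0" shows "(omega has_vector_derivative Complex 1 (- angle_d s)) (at s)"
proof -
  have "(omega has_vector_derivative Complex 1 (- angle_d s)) (at s) \<longleftrightarrow>
    ((\<lambda>s. of_real s - \<i> * of_real (angle s)) has_vector_derivative of_real 1 - \<i> * of_real (angle_d s)) (at s)"
    by (simp add: omega_def[abs_def] Complex_eq)
  moreover have "((\<lambda>s. of_real s - \<i> * of_real (angle s)) has_vector_derivative of_real 1 - \<i> * of_real (angle_d s)) (at s)"
    using angle_deriv[OF assms]
    by (intro has_vector_derivative_diff has_vector_derivative_mult_right has_vector_derivative_of_real)
       (auto intro: DERIV_ident simp: has_real_derivative_iff_has_vector_derivative[symmetric])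
  ultimately show ?thesis by blast
qed

lemma path_deriv: assumes "\<bar>s\<bar> < s0"
  shows "(path has_vector_derivative - (path s * (1 + path s)) * Complex 1 (- angle_d s)) (at s)"
proof -
  have ne: "exp (omega s) - 1 \<noteq> 0" using exp_omega_neq_1 assms by simp
  have "((\<lambda>z. 1 / (exp z - 1)) has_field_derivative - exp (omega s) / (exp (omega s) - 1)\<^sup>2) (at (omega s))"
    using ne by (auto intro!: derivative_eq_intros simp: power2_eq_square)
  from field_vector_diff_chain_at[OF omega_deriv[OF assms] this]
  have "(path has_vector_derivative Complex 1 (- angle_d s) * (- exp (omega s) / (exp (omega s) - 1)\<^sup>2)) (at s)"
    by (simp add: o_def path_def[abs_def])
  moreover have "- exp (omega s) / (exp (omega s) - 1)\<^sup>2 = - (path s * (1 + path s))"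
  proof -
    have "- exp (omega s) / (exp (omega s) - 1)\<^sup>2 = - (path s * (exp (omega s) * path s))"
      by (simp add: path_def power2_eq_square)
    thus ?thesis using path_neq_0(3)[of s] assms by simp
  qed
  ultimately show ?thesis by (simp only: mult.commute)
qed

section \<open>Monotonicity of X along the curve\<close>

lemma of_real_ln_X_deriv: assumes "\<bar>s\<bar> < s0"
  shows "((\<lambda>s. complex_of_real (ln_X s)) has_vector_derivative ln_X_d s) (at s)"
proof (rule has_vector_derivative_transform_within_open[where S = "{- s0<..<s0}" and f = "\<lambda>s. omega s + of_real \<beta> * path s"])
  have "((\<lambda>s. omega s + of_real \<beta> * path s) has_vector_derivative Complex 1 (- angle_d s) + of_real \<beta> * (- (path s * (1 + path s)) * Complex 1 (- angle_d s))) (at s)"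
    by (intro has_vector_derivative_add has_vector_derivative_mult_right omega_deriv path_deriv assms)
  thus "((\<lambda>s. omega s + of_real \<beta> * path s) has_vector_derivative ln_X_d s) (at s)"
    unfolding ln_X_d_def by (simp add: algebra_simps)
qed (use assms in \<open>auto simp: of_real_ln_X\<close>)

lemma Im_ln_X_d: assumes "\<bar>s\<bar> < s0" shows "Im (ln_X_d s) = 0"
proof -
  have "((\<lambda>s. Im (complex_of_real (ln_X s))) has_vector_derivative Im (ln_X_d s)) (at s)"
    by (rule bounded_linear.has_vector_derivative[OF bounded_linear_Im of_real_ln_X_deriv[OF assms]])
  hence "((\<lambda>s::real. 0::real) has_vector_derivative Im (ln_X_d s)) (at s)" by simp
  thus ?thesis using vector_derivative_unique_at[OF _ has_vector_derivative_const] by metis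
qed

lemma ln_X_d_eq: assumes "\<bar>s\<bar> < s0" shows "ln_X_d s = of_real (Re (ln_X_d s))"
  using Im_ln_X_d[OF assms] by (simp add: complex_eq_iff)

text \<open>From w = 1/(exp \<omega> - 1) one gets w (1 + w) = 1 / (2 (cosh \<omega> - 1)). For
  \<omega> = s - i \<theta> the denominator has real part 2 (cosh s cos \<theta> - 1), and |cosh
  \<omega> - 1| = cosh s - cos \<theta>.\<close>

lemma Re_path_prod:
  assumes "\<bar>s\<bar> \<le> s0"
  shows "Re (path s * (1 + path s)) = (cosh s * cos (angle s) - 1) / (2 * (cosh s - cos (angle s))\<^sup>2)"
proof -
  define A B where "A = cosh s * cos (angle s) - 1" and "B = sinh s * sin (angle s)"
  have e: "exp (omega s) + exp (- omega s) = Complex (2 * (cosh s * cos (angle s))) (- (2 * (sinh s * sin (angle s))))"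
    by (simp add: omega_def complex_eq_iff Re_exp Im_exp cosh_def sinh_def algebra_simps)
  have "path s * (1 + path s) * (exp (omega s) + exp (- omega s) - 2) = 1"
  proof -
    have ne: "exp (omega s) - 1 \<noteq> 0" by (rule exp_omega_neq_1[OF assms])
    have "path s * (1 + path s) = exp (omega s) / (exp (omega s) - 1)\<^sup>2"
      unfolding path_neq_0(3)[OF assms, symmetric] by (simp add: path_def power2_eq_square)
    moreover have "exp (omega s) * (exp (omega s) + exp (- omega s) - 2) = (exp (omega s) - 1)\<^sup>2"
      by (simp add: power2_eq_square algebra_simps flip: exp_add)
    ultimately show ?thesis using ne by simp
  qed
  moreover have "exp (omega s) + exp (- omega s) - 2 = 2 * Complex A (- B)"
    unfolding e by (simp add: complex_eq_iff A_def B_def)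
  ultimately have "path s * (1 + path s) * (2 * Complex A (- B)) = 1" by simp
  hence "path s * (1 + path s) = 1 / (2 * Complex A (- B))"
    by (metis mult_zero_right nonzero_eq_divide_eq zero_neq_one)
  hence "Re (path s * (1 + path s)) = Re (1 / (2 * Complex A (- B)))" by simp
  also have "\<dots> = (2 * A) / (4 * (A\<^sup>2 + B\<^sup>2))" by (simp add: Re_divide power2_eq_square algebra_simps)
  also have "A\<^sup>2 + B\<^sup>2 = (cosh s - cos (angle s))\<^sup>2"
  proof -
    have B2: "B\<^sup>2 = (cosh s ^ 2 - 1) * (1 - cos (angle s) ^ 2)"
      unfolding B_def power_mult_distrib using sinh_square_eq[of s] sin_squared_eq[of "angle s"] by simp
    show ?thesis unfolding B2 A_def by (simp add: power2_eq_square algebra_simps)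
  qed
  also have "2 * A / (4 * (cosh s - cos (angle s))\<^sup>2) = A / (2 * (cosh s - cos (angle s))\<^sup>2)"
    using cosh_diff(2)[OF assms] by (simp add: divide_simps)
  finally show ?thesis unfolding A_def .
qed

text \<open>Writing the derivative as (p + i q)(1 - i \<theta>'), its reality forces q = p
  \<theta>', so its value is p (1 + \<theta>'^2) and only the sign of p matters. After eliminating
  \<beta> by the equation of the curve, the numerator of p is cosh s (sin \<theta> - \<theta> cos
  \<theta>) + (\<theta> - sin \<theta> cos \<theta>), a sum of two nonnegative terms.\<close>

lemma Re_ln_X_d_nonneg: assumes "\<bar>s\<bar> < s0" shows "Re (ln_X_d s) \<ge> 0"
proof -
  have s: "\<bar>s\<bar> \<le> s0" using assms by simp
  define p q where "p = 1 - \<beta> * Re (path s * (1 + path s))" and "q = - \<beta> * Im (path s * (1 + path s))"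
  have d: "ln_X_d s = Complex p q * Complex 1 (- angle_d s)"
    unfolding ln_X_d_def p_def q_def by (simp add: complex_eq_iff)
  have "q = p * angle_d s" using Im_ln_X_d[OF assms] unfolding d by simp
  hence R: "Re (ln_X_d s) = p * (1 + (angle_d s)\<^sup>2)" unfolding d by (simp add: power2_eq_square algebra_simps)
  define \<theta> c where "\<theta> = angle s" and "c = cosh s"
  have \<theta>: "0 < \<theta>" "\<theta> < pi" using angle_pos[OF assms] angle_bounds(2)[OF s] by (auto simp: \<theta>_def)
  have c: "c \<ge> 1" using cosh_real_ge_1 by (simp add: c_def)
  define \<Delta> where "\<Delta> = c - cos \<theta>"
  have S: "sin \<theta> > 0" by (rule sin_gt_zero[OF \<theta>])
  have \<Delta>: "\<Delta> > 0" "\<Delta> = (\<beta> / 2) * (sin \<theta> / \<theta>)" using cosh_diff[OF s] \<theta> by (auto simp: \<Delta>_def c_def \<theta>_def)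
  have b: "\<beta> = 2 * \<Delta> * \<theta> / sin \<theta>" using \<Delta>(2) S \<theta> by simp
  have "p = 1 - \<beta> * ((c * cos \<theta> - 1) / (2 * \<Delta>\<^sup>2))"
    unfolding p_def Re_path_prod[OF s] by (simp add: \<Delta>_def c_def \<theta>_def)
  also have "\<dots> = 1 - \<theta> * (c * cos \<theta> - 1) / (sin \<theta> * \<Delta>)"
    unfolding b using \<Delta>(1) S by (simp add: power2_eq_square)
  also have "\<dots> = (sin \<theta> * \<Delta> - \<theta> * (c * cos \<theta> - 1)) / (sin \<theta> * \<Delta>)"
    using \<Delta>(1) S by (simp add: diff_divide_distrib)
  also have "sin \<theta> * \<Delta> - \<theta> * (c * cos \<theta> - 1) = c * (sin \<theta> - \<theta> * cos \<theta>) + (\<theta> - sin \<theta> * cos \<theta>)"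
    by (simp add: \<Delta>_def algebra_simps)
  also have "\<dots> / (sin \<theta> * \<Delta>) \<ge> 0"
  proof (intro divide_nonneg_nonneg add_nonneg_nonneg mult_nonneg_nonneg)
    show "0 \<le> sin \<theta> - \<theta> * cos \<theta>" using mult_cos_less_sin[OF \<theta>] by simp
    have "sin \<theta> * cos \<theta> \<le> sin \<theta>" using S by (simp add: mult_le_cancel_left1)
    also have "sin \<theta> \<le> \<theta>" using sin_x_le_x[of \<theta>] \<theta> by simp
    finally show "0 \<le> \<theta> - sin \<theta> * cos \<theta>" by simp
  qed (use c S \<Delta> in auto)
  finally have "p \<ge> 0" .
  thus ?thesis unfolding R by simp
qed

lemma X_at_deriv: assumes "\<bar>s\<bar> < s0"
  shows "((\<lambda>s. complex_of_real (X_at s)) has_vector_derivative ln_X_d s * of_real (X_at s)) (at s)"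
proof -
  have "((exp \<circ> (\<lambda>s. complex_of_real (ln_X s))) has_vector_derivative ln_X_d s * exp (complex_of_real (ln_X s))) (at s)"
    by (rule field_vector_diff_chain_at[OF of_real_ln_X_deriv[OF assms] DERIV_exp])
  thus ?thesis by (simp add: X_at_def o_def exp_of_real)
qed

section \<open>The measure as a push-forward\<close>

definition weight :: "real \<Rightarrow> real" where
  "weight s = indicator {- s0<..<s0} s *\<^sub>R (Im (path s) * Re (ln_X_d s) / pi)"
definition X_cut :: "real \<Rightarrow> real" where "X_cut s = indicator {- s0<..<s0} s *\<^sub>R X_at s"
text \<open>The density \<open>weight\<close> is Im w d(log X)/ds divided by pi, transported to the
  variable x = X. The cut-offs give functions on the whole line; outside the interval the weight is
  0, so the default value 0 of \<open>X_cut\<close> carries no mass.\<close>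

definition y_measure :: "real measure" where
  "y_measure = distr (density lborel (\<lambda>s. ennreal (weight s))) borel X_cut"

lemma angle_d_continuous: "continuous_on {- s0<..<s0} angle_d"
  unfolding angle_d_def
proof (intro continuous_intros)
  have angle: "continuous_on {- s0<..<s0} angle" by (rule continuous_on_subset[OF angle_continuous]) auto
  have "continuous_on {0<..<pi} cosh_of_d" unfolding cosh_of_d_def by (intro continuous_intros) auto
  thus "continuous_on {- s0<..<s0} (\<lambda>s. cosh_of_d (angle s))"
    by (rule continuous_on_compose2[OF _ angle]) (use angle_pos angle_bounds(2) in force)
  show "\<forall>s\<in>{- s0<..<s0}. cosh_of_d (angle s) \<noteq> 0"
  proof
    fix s assume "s \<in> {- s0<..<s0}"
    hence "\<bar>s\<bar> < s0" by auto
    thus "cosh_of_d (angle s) \<noteq> 0" using cosh_of_d_neg[OF angle_pos angle_bounds(2)] by force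
  qed
qed

lemma measurable_weight [measurable]: "weight \<in> borel_measurable borel"
proof -
  have w: "continuous_on {- s0<..<s0} path" by (rule continuous_on_subset[OF path_continuous]) auto
  have "continuous_on {- s0<..<s0} (\<lambda>s. Im (path s) * Re (ln_X_d s) / pi)"
    unfolding ln_X_d_def Complex_eq by (intro continuous_intros w angle_d_continuous) auto
  thus ?thesis unfolding weight_def[abs_def] by (intro borel_measurable_continuous_on_indicator) auto
qed

lemma measurable_X_cut [measurable]: "X_cut \<in> borel_measurable borel"
proof -
  have "continuous_on {- s0<..<s0} X_at" by (rule continuous_on_subset[OF X_at_continuous]) auto
  thus ?thesis unfolding X_cut_def[abs_def] by (intro borel_measurable_continuous_on_indicator) auto
qed

lemma weight_nonneg: "weight s \<ge> 0"
proof (cases "s \<in> {- s0<..<s0}")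
  case True
  hence "\<bar>s\<bar> < s0" by auto
  thus ?thesis using Im_path_nonneg[of s] Re_ln_X_d_nonneg[of s] by (simp add: weight_def)
qed (simp add: weight_def)

text \<open>With nonnegative integrals the gauge integral on the curve yields finiteness of the
  moment as well, so integrability needs no separate argument.\<close>

lemma y_measure_nn_moment:
  assumes I: "((\<lambda>s. Im (path s) * X_at s ^ n * Re (ln_X_d s)) has_integral pi * m) {- s0..s0}"
  shows "(\<integral>\<^sup>+x. ennreal (x ^ n) \<partial>y_measure) = ennreal m" "m \<ge> 0"
proof -
  have "((\<lambda>s. Im (path s) * X_at s ^ n * Re (ln_X_d s)) has_integral pi * m) {- s0<..<s0}"
    using I has_integral_Icc_iff_Ioo by blast
  hence "((\<lambda>s. Im (path s) * X_at s ^ n * Re (ln_X_d s) * (1 / pi)) has_integral pi * m * (1 / pi)) {- s0<..<s0}"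
    by (rule has_integral_mult_left)
  hence I': "((\<lambda>s. Im (path s) * X_at s ^ n * Re (ln_X_d s) / pi) has_integral m) {- s0<..<s0}" by simp
  have nn: "0 \<le> Im (path s) * X_at s ^ n * Re (ln_X_d s) / pi" if "s \<in> {- s0<..<s0}" for s
  proof -
    have "\<bar>s\<bar> < s0" using that by auto
    thus "0 \<le> Im (path s) * X_at s ^ n * Re (ln_X_d s) / pi"
      using Im_path_nonneg[of s] Re_ln_X_d_nonneg[of s] by (simp add: X_at_def)
  qed
  show "m \<ge> 0" using has_integral_nonneg[OF I' nn] .
  have "(\<integral>\<^sup>+x. ennreal (x ^ n) \<partial>y_measure) = (\<integral>\<^sup>+s. ennreal (weight s) * ennreal (X_cut s ^ n) \<partial>lborel)"
    unfolding y_measure_def by (subst nn_integral_distr) (auto simp: nn_integral_density)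
  also have "\<dots> = (\<integral>\<^sup>+s. indicator {- s0<..<s0} s * ennreal (Im (path s) * X_at s ^ n * Re (ln_X_d s) / pi) \<partial>lborel)"
  proof (rule nn_integral_cong)
    fix s
    show "ennreal (weight s) * ennreal (X_cut s ^ n) = indicator {- s0<..<s0} s * ennreal (Im (path s) * X_at s ^ n * Re (ln_X_d s) / pi)"
    proof (cases "s \<in> {- s0<..<s0}")
      case True
      have "ennreal (weight s) * ennreal (X_cut s ^ n) = ennreal (weight s * X_cut s ^ n)"
        using weight_nonneg True by (subst ennreal_mult') (auto simp: X_cut_def X_at_def)
      thus ?thesis using True by (simp add: weight_def X_cut_def mult_ac)
    qed (simp add: weight_def)
  qed
  also have "\<dots> = (\<integral>\<^sup>+s. ennreal (indicator {- s0<..<s0} s * (Im (path s) * X_at s ^ n * Re (ln_X_d s) / pi)) \<partial>lborel)"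
    by (intro nn_integral_cong) (auto simp: indicator_def)
  also have "\<dots> = ennreal m"
    by (rule nn_integral_has_integral_lebesgue[OF nn I'])
  finally show "(\<integral>\<^sup>+x. ennreal (x ^ n) \<partial>y_measure) = ennreal m" .
qed

text \<open>
  The logarithm with its cut along the negative imaginary axis, so that it is continuous on the
  closed upper half-plane without $0$.
\<close>

definition Lg :: "complex \<Rightarrow> complex" where "Lg z = Ln (- \<i> * z) + \<i> * of_real (pi / 2)"

lemma Lg_deriv: assumes "Im z \<ge> 0" "z \<noteq> 0" shows "(Lg has_field_derivative 1 / z) (at z)"
proof -
  have "- \<i> * z \<notin> \<real>\<^sub>\<le>\<^sub>0" using assms by (auto simp: complex_nonpos_Reals_iff complex_eq_iff)
  hence "((\<lambda>z. Ln (- \<i> * z)) has_field_derivative inverse (- \<i> * z) * (- \<i>)) (at z)"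
    by (intro DERIV_chain2[OF has_field_derivative_Ln]) (auto intro!: derivative_eq_intros)
  hence "((\<lambda>z. Ln (- \<i> * z) + \<i> * of_real (pi / 2)) has_field_derivative inverse (- \<i> * z) * (- \<i>) + 0) (at z)"
    by (intro DERIV_add DERIV_const)
  moreover have "inverse (- \<i> * z) * (- \<i>) + 0 = 1 / z" using assms by (simp add: field_simps)
  ultimately show ?thesis unfolding Lg_def[abs_def] by simp
qed

lemma Im_Lg_pos: "u > 0 \<Longrightarrow> Im (Lg (of_real u)) = 0"
proof -
  assume u: "u > 0"
  have "Arg (- \<i> * of_real u) = - pi / 2"
    using u pi_gt_zero by (intro Arg_unique[of u]) (auto simp: complex_eq_iff Re_exp Im_exp intro: order_trans[of _ 0])
  thus ?thesis using u by (simp add: Lg_def Arg_eq_Im_Ln[symmetric])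
qed

lemma Im_Lg_neg: "u < 0 \<Longrightarrow> Im (Lg (of_real u)) = pi"
proof -
  assume u: "u < 0"
  have "Arg (- \<i> * of_real u) = pi / 2"
    using u by (intro Arg_unique[of "- u"]) (auto simp: complex_eq_iff Re_exp Im_exp)
  thus ?thesis using u by (simp add: Lg_def Arg_eq_Im_Ln[symmetric])
qed

section \<open>Moment integrals by residues\<close>

lemma path_comp_deriv:
  assumes "\<bar>s\<bar> < s0" "(g has_field_derivative g') (at (path s))"
  shows "((\<lambda>s. g (path s)) has_vector_derivative - (path s * (1 + path s)) * Complex 1 (- angle_d s) * g') (at s)"
  using field_vector_diff_chain_at[OF path_deriv[OF assms(1)] assms(2)] by (simp add: o_def)

text \<open>X and d(log X) are real on the curve, so the imaginary part of w X^n d(log X) falls on w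
  alone. A primitive along the open curve, continuous up to the ends, is then enough.\<close>

lemma Im_has_integral:
  assumes P: "continuous_on {- s0..s0} P"
    and d: "\<And>s. \<bar>s\<bar> < s0 \<Longrightarrow> (P has_vector_derivative path s * of_real (X_at s) ^ n * ln_X_d s) (at s)"
  shows "((\<lambda>s. Im (path s) * X_at s ^ n * Re (ln_X_d s)) has_integral Im (P s0) - Im (P (- s0))) {- s0..s0}"
proof -
  have "((\<lambda>s. path s * of_real (X_at s) ^ n * ln_X_d s) has_integral P s0 - P (- s0)) {- s0..s0}"
    using s0_pos d by (intro fundamental_theorem_of_calculus_interior P) auto
  from has_integral_linear[OF this bounded_linear_Im]
  have "((\<lambda>s. Im (path s * of_real (X_at s) ^ n * ln_X_d s)) has_integral Im (P s0) - Im (P (- s0))) {- s0..s0}"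
    by (simp add: o_def)
  hence I: "((\<lambda>s. Im (path s * of_real (X_at s) ^ n * ln_X_d s)) has_integral Im (P s0) - Im (P (- s0))) {- s0<..<s0}"
    using has_integral_Icc_iff_Ioo by blast
  have eq: "Im (path s * of_real (X_at s) ^ n * ln_X_d s) = Im (path s) * X_at s ^ n * Re (ln_X_d s)" if "s \<in> {- s0<..<s0}" for s
  proof -
    have "\<bar>s\<bar> < s0" using that by auto
    then obtain r where r: "ln_X_d s = of_real r" using ln_X_d_eq by blast
    have "path s * of_real (X_at s) ^ n * ln_X_d s = path s * of_real (X_at s ^ n * Re (ln_X_d s))"
      unfolding r by (simp add: mult.assoc)
    hence "Im (path s * of_real (X_at s) ^ n * ln_X_d s) = Im (path s * of_real (X_at s ^ n * Re (ln_X_d s)))" by (rule arg_cong)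
    also have "\<dots> = Im (path s) * (X_at s ^ n * Re (ln_X_d s))"
      by (simp only: times_complex.sel Re_complex_of_real Im_complex_of_real mult_zero_right add_0_left)
    finally show ?thesis by (simp only: mult.assoc)
  qed
  have "((\<lambda>s. Im (path s) * X_at s ^ n * Re (ln_X_d s)) has_integral Im (P s0) - Im (P (- s0))) {- s0<..<s0}"
    by (rule has_integral_eq[OF eq I])
  thus ?thesis using has_integral_Icc_iff_Ioo by blast
qed

text \<open>From log X = log(1 + w) - log w + \<beta> w one gets w d(log X) = (\<beta> w - 1/(1 +
  w)) dw. The total mass thus comes from the argument of 1 + w, which changes by pi between the
  ends.\<close>

lemma moment_integral_0:
  "((\<lambda>s. Im (path s) * X_at s ^ 0 * Re (ln_X_d s)) has_integral pi * 1) {- s0..s0}"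
proof -
  define P where "P s = of_real \<beta> * (path s)\<^sup>2 / 2 - Lg (1 + path s)" for s
  have Im1: "Im (1 + path s) \<ge> 0" if "\<bar>s\<bar> \<le> s0" for s using Im_path_nonneg[OF that] by simp
  have contL: "continuous_on {z. Im z \<ge> 0 \<and> z \<noteq> 0} Lg"
    by (intro continuous_at_imp_continuous_on ballI DERIV_isCont[OF Lg_deriv]) auto
  have "continuous_on {- s0..s0} (\<lambda>s. Lg (1 + path s))"
    by (rule continuous_on_compose2[OF contL]) (use Im_path_nonneg path_neq_0(2) in \<open>auto intro!: continuous_intros path_continuous simp: abs_le_iff\<close>)
  hence P: "continuous_on {- s0..s0} P" unfolding P_def by (intro continuous_intros path_continuous) auto
  have d: "(P has_vector_derivative path s * of_real (X_at s) ^ 0 * ln_X_d s) (at s)" if s: "\<bar>s\<bar> < s0" for s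
  proof -
    have nz: "1 + path s \<noteq> 0" "Im (1 + path s) \<ge> 0" using path_neq_0(2)[of s] Im1[of s] s by auto
    have "((\<lambda>z. of_real \<beta> * z\<^sup>2 / 2 - Lg (1 + z)) has_field_derivative of_real \<beta> * path s - 1 / (1 + path s)) (at (path s))"
    proof (intro DERIV_diff)
      show "((\<lambda>z. of_real \<beta> * z\<^sup>2 / 2) has_field_derivative of_real \<beta> * path s) (at (path s))"
        by (auto intro!: derivative_eq_intros)
      have "((\<lambda>z. Lg (1 + z)) has_field_derivative 1 / (1 + path s) * 1) (at (path s))"
        by (rule DERIV_chain2[where f = Lg and g = "\<lambda>z. 1 + z" and x = "path s"])
           (use Lg_deriv[OF nz(2,1)] in \<open>auto intro!: derivative_eq_intros\<close>)
      thus "((\<lambda>z. Lg (1 + z)) has_field_derivative 1 / (1 + path s)) (at (path s))" by simp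
    qed
    from path_comp_deriv[OF s this]
    have "(P has_vector_derivative - (path s * (1 + path s)) * Complex 1 (- angle_d s) * (of_real \<beta> * path s - 1 / (1 + path s))) (at s)"
      unfolding P_def .
    moreover have "- (path s * (1 + path s)) * Complex 1 (- angle_d s) * (of_real \<beta> * path s - 1 / (1 + path s)) = path s * of_real (X_at s) ^ 0 * ln_X_d s"
    proof -
      have "- (path s * (1 + path s)) * (of_real \<beta> * path s - 1 / (1 + path s)) = path s * (1 - of_real \<beta> * (path s * (1 + path s)))"
        using nz(1) by (simp add: right_diff_distrib)
      hence "- (path s * (1 + path s)) * (of_real \<beta> * path s - 1 / (1 + path s)) * Complex 1 (- angle_d s) = path s * ln_X_d s"
        unfolding ln_X_d_def by (simp only: mult.assoc)
      thus ?thesis by (simp only: power_0 mult_1_right mult_1_left mult_ac)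
    qed
    ultimately show ?thesis by simp
  qed
  obtain u where u: "u > 0" "path s0 = of_real u" "path (- s0) = of_real (- 1 - u)" by (rule path_endpoints)
  have "Lg (1 + path s0) = Lg (of_real (1 + u))" "Lg (1 + path (- s0)) = Lg (of_real (- u))" using u by simp_all
  hence "Im (P s0) = 0" "Im (P (- s0)) = - pi"
    unfolding P_def using u Im_Lg_pos[of "1 + u"] Im_Lg_neg[of "- u"] by (simp_all add: power2_eq_square)
  thus ?thesis using Im_has_integral[OF P d] by simp
qed

text \<open>Integration by parts with N = n + 1: N w X^N d(log X) = d(w X^N) - X^N dw. The boundary
  term is real, and X^N has its only pole at 0 with residue a n. Its primitive is therefore Q + a n
  log w, and the argument of w changes by pi between the ends.\<close>

lemma moment_integral_Suc:
  assumes a: "\<And>w::complex. (\<lambda>k. of_real (a k) * w ^ k) sums ((1 + w) * exp (of_real \<beta> * w)) ^ Suc n"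
  shows "((\<lambda>s. Im (path s) * X_at s ^ Suc n * Re (ln_X_d s)) has_integral pi * (a n / Suc n)) {- s0..s0}"
proof -
  obtain Q where Q: "\<And>w. w \<noteq> 0 \<Longrightarrow> (Q has_field_derivative ((1 + w) * exp (of_real \<beta> * w)) ^ Suc n / w ^ Suc n - of_real (a n) / w) (at w)"
    "\<And>x::real. x \<noteq> 0 \<Longrightarrow> Im (Q (of_real x)) = 0"
    using primitive_modulo_residue[OF a, of n] by blast
  define A where "A z = Q z + of_real (a n) * Lg z" for z
  have A: "(A has_field_derivative ((1 + w) * exp (of_real \<beta> * w) / w) ^ Suc n) (at w)" if "w \<noteq> 0" "Im w \<ge> 0" for w
  proof -
    have "(A has_field_derivative (((1 + w) * exp (of_real \<beta> * w)) ^ Suc n / w ^ Suc n - of_real (a n) / w) + of_real (a n) * (1 / w)) (at w)"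
      unfolding A_def by (intro DERIV_add DERIV_cmult Q(1) Lg_deriv that)
    thus ?thesis by (simp add: power_divide)
  qed
  define N :: complex where "N = of_nat (Suc n)"
  have N: "N \<noteq> 0" by (simp add: N_def del: of_nat_Suc)
  define P where "P s = (path s * of_real (X_at s) ^ Suc n - A (path s)) / N" for s
  have contA: "continuous_on {z. Im z \<ge> 0 \<and> z \<noteq> 0} A"
    by (intro continuous_at_imp_continuous_on ballI DERIV_isCont[OF A]) auto
  have "continuous_on {- s0..s0} (\<lambda>s. A (path s))"
    by (rule continuous_on_compose2[OF contA path_continuous]) (use Im_path_nonneg path_neq_0(1) in \<open>auto simp: abs_le_iff\<close>)
  hence P: "continuous_on {- s0..s0} P" unfolding P_def
    by (intro continuous_intros path_continuous X_at_continuous ballI N)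
  have d: "(P has_vector_derivative path s * of_real (X_at s) ^ Suc n * ln_X_d s) (at s)" if s: "\<bar>s\<bar> < s0" for s
  proof -
    define W where "W = - (path s * (1 + path s)) * Complex 1 (- angle_d s)"
    have nz: "path s \<noteq> 0" "Im (path s) \<ge> 0" using path_neq_0(1)[of s] Im_path_nonneg[of s] s by auto
    have x: "(1 + path s) * exp (of_real \<beta> * path s) / path s = of_real (X_at s)" using of_real_X_at[of s] s by simp
    have dA: "((\<lambda>s. A (path s)) has_vector_derivative W * of_real (X_at s) ^ Suc n) (at s)"
      using path_comp_deriv[OF s A[OF nz]] unfolding W_def x .
    have "((\<lambda>z. z ^ Suc n) has_field_derivative N * of_real (X_at s) ^ n) (at (complex_of_real (X_at s)))"
      using DERIV_power_Suc[OF DERIV_ident, of n "complex_of_real (X_at s)" UNIV] by (simp add: N_def)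
    from field_vector_diff_chain_at[OF X_at_deriv[OF s] this]
    have dx: "((\<lambda>s. complex_of_real (X_at s) ^ Suc n) has_vector_derivative ln_X_d s * of_real (X_at s) * (N * of_real (X_at s) ^ n)) (at s)"
      by (simp add: o_def)
    have "(P has_vector_derivative ((path s * (ln_X_d s * of_real (X_at s) * (N * of_real (X_at s) ^ n)) + W * of_real (X_at s) ^ Suc n) - W * of_real (X_at s) ^ Suc n) / N) (at s)"
      unfolding P_def by (intro has_vector_derivative_divide has_vector_derivative_diff has_vector_derivative_mult dA dx)
        (use path_deriv[OF s] in \<open>simp only: W_def\<close>)
    moreover have "((path s * (ln_X_d s * of_real (X_at s) * (N * of_real (X_at s) ^ n)) + W * of_real (X_at s) ^ Suc n) - W * of_real (X_at s) ^ Suc n) / N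
       = path s * of_real (X_at s) ^ Suc n * ln_X_d s" using N by simp
    ultimately show ?thesis by simp
  qed
  obtain u where u: "u > 0" "path s0 = of_real u" "path (- s0) = of_real (- 1 - u)" by (rule path_endpoints)
  have nn: "path s0 * of_real (X_at s0) ^ Suc n = of_real (u * X_at s0 ^ Suc n)"
    "path (- s0) * of_real (X_at (- s0)) ^ Suc n = of_real ((- 1 - u) * X_at (- s0) ^ Suc n)" using u by simp_all
  have "Im (A (path s0)) = 0" unfolding A_def u(2) using Q(2)[of u] Im_Lg_pos[OF u(1)] u(1) by simp
  moreover have "Im (A (path (- s0))) = a n * pi"
    unfolding A_def u(3) using Q(2)[of "- 1 - u"] Im_Lg_neg[of "- 1 - u"] u(1) by simp
  moreover have NI: "Im (z / N) = Im z / Suc n" for z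
    unfolding N_def by (metis Im_divide_of_nat)
  ultimately have "Im (P s0) = 0" "Im (P (- s0)) = - (a n * pi) / Suc n"
    unfolding P_def NI nn by (simp_all del: of_nat_Suc)
  thus ?thesis using Im_has_integral[OF P d] by (simp add: mult.commute)
qed

end

section \<open>Lagrange coefficients as moments and the resulting equation for G\<close>

lemma fps_power_Reals:
  fixes F :: "complex fps"
  assumes "\<And>k. fps_nth F k \<in> \<real>" shows "fps_nth (F ^ n) k \<in> \<real>"
proof (induction n arbitrary: k)
  case 0 thus ?case by simp
next
  case (Suc n)
  show ?case unfolding power_Suc fps_mult_nth by (intro sum_in_Reals Reals_mult assms Suc)
qed

context y_curve
begin

text \<open>The inverse of Psi is w S(w) / (1 + w), which for S = exp(-\<beta> w) is w divided by
  this series. So \<open>m_y\<close> lists the moments that Lagrange inversion prescribes, with the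
  total mass 1 in front.\<close>

definition F_y :: "complex fps" where "F_y = (1 + fps_X) * fps_exp (of_real \<beta>)"
definition m_y :: "nat \<Rightarrow> real" where
  "m_y n = (if n = 0 then 1 else Re (fps_nth (F_y ^ n) (n - 1)) / n)"

lemma F_y_expansion: "(\<lambda>w. (1 + w) * exp (of_real \<beta> * w)) has_fps_expansion F_y"
  unfolding F_y_def by (intro fps_expansion_intros)

lemma F_y_Reals: "fps_nth (F_y ^ n) k \<in> \<real>"
proof (rule fps_power_Reals)
  fix k
  have "fps_nth F_y k = fps_nth (fps_exp (of_real \<beta>)) k + (if k = 0 then 0 else fps_nth (fps_exp (of_real \<beta>)) (k - 1))"
    by (simp add: F_y_def distrib_right)
  moreover have "fps_nth (fps_exp (complex_of_real \<beta>)) j \<in> \<real>" for j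
  proof -
    have "fps_nth (fps_exp (complex_of_real \<beta>)) j = of_real (\<beta> ^ j / fact j)" by simp
    thus ?thesis by (metis Reals_of_real)
  qed
  ultimately show "fps_nth F_y k \<in> \<real>" by (auto intro: Reals_add)
qed

lemma F_y_sums:
  fixes w :: complex
  shows "(\<lambda>k. of_real (Re (fps_nth (F_y ^ n) k)) * w ^ k) sums ((1 + w) * exp (of_real \<beta> * w)) ^ n"
proof -
  have e: "(\<lambda>w. ((1 + w) * exp (of_real \<beta> * w)) ^ n) has_fps_expansion F_y ^ n"
    by (rule has_fps_expansion_power[OF F_y_expansion])
  have "(\<lambda>k. fps_nth (F_y ^ n) k * w ^ k) sums ((1 + w) * exp (of_real \<beta> * w)) ^ n"
    by (rule has_fps_expansion_imp_sums_complex[OF e, where r = \<infinity>]) (auto intro!: holomorphic_intros)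
  moreover have "of_real (Re (fps_nth (F_y ^ n) k)) = fps_nth (F_y ^ n) k" for k
    using F_y_Reals by (simp add: of_real_Re)
  ultimately show ?thesis by simp
qed

lemma y_measure_moment:
  "(\<integral>\<^sup>+x. ennreal (x ^ n) \<partial>y_measure) = ennreal (m_y n)" "m_y n \<ge> 0"
proof -
  have "((\<lambda>s. Im (path s) * X_at s ^ n * Re (ln_X_d s)) has_integral pi * m_y n) {- s0..s0}"
  proof (cases n)
    case 0 thus ?thesis using moment_integral_0 by (simp add: m_y_def)
  next
    case (Suc l)
    have "((\<lambda>s. Im (path s) * X_at s ^ Suc l * Re (ln_X_d s)) has_integral pi * (Re (fps_nth (F_y ^ Suc l) l) / Suc l)) {- s0..s0}"
      by (rule moment_integral_Suc[OF F_y_sums])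
    thus ?thesis using Suc by (simp add: m_y_def del: power_Suc of_nat_Suc)
  qed
  thus "(\<integral>\<^sup>+x. ennreal (x ^ n) \<partial>y_measure) = ennreal (m_y n)" "m_y n \<ge> 0" by (rule y_measure_nn_moment)+
qed

lemma sets_y_measure [simp, measurable_cong]: "sets y_measure = sets borel"
  by (simp add: y_measure_def)

lemma prob_space_y_measure: "prob_space y_measure"
proof (rule prob_spaceI)
  show "emeasure y_measure (space y_measure) = 1" using y_measure_moment(1)[of 0] by (simp add: m_y_def)
qed

lemma y_measure_bounded: "\<exists>K\<ge>0. AE x in y_measure. 0 \<le> x \<and> x \<le> K"
proof -
  have "bounded (X_at ` {- s0..s0})" by (intro compact_imp_bounded compact_continuous_image X_at_continuous compact_Icc)
  then obtain K where K: "\<forall>s\<in>{- s0..s0}. \<bar>X_at s\<bar> \<le> K" by (auto simp: bounded_iff)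
  have K0: "K \<ge> 0" using bspec[OF K, of 0] s0_pos by auto
  have "0 \<le> X_cut s \<and> X_cut s \<le> K" for s
    using bspec[OF K, of s] K0 by (auto simp: X_cut_def indicator_def X_at_def)
  hence "AE x in y_measure. 0 \<le> x \<and> x \<le> K"
    unfolding y_measure_def by (subst AE_distr_iff) auto
  thus ?thesis using K0 by blast
qed

lemma prob_on_Rplus_y_measure: "prob_on_Rplus y_measure"
proof -
  interpret prob_space y_measure by (rule prob_space_y_measure)
  have "AE x in y_measure. x \<in> {0..}" using y_measure_bounded by (auto elim: eventually_mono)
  hence "emeasure y_measure {0..} = 1" by (intro emeasure_eq_1_AE) auto
  thus ?thesis using prob_space_y_measure by (simp add: prob_on_Rplus_def prob_on_R_def)
qed

lemma y_measure_integral_moment: "(\<integral>x. x ^ n \<partial>y_measure) = m_y n"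
proof -
  have "AE x in y_measure. 0 \<le> x ^ n" using y_measure_bounded by (auto elim: eventually_mono)
  hence "(\<integral>x. x ^ n \<partial>y_measure) = enn2real (\<integral>\<^sup>+x. ennreal (x ^ n) \<partial>y_measure)"
    by (intro integral_eq_nn_integral) auto
  thus ?thesis using y_measure_moment by simp
qed

text \<open>By its moments the measure has Psi equal to the solution g of g = z (1 + g) exp(\<beta>
  g) near 0. At z = 1/v one has G = z (1 + g), which is the functional equation for large |v|; the
  identity theorem carries it to the slit plane. The moment of order 0 is subtracted because the
  inversion lemma concerns series without constant term.\<close>

lemma y_measure_fe:
  assumes "v \<in> slit_plane"
  shows "cauchy_fe_at \<beta> 1 y_measure v"
proof -
  interpret prob_space y_measure by (rule prob_space_y_measure)
  obtain K where K: "K \<ge> 0" "AE x in y_measure. 0 \<le> x \<and> x \<le> K" using y_measure_bounded by blast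
  define g where "g z = (\<integral>x. 1 / (1 - complex_of_real x * z) \<partial>y_measure) - 1" for z
  have g_sums: "(\<lambda>n. of_real (if n = 0 then 0 else m_y n) * z ^ n) sums g z" if "cmod z < 1 / (K + 1)" for z
  proof -
    have "K * cmod z \<le> (K + 1) * cmod z" by (simp add: algebra_simps)
    also have "\<dots> < 1" using that K(1) by (simp add: field_simps)
    finally have "(\<lambda>n. of_real (m_y n) * z ^ n) sums (\<integral>x. 1 / (1 - complex_of_real x * z) \<partial>y_measure)"
      using sums_integral_geometric[OF finite_measure_axioms _ K(2,1)] by (simp add: y_measure_integral_moment)
    moreover have "(\<lambda>n. if n = 0 then 1 else 0 :: complex) sums 1" using sums_single[of 0 "\<lambda>_. 1::complex"] by simp
    ultimately have "(\<lambda>n. of_real (m_y n) * z ^ n - (if n = 0 then 1 else 0)) sums g z"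
      unfolding g_def by (rule sums_diff)
    moreover have "of_real (m_y n) * z ^ n - (if n = 0 then 1 else 0) = of_real (if n = 0 then 0 else m_y n) * z ^ n" for n
      by (simp add: m_y_def)
    ultimately show ?thesis by simp
  qed
  have "\<exists>\<delta>>0. \<forall>z. cmod z < \<delta> \<longrightarrow> g z = z * ((1 + g z) * exp (of_real \<beta> * g z))"
  proof (rule lagrange_inversion_eval[OF F_y_expansion _ _ _ _ g_sums])
    show "fps_nth F_y 0 \<noteq> 0" by (simp add: F_y_def)
    fix n :: nat assume n: "n \<ge> 1"
    have "of_nat n * complex_of_real (m_y n) = of_real (Re (fps_nth (F_y ^ n) (n - 1)))"
      using n by (simp add: m_y_def)
    also have "\<dots> = fps_nth (F_y ^ n) (n - 1)" using F_y_Reals by (rule of_real_Re)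
    finally show "of_nat n * complex_of_real (if n = 0 then 0 else m_y n) = fps_nth (F_y ^ n) (n - 1)" using n by simp
  qed (use K in auto)
  then obtain \<delta> where \<delta>: "\<delta> > 0" "\<And>z. cmod z < \<delta> \<Longrightarrow> g z = z * ((1 + g z) * exp (of_real \<beta> * g z))" by blast
  define S where "S = slit_plane"
  define U where "U = S \<inter> {v. 1 / \<delta> < cmod v}"
  have fe: "cauchy_fe_at \<beta> 1 y_measure v" if v: "v \<in> U" for v
  proof -
    have "1 / \<delta> > 0" using \<delta>(1) by simp
    hence v0: "v \<noteq> 0" and vn: "cmod v > 1 / \<delta>" using v by (auto simp: U_def)
    define z where "z = 1 / v"
    have "1 / cmod v < \<delta>" using vn \<delta>(1) v0 by (simp add: field_simps)
    hence z: "cmod z < \<delta>" by (simp add: z_def norm_divide)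
    have "1 / (1 - complex_of_real x * z) = v * (1 / (v - complex_of_real x))" for x
      using v0 by (simp add: z_def divide_simps)
    hence "g z = v * cauchy_transform y_measure v - 1"
      unfolding g_def cauchy_transform_def by (simp only: integral_mult_right_zero)
    moreover from this have "cauchy_transform y_measure v = z * (1 + g z)" using v0 by (simp add: z_def)
    moreover have "z * (1 + g z) = g z * exp (- of_real \<beta> * g z)"
    proof -
      have "g z * exp (- of_real \<beta> * g z) = z * ((1 + g z) * exp (of_real \<beta> * g z)) * exp (- of_real \<beta> * g z)"
        using \<delta>(2)[OF z] by simp
      also have "\<dots> = z * (1 + g z) * (exp (of_real \<beta> * g z) * exp (- of_real \<beta> * g z))" by (simp only: mult_ac)
      also have "exp (of_real \<beta> * g z) * exp (- of_real \<beta> * g z) = 1" by (simp flip: exp_add)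
      finally show ?thesis by simp
    qed
    ultimately show ?thesis unfolding cauchy_fe_at_def Let_def of_real_1 div_by_1 by metis
  qed
  have "open U" unfolding U_def S_def
    by (intro open_Int open_connected_slit open_Collect_less continuous_intros)
  moreover have X_cut: "- complex_of_real (1 / \<delta> + 1) \<in> U"
  proof -
    have p: "1 / \<delta> + 1 > 0" using \<delta>(1) by (simp add: add_pos_pos)
    have "cmod (- complex_of_real (1 / \<delta> + 1)) = 1 / \<delta> + 1" unfolding norm_minus_cancel norm_of_real using p by simp
    thus ?thesis using slit_neg[OF p] by (simp add: U_def S_def)
  qed
  ultimately have lim: "- complex_of_real (1 / \<delta> + 1) islimpt U"
    using interior_limit_point interior_open by metis
  show ?thesis
    by (rule cauchy_fe_identity[OF cauchy_transform_holomorphic_slit[OF prob_on_Rplus_y_measure] open_connected_slit _ _ lim fe assms])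
       (use X_cut in \<open>auto simp: U_def S_def\<close>)
qed

end

theorem y_measure_exists:
  assumes "\<beta> > 0"
  shows "\<exists>\<mu>. prob_on_Rplus \<mu> \<and> (\<forall>v \<in> slit_plane. cauchy_fe_at \<beta> 1 \<mu> v)"
proof -
  interpret y_curve \<beta> by standard fact
  show ?thesis using prob_on_Rplus_y_measure y_measure_fe by blast
qed

section \<open>The Levy measure\<close>

text \<open>The reciprocal of f, written with \<open>sinc\<close> so that it extends continuously to
  u = 0 with value e.\<close>

definition h_fun :: "real \<Rightarrow> real" where "h_fun u = sinc u * exp (cos u / sinc u)"

lemma sinc_pos: assumes "0 \<le> u" "u < pi" shows "sinc u > 0"
  using assms sin_gt_zero[of u] by (cases "u = 0") auto

lemma f_fun_eq: assumes "0 < u" "u < pi" shows "f_fun u = 1 / h_fun u"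
  using assms sin_gt_zero[of u] by (simp add: f_fun_def h_fun_def cot_def exp_minus field_simps)

lemma h_fun_pos: assumes "0 \<le> u" "u < pi" shows "h_fun u > 0"
  unfolding h_fun_def using sinc_pos[OF assms] by (intro mult_pos_pos) auto

lemma h_fun_continuous: "continuous_on {0..<pi} h_fun"
proof -
  have "\<forall>u\<in>{0..<pi}. sinc u \<noteq> 0" using sinc_pos by force
  thus ?thesis unfolding h_fun_def by (intro continuous_intros)
qed

text \<open>The curve $u \cot u + i u$, on which $e^w / w$ is real; it starts at $1$ when $u = 0$.\<close>

definition W_curve :: "real \<Rightarrow> complex" where "W_curve u = of_real (1 / sinc u) * exp (\<i> * of_real u)"

lemma W_curve_Re_Im:
  assumes "0 \<le> u" "u < pi"
  shows "Re (W_curve u) = cos u / sinc u" "Im (W_curve u) = u"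
proof -
  have e: "exp (\<i> * complex_of_real u) = Complex (cos u) (sin u)" by (simp add: complex_eq_iff Re_exp Im_exp)
  have W: "W_curve u = Complex (cos u / sinc u) (sin u / sinc u)"
    unfolding W_curve_def e by (simp add: complex_eq_iff)
  show "Re (W_curve u) = cos u / sinc u" unfolding W by simp
  have "sin u = u * sinc u" by simp
  hence "sin u / sinc u = u" using sinc_pos[OF assms] by (metis nonzero_mult_div_cancel_right order_less_irrefl)
  thus "Im (W_curve u) = u" unfolding W by simp
qed

text \<open>The argument and the imaginary part of W are both u, so the phases of exp W and W
  cancel.\<close>

lemma W_curve_exp:
  assumes "0 \<le> u" "u < pi"
  shows "exp (W_curve u) / W_curve u = of_real (h_fun u)" "W_curve u \<noteq> 0"
proof -
  have s: "sinc u > 0" by (rule sinc_pos[OF assms])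
  show "W_curve u \<noteq> 0" using s by (simp add: W_curve_def)
  have "W_curve u = of_real (cos u / sinc u) + \<i> * of_real u"
    using W_curve_Re_Im[OF assms] by (intro complex_eqI) simp_all
  hence "exp (W_curve u) = of_real (exp (cos u / sinc u)) * exp (\<i> * of_real u)"
    by (simp only: exp_add exp_of_real)
  thus "exp (W_curve u) / W_curve u = of_real (h_fun u)" using s by (simp add: W_curve_def h_fun_def)
qed

lemma Ln_W_curve:
  assumes "0 \<le> u" "u < pi"
  shows "Im (Ln (W_curve u)) = u" "W_curve u \<notin> \<real>\<^sub>\<le>\<^sub>0"
proof -
  have "Arg (W_curve u) = u"
    by (rule Arg_unique[of "1 / sinc u"]) (use sinc_pos[OF assms] assms in \<open>auto simp: W_curve_def\<close>)
  thus "Im (Ln (W_curve u)) = u" using W_curve_exp(2)[OF assms] by (simp add: Arg_eq_Im_Ln)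
  show "W_curve u \<notin> \<real>\<^sub>\<le>\<^sub>0"
  proof (cases "u = 0")
    case True thus ?thesis by (simp add: W_curve_def)
  next
    case False thus ?thesis using W_curve_Re_Im(2)[OF assms] by (auto simp: complex_nonpos_Reals_iff)
  qed
qed

lemma W_curve_continuous: "continuous_on {0..<pi} W_curve"
proof -
  have "\<forall>u\<in>{0..<pi}. sinc u \<noteq> 0" using sinc_pos by force
  thus ?thesis unfolding W_curve_def by (intro continuous_intros) auto
qed

text \<open>Since arg W = u, the logarithmic derivative has imaginary part 1. Its real part stays
  anonymous: it only ever multiplies a real number of which the imaginary part is taken.\<close>

lemma W_curve_deriv:
  assumes "0 < u" "u < pi"
  shows "\<exists>r. (W_curve has_vector_derivative W_curve u * (of_real r + \<i>)) (at u)"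
proof -
  define d where "d = (sin u - u * cos u) / (sin u)\<^sup>2"
  have s: "sin u > 0" by (rule sin_gt_zero[OF assms])
  have "((\<lambda>u. u / sin u) has_real_derivative d) (at u)"
    unfolding d_def using s by (auto intro!: derivative_eq_intros simp: power2_eq_square)
  hence 1: "((\<lambda>u. complex_of_real (u / sin u)) has_vector_derivative of_real d) (at u)"
    by (intro has_vector_derivative_of_real) (simp add: has_real_derivative_iff_has_vector_derivative)
  have 2: "((\<lambda>u. exp (\<i> * of_real u)) has_vector_derivative \<i> * exp (\<i> * of_real u)) (at u)"
  proof -
    have "((\<lambda>u. \<i> * complex_of_real u) has_vector_derivative \<i> * of_real 1) (at u)"
      by (intro has_vector_derivative_mult_right has_vector_derivative_of_real) (simp add: has_vector_derivative_id)
    from field_vector_diff_chain_at[OF this DERIV_exp] show ?thesis by (simp add: o_def)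
  qed
  have "((\<lambda>u. complex_of_real (u / sin u) * exp (\<i> * of_real u)) has_vector_derivative
     of_real (u / sin u) * (\<i> * exp (\<i> * of_real u)) + of_real d * exp (\<i> * of_real u)) (at u)"
    by (rule has_vector_derivative_mult[OF 1 2])
  moreover have "of_real (u / sin u) * (\<i> * exp (\<i> * of_real u)) + of_real d * exp (\<i> * of_real u) = W_curve u * (of_real (d * sin u / u) + \<i>)"
    unfolding W_curve_def using assms s by (simp add: field_simps)
  ultimately have "((\<lambda>u. complex_of_real (u / sin u) * exp (\<i> * of_real u)) has_vector_derivative W_curve u * (of_real (d * sin u / u) + \<i>)) (at u)" by simp
  hence "(W_curve has_vector_derivative W_curve u * (of_real (d * sin u / u) + \<i>)) (at u)"
    by (rule has_vector_derivative_transform_within_open[where S = "{0<..<pi}"]) (use assms in \<open>auto simp: W_curve_def\<close>)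
  thus ?thesis by blast
qed

lemma exp_primitive:
  "\<exists>Q. (\<forall>w::complex. w \<noteq> 0 \<longrightarrow> (Q has_field_derivative exp (of_nat n * w) / w ^ Suc n - of_real (real n ^ n / fact n) / w) (at w)) \<and>
     (\<forall>x::real. x \<noteq> 0 \<longrightarrow> Im (Q (of_real x)) = 0)"
proof -
  have "(\<lambda>k. of_real (real n ^ k / fact k) * w ^ k) sums exp (of_nat n * w)" for w :: complex
    using exp_converges[of "of_nat n * w"] by (simp add: power_mult_distrib scaleR_conv_of_real field_simps)
  from primitive_modulo_residue[of "\<lambda>k. real n ^ k / fact k", OF this, of n] show ?thesis .
qed

text \<open>As dW/W has imaginary part du and exp(W)/W = h is real, h^n du is the imaginary part of
  exp(n W) / W^(n+1) dW. The logarithm that restores the residue term contributes c arg W = c a at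
  the upper end; at the lower end W = 1 and everything is real.\<close>

lemma h_fun_power_integral:
  assumes Q: "\<And>w::complex. w \<noteq> 0 \<Longrightarrow> (Q has_field_derivative exp (of_nat n * w) / w ^ Suc n - of_real c / w) (at w)"
    "\<And>x::real. x \<noteq> 0 \<Longrightarrow> Im (Q (of_real x)) = 0"
    and a: "0 \<le> a" "a < pi"
  shows "((\<lambda>u. h_fun u ^ n) has_integral Im (Q (W_curve a)) + c * a) {0..a}"
proof -
  define P where "P w = Q w + of_real c * Ln w" for w
  have P: "(P has_field_derivative exp (of_nat n * w) / w ^ Suc n) (at w)" if "w \<notin> \<real>\<^sub>\<le>\<^sub>0" for w
  proof -
    have "w \<noteq> 0" using that by auto
    have "(P has_field_derivative (exp (of_nat n * w) / w ^ Suc n - of_real c / w) + of_real c * inverse w) (at w)"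
      unfolding P_def by (intro DERIV_add Q(1) \<open>w \<noteq> 0\<close> DERIV_cmult has_field_derivative_Ln that)
    thus ?thesis by (simp add: divide_inverse)
  qed
  have cont: "continuous_on {0..a} (\<lambda>u. P (W_curve u))"
  proof (rule continuous_on_compose2[where g = P and t = "- \<real>\<^sub>\<le>\<^sub>0"])
    show "continuous_on (- \<real>\<^sub>\<le>\<^sub>0) P"
      by (intro continuous_at_imp_continuous_on ballI DERIV_isCont[OF P]) auto
    show "continuous_on {0..a} W_curve" by (rule continuous_on_subset[OF W_curve_continuous]) (use a in auto)
    show "W_curve ` {0..a} \<subseteq> - \<real>\<^sub>\<le>\<^sub>0" using Ln_W_curve(2) a by auto
  qed
  have "((\<lambda>u. Im (P (W_curve u))) has_vector_derivative h_fun u ^ n) (at u)" if u: "u \<in> {0<..<a}" for u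
  proof -
    have u': "0 \<le> u" "u < pi" using u a by auto
    obtain r where r: "(W_curve has_vector_derivative W_curve u * (of_real r + \<i>)) (at u)"
      using W_curve_deriv[of u] u a by auto
    have "((\<lambda>u. P (W_curve u)) has_vector_derivative W_curve u * (of_real r + \<i>) * (exp (of_nat n * W_curve u) / W_curve u ^ Suc n)) (at u)"
      using field_vector_diff_chain_at[OF r P[OF Ln_W_curve(2)[OF u']]] by (simp add: o_def)
    from bounded_linear.has_vector_derivative[OF bounded_linear_Im this]
    have d: "((\<lambda>u. Im (P (W_curve u))) has_vector_derivative Im (W_curve u * (of_real r + \<i>) * (exp (of_nat n * W_curve u) / W_curve u ^ Suc n))) (at u)" .
    have "W_curve u * (of_real r + \<i>) * (exp (of_nat n * W_curve u) / W_curve u ^ Suc n) = (of_real r + \<i>) * (exp (W_curve u) / W_curve u) ^ n"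
      using W_curve_exp(2)[OF u'] by (simp add: exp_of_nat_mult power_divide)
    also have "\<dots> = (of_real r + \<i>) * of_real (h_fun u ^ n)" unfolding W_curve_exp(1)[OF u'] by simp
    finally have "Im (W_curve u * (of_real r + \<i>) * (exp (of_nat n * W_curve u) / W_curve u ^ Suc n)) = Im ((of_real r + \<i>) * of_real (h_fun u ^ n))"
      by (rule arg_cong)
    also have "\<dots> = h_fun u ^ n"
      by (simp only: times_complex.sel plus_complex.sel Im_complex_of_real Re_complex_of_real) simp
    finally show ?thesis using d by simp
  qed
  hence "((\<lambda>u. h_fun u ^ n) has_integral Im (P (W_curve a)) - Im (P (W_curve 0))) {0..a}"
    using a cont by (intro fundamental_theorem_of_calculus_interior continuous_intros) auto
  moreover have "W_curve 0 = of_real 1" by (simp add: W_curve_def)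
  hence "Im (P (W_curve 0)) = 0" using Q(2)[of 1] by (simp add: P_def)
  moreover have "Im (P (W_curve a)) = Im (Q (W_curve a)) + c * a" using Ln_W_curve(1)[OF a] by (simp add: P_def)
  ultimately show ?thesis by simp
qed

text \<open>In the half-plane Re w \<le> -R one has |exp(n w)| \<le> 1, so the derivative of Q has
  modulus at most (1 + |c|)/R. Comparing z with the real point -R on the same vertical line, where Q
  is real, bounds Im Q by the mean value inequality.\<close>

lemma exp_primitive_left_limit:
  assumes Q: "\<And>w::complex. w \<noteq> 0 \<Longrightarrow> (Q has_field_derivative exp (of_nat n * w) / w ^ Suc n - of_real c / w) (at w)"
    "\<And>x::real. x \<noteq> 0 \<Longrightarrow> Im (Q (of_real x)) = 0"
    and R: "Re z = - R" "R \<ge> 1"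
  shows "\<bar>Im (Q z)\<bar> \<le> (1 + \<bar>c\<bar>) / R * \<bar>Im z\<bar>"
proof -
  have "norm (Q z - Q (of_real (- R))) \<le> (1 + \<bar>c\<bar>) / R * norm (z - of_real (- R))"
  proof (rule field_differentiable_bound[where S = "{w. Re w \<le> - R}"])
    show "convex {w. Re w \<le> - R}" by (rule convex_halfspace_Re_le)
    fix w assume w: "w \<in> {w. Re w \<le> - R}"
    hence nw: "cmod w \<ge> R" "cmod w \<ge> 1" using abs_Re_le_cmod[of w] R(2) by auto
    hence "w \<noteq> 0" by auto
    thus "(Q has_field_derivative exp (of_nat n * w) / w ^ Suc n - of_real c / w) (at w within {w. Re w \<le> - R})"
      by (rule has_field_derivative_at_within[OF Q(1)])
    have "Re w \<le> 0" using w R(2) by simp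
    hence "real n * Re w \<le> 0" by (rule mult_nonneg_nonpos[OF of_nat_0_le_iff])
    hence "cmod (exp (of_nat n * w)) \<le> 1" by (simp add: norm_exp_eq_Re)
    moreover have "R \<le> cmod (w ^ Suc n)"
    proof -
      have "cmod w * 1 \<le> cmod w * cmod w ^ n" using nw by (intro mult_left_mono one_le_power) auto
      thus ?thesis using nw by (simp add: norm_mult norm_power)
    qed
    ultimately have "cmod (exp (of_nat n * w) / w ^ Suc n) \<le> 1 / R"
      unfolding norm_divide using R(2) by (intro frac_le) auto
    moreover have "cmod (of_real c / w) \<le> \<bar>c\<bar> / R" unfolding norm_divide norm_of_real using nw R(2) by (intro frac_le) auto
    ultimately show "cmod (exp (of_nat n * w) / w ^ Suc n - of_real c / w) \<le> (1 + \<bar>c\<bar>) / R"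
      using norm_triangle_ineq4[of "exp (of_nat n * w) / w ^ Suc n" "of_real c / w"] by (simp add: add_divide_distrib)
  qed (use R in auto)
  moreover have "z - of_real (- R) = \<i> * of_real (Im z)" using R(1) by (simp add: complex_eq_iff)
  hence "norm (z - of_real (- R)) = \<bar>Im z\<bar>" by (simp add: norm_mult)
  moreover have "\<bar>Im (Q z)\<bar> \<le> norm (Q z - Q (of_real (- R)))"
    using abs_Im_le_cmod[of "Q z - Q (of_real (- R))"] Q(2)[of "- R"] R(2) by simp
  ultimately show ?thesis by (metis order_trans)
qed

text \<open>As u tends to pi the curve escapes to the left with imaginary part below pi. The
  contribution of Q then vanishes, and only the term c pi from the logarithm remains; monotone
  convergence handles the open end.\<close>

lemma nn_integral_h_fun_power:
  "(\<integral>\<^sup>+u. ennreal (indicator {0<..<pi} u * h_fun u ^ n) \<partial>lborel) = ennreal (pi * (real n ^ n / fact n))"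
proof -
  define c where "c = real n ^ n / fact n"
  obtain Q where Q: "\<And>w::complex. w \<noteq> 0 \<Longrightarrow> (Q has_field_derivative exp (of_nat n * w) / w ^ Suc n - of_real c / w) (at w)"
    "\<And>x::real. x \<noteq> 0 \<Longrightarrow> Im (Q (of_real x)) = 0"
    using exp_primitive[of n] unfolding c_def[symmetric] by metis
  define a where "a k = pi - 1 / real (Suc k)" for k
  have a: "0 \<le> a k" "a k < pi" for k
  proof -
    have "1 / real (Suc k) \<le> 1" by simp
    thus "0 \<le> a k" unfolding a_def using pi_gt3 by linarith
    show "a k < pi" by (simp add: a_def)
  qed
  have a_mono: "a j \<le> a k" if "j \<le> k" for j k using that by (simp add: a_def frac_le)
  have a_lim: "a \<longlonglongrightarrow> pi"
  proof -
    have "(\<lambda>k. pi - inverse (real (Suc k))) \<longlonglongrightarrow> pi - 0" by (intro tendsto_intros LIMSEQ_inverse_real_of_nat)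
    thus ?thesis unfolding a_def[abs_def] by (simp add: inverse_eq_divide)
  qed
  define X where "X k u = ennreal (indicator {0..a k} u * h_fun u ^ n)" for k u
  have hm: "(\<lambda>u. indicator {0..a k} u *\<^sub>R h_fun u ^ n) \<in> borel_measurable borel" for k
    by (intro borel_measurable_continuous_on_indicator continuous_intros continuous_on_subset[OF h_fun_continuous]) (auto intro: le_less_trans[OF _ a(2)])
  have int: "integral\<^sup>N lborel (X k) = ennreal (Im (Q (W_curve (a k))) + c * a k)" for k
    unfolding X_def
  proof (rule nn_integral_has_integral_lebesgue[OF _ h_fun_power_integral[OF Q a]])
    fix u assume "u \<in> {0..a k}"
    thus "0 \<le> h_fun u ^ n" using h_fun_pos[of u] a(2)[of k] by simp
  qed
  have "(\<lambda>k. integral\<^sup>N lborel (X k)) \<longlonglongrightarrow> (\<integral>\<^sup>+u. ennreal (indicator {0..<pi} u * h_fun u ^ n) \<partial>lborel)"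
  proof (rule nn_integral_LIMSEQ)
    show "mono X"
    proof (intro monoI le_funI)
      fix i j :: nat and u assume "i \<le> j"
      hence "a i \<le> a j" by (rule a_mono)
      thus "X i u \<le> X j u" unfolding X_def using h_fun_pos[of u] a(2)[of j]
        by (intro ennreal_leI) (auto simp: indicator_def intro!: zero_le_power)
    qed
    show "X k \<in> borel_measurable lborel" for k using hm[of k] unfolding X_def by simp
    show "(\<lambda>k. X k u) \<longlonglongrightarrow> ennreal (indicator {0..<pi} u * h_fun u ^ n)" for u
    proof (cases "u < pi")
      case True
      have "\<forall>\<^sub>F k in sequentially. u < a k" using order_tendstoD(1)[OF a_lim True] .
      hence "\<forall>\<^sub>F k in sequentially. X k u = ennreal (indicator {0..<pi} u * h_fun u ^ n)"
        by eventually_elim (use True in \<open>auto simp: X_def indicator_def\<close>)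
      thus ?thesis by (rule tendsto_eventually)
    next
      case False
      hence "X k u = ennreal (indicator {0..<pi} u * h_fun u ^ n)" for k using a(2)[of k] by (auto simp: X_def indicator_def)
      thus ?thesis by simp
    qed
  qed
  moreover have "(\<lambda>k. integral\<^sup>N lborel (X k)) \<longlonglongrightarrow> ennreal (0 + c * pi)"
    unfolding int
  proof (intro tendsto_ennrealI tendsto_add tendsto_mult tendsto_const a_lim)
    \<comment> \<open>Minus the real part of the curve; it tends to infinity since the cosine tends
      to -1 and \<open>sinc\<close> to 0 from above.\<close>
    define R where "R k = - (cos (a k) / sinc (a k))" for k
    have Rtop: "filterlim R at_top sequentially"
    proof -
      have s0: "(\<lambda>k. sinc (a k)) \<longlonglongrightarrow> sinc pi" by (rule isCont_tendsto_compose[OF isCont_sinc a_lim])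
      have "filterlim (\<lambda>k. sinc (a k)) (at_right 0) sequentially"
      proof (rule tendsto_imp_filterlim_at_right)
        have "sinc pi = 0" by simp
        thus "(\<lambda>k. sinc (a k)) \<longlonglongrightarrow> 0" using s0 by (simp only:)
        show "\<forall>\<^sub>F k in sequentially. sinc (a k) > 0" by (intro always_eventually allI sinc_pos a)
      qed
      hence i: "filterlim (\<lambda>k. inverse (sinc (a k))) at_top sequentially" by (rule filterlim_compose[OF filterlim_inverse_at_top_right])
      have "(\<lambda>k. - cos (a k)) \<longlonglongrightarrow> - cos pi" by (intro tendsto_intros a_lim)
      hence "(\<lambda>k. - cos (a k)) \<longlonglongrightarrow> 1" by simp
      from filterlim_tendsto_pos_mult_at_top[OF this _ i] have "filterlim (\<lambda>k. - cos (a k) * inverse (sinc (a k))) at_top sequentially" by simp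
      thus ?thesis unfolding R_def[abs_def] by (simp only: divide_inverse minus_mult_left)
    qed
    show "(\<lambda>k. Im (Q (W_curve (a k)))) \<longlonglongrightarrow> 0"
    proof (rule Lim_null_comparison)
      have "\<forall>\<^sub>F k in sequentially. R k \<ge> 1" using Rtop by (simp add: filterlim_at_top)
      thus "\<forall>\<^sub>F k in sequentially. norm (Im (Q (W_curve (a k)))) \<le> (1 + \<bar>c\<bar>) / R k * pi"
      proof eventually_elim
        case (elim k)
        have "\<bar>Im (Q (W_curve (a k)))\<bar> \<le> (1 + \<bar>c\<bar>) / R k * \<bar>Im (W_curve (a k))\<bar>"
          by (rule exp_primitive_left_limit[OF Q _ elim], assumption, assumption, simp only: W_curve_Re_Im[OF a] R_def minus_minus)
        also have "\<dots> \<le> (1 + \<bar>c\<bar>) / R k * pi"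
          using elim a[of k] by (intro mult_left_mono) (simp_all only: W_curve_Re_Im[OF a], simp_all)
        finally show ?case by simp
      qed
      have "(\<lambda>k. (1 + \<bar>c\<bar>) / R k * pi) \<longlonglongrightarrow> 0 * pi"
        by (intro tendsto_mult tendsto_const tendsto_divide_0[OF tendsto_const filterlim_at_top_imp_at_infinity[OF Rtop]])
      thus "(\<lambda>k. (1 + \<bar>c\<bar>) / R k * pi) \<longlonglongrightarrow> 0" by simp
    qed
  qed
  ultimately have "(\<integral>\<^sup>+u. ennreal (indicator {0..<pi} u * h_fun u ^ n) \<partial>lborel) = ennreal (0 + c * pi)"
    by (rule LIMSEQ_unique)
  moreover have "(\<integral>\<^sup>+u. ennreal (indicator {0..<pi} u * h_fun u ^ n) \<partial>lborel) = (\<integral>\<^sup>+u. ennreal (indicator {0<..<pi} u * h_fun u ^ n) \<partial>lborel)"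
    by (intro nn_integral_cong_AE AE_I'[of "{0}"]) (auto simp: indicator_def)
  ultimately show ?thesis by (simp add: c_def mult.commute)
qed

section \<open>Bijectivity of f on (0, pi)\<close>

lemma f_fun_deriv:
  assumes "0 < u" "u < pi"
  shows "\<exists>d. (f_fun has_real_derivative d) (at u) \<and> d > 0"
proof -
  have s: "sin u > 0" by (rule sin_gt_zero[OF assms])
  define A where "A = (sin u - u * cos u) / (sin u)\<^sup>2"
  define B where "B = - (cot u - u * inverse ((sin u)\<^sup>2))"
  have 1: "((\<lambda>u. u / sin u) has_real_derivative A) (at u)"
    unfolding A_def using s by (auto intro!: derivative_eq_intros simp: power2_eq_square)
  have 2: "((\<lambda>u. - u * cot u) has_real_derivative B) (at u)"
    unfolding B_def using s by (auto intro!: derivative_eq_intros DERIV_cot simp: algebra_simps)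
  have "((\<lambda>u. u / sin u * exp (- u * cot u)) has_real_derivative A * exp (- u * cot u) + (exp (- u * cot u) * B) * (u / sin u)) (at u)"
    by (rule DERIV_mult[OF 1 DERIV_chain2[OF DERIV_exp 2]])
  \<comment> \<open>Factoring out the exponential leaves a sum of two squares over the cube of the
    sine, hence a positive number.\<close>
  moreover have "A * exp (- u * cot u) + (exp (- u * cot u) * B) * (u / sin u)
     = exp (- u * cot u) * (((sin u - u * cos u)\<^sup>2 + (u * sin u)\<^sup>2) / (sin u) ^ 3)"
  proof -
    have "A + B * (u / sin u) = ((sin u)\<^sup>2 - 2 * u * cos u * sin u + u\<^sup>2) / (sin u) ^ 3"
      unfolding A_def B_def cot_def using s by (simp add: field_simps power2_eq_square power3_eq_cube)
    also have "(sin u)\<^sup>2 - 2 * u * cos u * sin u + u\<^sup>2 = (sin u - u * cos u)\<^sup>2 + (u * sin u)\<^sup>2"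
    proof -
      have "(S - u * C)\<^sup>2 + (u * S)\<^sup>2 = S\<^sup>2 - 2 * u * C * S + u\<^sup>2 * (S\<^sup>2 + C\<^sup>2)" for S C :: real
        by (simp add: power2_eq_square algebra_simps)
      thus ?thesis by simp
    qed
    finally have e: "A + B * (u / sin u) = ((sin u - u * cos u)\<^sup>2 + (u * sin u)\<^sup>2) / (sin u) ^ 3" .
    have "A * exp (- u * cot u) + (exp (- u * cot u) * B) * (u / sin u) = exp (- u * cot u) * (A + B * (u / sin u))"
      by (simp add: distrib_left)
    thus ?thesis unfolding e .
  qed
  moreover have "exp (- u * cot u) * (((sin u - u * cos u)\<^sup>2 + (u * sin u)\<^sup>2) / (sin u) ^ 3) > 0"
    using s assms by (intro mult_pos_pos divide_pos_pos add_nonneg_pos) auto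
  ultimately show ?thesis unfolding f_fun_def[abs_def] by metis
qed

lemma f_fun_strict_mono:
  assumes "0 < a" "a < b" "b < pi" shows "f_fun a < f_fun b"
proof (rule DERIV_pos_imp_increasing[OF assms(2)])
  fix x assume "a \<le> x" "x \<le> b"
  thus "\<exists>y. (f_fun has_real_derivative y) (at x) \<and> y > 0" using f_fun_deriv[of x] assms by auto
qed

lemma f_fun_surj:
  assumes y: "y > 1 / exp 1" shows "\<exists>u. 0 < u \<and> u < pi \<and> f_fun u = y"
proof -
  have y0: "y > 0" using y by (meson exp_gt_zero less_trans zero_less_divide_1_iff)
  \<comment> \<open>At u = pi - t with t \<le> pi/2 the exponent in h is nonpositive and u > 1, so h
    u \<le> sin t \<le> t; with t \<le> 1/y the value 1/y lies between h u and h 0 = e.\<close>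
  define t where "t = min (1 / y) (pi / 2)"
  have t: "0 < t" "t \<le> 1 / y" "t \<le> pi / 2" using y0 by (auto simp: t_def)
  define b where "b = pi - t"
  have b: "0 < b" "b < pi" "pi / 2 \<le> b" using t pi_gt_zero unfolding b_def by linarith+
  have "cos b \<le> 0" using cos_monotone_0_pi_le[of "pi / 2" b] b pi_gt_zero by simp
  hence "cos b / sinc b \<le> 0" using sinc_pos[of b] b by (intro divide_nonpos_nonneg) auto
  hence "exp (cos b / sinc b) \<le> 1" by simp
  hence "h_fun b \<le> sinc b * 1" unfolding h_fun_def using sinc_pos[of b] b by (intro mult_left_mono) auto
  also have "\<dots> = sin b / b" using b by simp
  also have "\<dots> \<le> sin b / 1" using b pi_gt3 sin_gt_zero[of b] by (intro divide_left_mono) auto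
  also have "\<dots> = sin t" by (simp add: b_def)
  also have "\<dots> \<le> 1 / y" using sin_x_le_x[of t] t by linarith
  finally have hb: "h_fun b \<le> 1 / y" .
  have "1 / y \<le> h_fun 0"
  proof -
    have "1 / y < 1 / (1 / exp 1)" using y y0 by (intro divide_strict_left_mono) auto
    thus ?thesis by (simp add: h_fun_def)
  qed
  hence "\<exists>u\<ge>0. u \<le> b \<and> h_fun u = 1 / y"
    using hb b by (intro IVT2' continuous_on_subset[OF h_fun_continuous]) auto
  then obtain u where u: "0 \<le> u" "u \<le> b" "h_fun u = 1 / y" by blast
  have "u \<noteq> 0"
  proof
    assume "u = 0"
    hence "exp 1 = 1 / y" using u(3) by (simp add: h_fun_def)
    thus False using y y0 by (simp add: field_simps)
  qed
  thus ?thesis using u b f_fun_eq[of u] by (intro exI[of _ u]) auto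
qed

lemma f_inv_props:
  assumes y: "y > 1 / exp 1"
  shows "0 < f_inv y" "f_inv y < pi" "f_fun (f_inv y) = y"
proof -
  have "\<exists>!u. 0 < u \<and> u < pi \<and> f_fun u = y"
    using f_fun_surj[OF y] f_fun_strict_mono by (metis linorder_neqE_linordered_idom order_less_irrefl)
  from theI'[OF this] show "0 < f_inv y" "f_inv y < pi" "f_fun (f_inv y) = y"
    by (auto simp: f_inv_def)
qed

lemma f_fun_less_iff:
  assumes y: "y > 1 / exp 1" and u: "0 < u" "u < pi"
  shows "f_fun u < y \<longleftrightarrow> u < f_inv y"
proof
  assume "u < f_inv y"
  thus "f_fun u < y" using f_fun_strict_mono[OF u(1) _ f_inv_props(2)[OF y]] f_inv_props(3)[OF y] by metis
next
  assume l: "f_fun u < y"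
  show "u < f_inv y"
  proof (rule ccontr)
    assume "\<not> u < f_inv y"
    hence "f_inv y < u \<or> f_inv y = u" by auto
    thus False using f_fun_strict_mono[OF f_inv_props(1)[OF y] _ u(2)] f_inv_props(3)[OF y] l by auto
  qed
qed

text \<open>The formula for f degenerates to 0/0 at u = 0. Monotonicity is therefore carried over to
  the reciprocal, which is continuous on [0, u] and starts at e.\<close>

lemma f_fun_gt: assumes "0 < u" "u < pi" shows "f_fun u > 1 / exp 1"
proof -
  have "h_fun u < h_fun 0"
  proof (rule DERIV_neg_imp_decreasing_open[OF assms(1)])
    fix x assume x: "0 < x" "x < u"
    then obtain d where d: "(f_fun has_real_derivative d) (at x)" "d > 0" using f_fun_deriv[of x] assms by auto
    have f: "f_fun x > 0" using x assms h_fun_pos[of x] by (simp add: f_fun_eq)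
    have "((\<lambda>x. inverse (f_fun x)) has_real_derivative - (inverse (f_fun x) * d * inverse (f_fun x))) (at x)"
      by (rule DERIV_inverse'[OF d(1)]) (use f in simp)
    hence "(h_fun has_real_derivative - (inverse (f_fun x) * d * inverse (f_fun x))) (at x)"
      by (rule has_field_derivative_transform_within_open[where S = "{0<..<pi}"])
         (use x assms in \<open>auto simp: f_fun_eq\<close>)
    moreover have "inverse (f_fun x) * d * inverse (f_fun x) > 0" using f d(2) by (intro mult_pos_pos) auto
    ultimately show "\<exists>y. (h_fun has_real_derivative y) (at x) \<and> y < 0" by (metis neg_less_0_iff_less)
  next
    show "continuous_on {0..u} h_fun" by (rule continuous_on_subset[OF h_fun_continuous]) (use assms in auto)
  qed
  also have "h_fun 0 = exp 1" by (simp add: h_fun_def)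
  finally have "1 / exp 1 < 1 / h_fun u" using h_fun_pos[of u] assms by (intro divide_strict_left_mono) auto
  thus ?thesis using f_fun_eq[OF assms] by simp
qed

section \<open>The Levy density and its moments\<close>

definition levy_density :: "real \<Rightarrow> real \<Rightarrow> real" where
  "levy_density \<alpha> s = indicator {0..\<alpha> * exp 1} s * (s * f_inv (\<alpha> / s) / (\<alpha> * pi))"

text \<open>
  Layer-cake representation: integrating over $u$ gives the inverse function of $f$ at $\alpha/s$,
  integrating over $s$ gives powers of $1/f(u)$.
\<close>

definition layer :: "real \<Rightarrow> real \<Rightarrow> real \<Rightarrow> ennreal" where
  "layer \<alpha> s u = (if 0 < u \<and> u < pi \<and> s * f_fun u < \<alpha> then 1 else 0)"

lemma measurable_f_fun [measurable]: "f_fun \<in> borel_measurable borel"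
  unfolding f_fun_def cot_def by measurable

lemma measurable_layer [measurable]: "(\<lambda>(s, u). layer \<alpha> s u) \<in> borel_measurable (lborel \<Otimes>\<^sub>M lborel)"
  unfolding layer_def by measurable

lemma layer_integral:
  assumes \<alpha>: "\<alpha> > 0" and s: "s > 0" "s \<noteq> \<alpha> * exp 1"
  shows "(\<integral>\<^sup>+u. layer \<alpha> s u \<partial>lborel) = (if s < \<alpha> * exp 1 then ennreal (f_inv (\<alpha> / s)) else 0)"
proof (cases "s < \<alpha> * exp 1")
  case True
  have y: "\<alpha> / s > 1 / exp 1" using True s(1) by (simp add: field_simps)
  have "layer \<alpha> s u = indicator {0<..<f_inv (\<alpha> / s)} u" for u
  proof -
    have "s * f_fun u < \<alpha> \<longleftrightarrow> f_fun u < \<alpha> / s" using s(1) by (simp add: field_simps)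
    thus ?thesis using f_fun_less_iff[OF y, of u] f_inv_props[OF y] by (auto simp: layer_def indicator_def)
  qed
  hence "(\<integral>\<^sup>+u. layer \<alpha> s u \<partial>lborel) = emeasure lborel {0<..<f_inv (\<alpha> / s)}" by simp
  thus ?thesis using True f_inv_props(1)[OF y] by simp
next
  case False
  have "layer \<alpha> s u = 0" for u
  proof -
    have "\<not> s * f_fun u < \<alpha>" if "0 < u" "u < pi"
    proof -
      have "\<alpha> = (\<alpha> * exp 1) * (1 / exp 1)" by simp
      also have "\<dots> \<le> s * f_fun u" using False f_fun_gt[OF that] s \<alpha> by (intro mult_mono) auto
      finally show ?thesis by simp
    qed
    thus ?thesis by (auto simp: layer_def)
  qed
  thus ?thesis using False by simp
qed

text \<open>At s = \<alpha> e the argument of \<open>f_inv\<close> is 1/e, a value that f does not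
  attain on (0, pi), so \<open>f_inv\<close> is unspecified there. The point is excluded here and
  disappears later as a null set.\<close>

lemma levy_density_eq:
  assumes \<alpha>: "\<alpha> > 0" and s: "s \<noteq> \<alpha> * exp 1"
  shows "ennreal (levy_density \<alpha> s) = ennreal (indicator {0<..} s * s / (\<alpha> * pi)) * (\<integral>\<^sup>+u. layer \<alpha> s u \<partial>lborel)"
proof (cases "s > 0")
  case True
  show ?thesis
  proof (cases "s < \<alpha> * exp 1")
    case lt: True
    have y: "\<alpha> / s > 1 / exp 1" using lt True by (simp add: field_simps)
    have "ennreal (s / (\<alpha> * pi)) * ennreal (f_inv (\<alpha> / s)) = ennreal (s / (\<alpha> * pi) * f_inv (\<alpha> / s))"
      using True \<alpha> by (intro ennreal_mult'[symmetric]) auto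
    thus ?thesis using True lt layer_integral[OF \<alpha> True s] by (simp add: levy_density_def)
  next
    case False
    thus ?thesis using True s layer_integral[OF \<alpha> True s] by (simp add: levy_density_def)
  qed
next
  case False
  thus ?thesis by (cases "s = 0") (auto simp: levy_density_def)
qed

text \<open>Since \<open>f_inv\<close> is a definite description, measurability is taken from the
  parametrised integral of \<open>layer\<close>, with the exceptional point \<alpha> e patched
  in.\<close>

lemma measurable_levy_density:
  assumes "\<alpha> > 0" shows "(\<lambda>s. ennreal (levy_density \<alpha> s)) \<in> borel_measurable lborel"
proof -
  have "(\<lambda>s. \<integral>\<^sup>+u. layer \<alpha> s u \<partial>lborel) \<in> borel_measurable lborel" by measurable
  hence "(\<lambda>s. if s = \<alpha> * exp 1 then ennreal (levy_density \<alpha> (\<alpha> * exp 1))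
     else ennreal (indicator {0<..} s * s / (\<alpha> * pi)) * (\<integral>\<^sup>+u. layer \<alpha> s u \<partial>lborel)) \<in> borel_measurable lborel"
    by measurable
  moreover have "(\<lambda>s. ennreal (levy_density \<alpha> s)) = (\<lambda>s. if s = \<alpha> * exp 1 then ennreal (levy_density \<alpha> (\<alpha> * exp 1))
     else ennreal (indicator {0<..} s * s / (\<alpha> * pi)) * (\<integral>\<^sup>+u. layer \<alpha> s u \<partial>lborel))"
    using levy_density_eq[OF assms] by auto
  ultimately show ?thesis by simp
qed

lemma nn_integral_power_Ioo:
  fixes X c :: real
  assumes "X \<ge> 0" "c > 0"
  shows "(\<integral>\<^sup>+s. ennreal (indicator {0<..<X} s * (s ^ n / c)) \<partial>lborel) = ennreal (X ^ Suc n / (Suc n * c))"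
proof -
  have "((\<lambda>s. s ^ n / c) has_integral X ^ Suc n / (Suc n * c) - 0 ^ Suc n / (Suc n * c)) {0..X}"
  proof (rule fundamental_theorem_of_calculus[OF assms(1)])
    fix s assume "s \<in> {0..X}"
    have "((\<lambda>s. s ^ Suc n / (Suc n * c)) has_real_derivative (real (Suc n) * s ^ n) / (Suc n * c)) (at s within {0..X})"
      using DERIV_pow[of "Suc n" s "{0..X}"] by (intro DERIV_cdivide) simp
    thus "((\<lambda>s. s ^ Suc n / (Suc n * c)) has_vector_derivative s ^ n / c) (at s within {0..X})"
      by (simp add: has_real_derivative_iff_has_vector_derivative[symmetric] del: of_nat_Suc power_Suc)
  qed
  hence "((\<lambda>s. s ^ n / c) has_integral X ^ Suc n / (Suc n * c)) {0..X}" by simp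
  hence "((\<lambda>s. s ^ n / c) has_integral X ^ Suc n / (Suc n * c)) {0<..<X}" using has_integral_Icc_iff_Ioo by blast
  from nn_integral_has_integral_lebesgue[OF _ this] show ?thesis using assms by simp
qed

definition levy_measure :: "real \<Rightarrow> real measure" where
  "levy_measure \<alpha> = density lborel (\<lambda>s. ennreal (levy_density \<alpha> s))"

text \<open>After exchanging the integrals, the inner one over 0 < s < \<alpha> h(u) gives
  \<alpha>^(m+1) h(u)^(m+2) / ((m+2) pi), and the integral of h^(m+2) is known. The shift by 2
  matches the expansion of z^2 / (1 - s z) in the Levy-Khintchine formula.\<close>

lemma levy_measure_nn_moment:
  assumes \<alpha>: "\<alpha> > 0"
  shows "(\<integral>\<^sup>+s. ennreal (s ^ m) \<partial>levy_measure \<alpha>) = ennreal (tree_coeff \<alpha> (m + 2))"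
proof -
  define g where "g s = indicator {0<..} s * (s ^ Suc m / (\<alpha> * pi))" for s :: real
  have gm[measurable]: "g \<in> borel_measurable borel" unfolding g_def by measurable
  have "(\<integral>\<^sup>+s. ennreal (s ^ m) \<partial>levy_measure \<alpha>) = (\<integral>\<^sup>+s. ennreal (levy_density \<alpha> s) * ennreal (s ^ m) \<partial>lborel)"
    unfolding levy_measure_def using measurable_levy_density[OF \<alpha>] by (intro nn_integral_density) auto
  also have "\<dots> = (\<integral>\<^sup>+s. (\<integral>\<^sup>+u. ennreal (g s) * layer \<alpha> s u \<partial>lborel) \<partial>lborel)"
  proof (rule nn_integral_cong_AE)
    have "AE s in lborel. s \<noteq> \<alpha> * exp 1" by (rule AE_lborel_singleton)
    thus "AE s in lborel. ennreal (levy_density \<alpha> s) * ennreal (s ^ m) = (\<integral>\<^sup>+u. ennreal (g s) * layer \<alpha> s u \<partial>lborel)"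
    proof eventually_elim
      case (elim s)
      have "ennreal (indicator {0<..} s * s / (\<alpha> * pi)) * ennreal (s ^ m) = ennreal (g s)"
      proof (cases "s > 0")
        case True
        thus ?thesis using \<alpha> by (subst ennreal_mult'[symmetric]) (auto simp: g_def)
      qed (simp add: g_def)
      moreover have "(\<integral>\<^sup>+u. ennreal (g s) * layer \<alpha> s u \<partial>lborel) = ennreal (g s) * (\<integral>\<^sup>+u. layer \<alpha> s u \<partial>lborel)"
        by (rule nn_integral_cmult) measurable
      ultimately show ?case unfolding levy_density_eq[OF \<alpha> elim] by (metis mult.commute mult.left_commute)
    qed
  qed
  also have "\<dots> = (\<integral>\<^sup>+u. (\<integral>\<^sup>+s. ennreal (g s) * layer \<alpha> s u \<partial>lborel) \<partial>lborel)"
    by (rule lborel_pair.Fubini') measurable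
  also have "\<dots> = (\<integral>\<^sup>+u. ennreal (\<alpha> ^ Suc m / ((m + 2) * pi)) * ennreal (indicator {0<..<pi} u * h_fun u ^ (m + 2)) \<partial>lborel)"
  proof (rule nn_integral_cong)
    fix u :: real
    show "(\<integral>\<^sup>+s. ennreal (g s) * layer \<alpha> s u \<partial>lborel) = ennreal (\<alpha> ^ Suc m / ((m + 2) * pi)) * ennreal (indicator {0<..<pi} u * h_fun u ^ (m + 2))"
    proof (cases "0 < u \<and> u < pi")
      case True
      hence h: "h_fun u > 0" "f_fun u = 1 / h_fun u" using h_fun_pos[of u] f_fun_eq[of u] by auto
      have "ennreal (g s) * layer \<alpha> s u = ennreal (indicator {0<..<\<alpha> * h_fun u} s * (s ^ Suc m / (\<alpha> * pi)))" for s
      proof -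
        have "s * f_fun u < \<alpha> \<longleftrightarrow> s < \<alpha> * h_fun u" 
          unfolding h(2) using pos_divide_less_eq[OF h(1), of s \<alpha>] by simp
        thus ?thesis using True by (auto simp: layer_def g_def indicator_def)
      qed
      hence "(\<integral>\<^sup>+s. ennreal (g s) * layer \<alpha> s u \<partial>lborel) = ennreal ((\<alpha> * h_fun u) ^ Suc (Suc m) / (Suc (Suc m) * (\<alpha> * pi)))"
        using nn_integral_power_Ioo[of "\<alpha> * h_fun u" "\<alpha> * pi" "Suc m"] \<alpha> h(1) by (simp del: power_Suc of_nat_Suc)
      also have "(\<alpha> * h_fun u) ^ Suc (Suc m) / (Suc (Suc m) * (\<alpha> * pi)) = \<alpha> ^ Suc m / ((m + 2) * pi) * h_fun u ^ (m + 2)"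
      proof -
        have "(\<alpha> * h_fun u) ^ Suc (Suc m) = \<alpha> * (\<alpha> ^ Suc m * h_fun u ^ (m + 2))"
          by (simp add: power_mult_distrib)
        moreover have "real (Suc (Suc m)) = real (m + 2)" by simp
        ultimately show ?thesis using \<alpha> by (simp del: of_nat_add of_nat_Suc power_Suc)
      qed
      also have "ennreal \<dots> = ennreal (\<alpha> ^ Suc m / ((m + 2) * pi)) * ennreal (h_fun u ^ (m + 2))"
        using \<alpha> by (intro ennreal_mult') auto
      finally show ?thesis using True by simp
    next
      case False
      hence "layer \<alpha> s u = 0" for s by (auto simp: layer_def)
      thus ?thesis using False by auto
    qed
  qed
  also have "\<dots> = ennreal (\<alpha> ^ Suc m / ((m + 2) * pi)) * (\<integral>\<^sup>+u. ennreal (indicator {0<..<pi} u * h_fun u ^ (m + 2)) \<partial>lborel)"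
  proof (rule nn_integral_cmult)
    have "(\<lambda>u. indicator {0<..<pi} u *\<^sub>R h_fun u ^ (m + 2)) \<in> borel_measurable borel"
      by (intro borel_measurable_continuous_on_indicator continuous_intros continuous_on_subset[OF h_fun_continuous]) auto
    thus "(\<lambda>u. ennreal (indicator {0<..<pi} u * h_fun u ^ (m + 2))) \<in> borel_measurable lborel" by simp
  qed
  also have "\<dots> = ennreal (\<alpha> ^ Suc m / ((m + 2) * pi) * (pi * (real (m + 2) ^ (m + 2) / fact (m + 2))))"
    unfolding nn_integral_h_fun_power using \<alpha> by (intro ennreal_mult'[symmetric]) auto
  also have "\<alpha> ^ Suc m / ((m + 2) * pi) * (pi * (real (m + 2) ^ (m + 2) / fact (m + 2))) = tree_coeff \<alpha> (m + 2)"
  proof -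
    define N where "N = real (m + 2)"
    have N: "N > 0" by (simp add: N_def)
    have "\<alpha> ^ Suc m / (N * pi) * (pi * (N ^ (m + 2) / fact (m + 2))) = (\<alpha> * N) ^ Suc m / fact (m + 2)"
      using N by (simp add: power_mult_distrib field_simps del: fact_Suc)
    thus ?thesis by (simp add: tree_coeff_def N_def del: fact_Suc)
  qed
  finally show ?thesis .
qed

lemma finite_levy_measure: assumes "\<alpha> > 0" shows "finite_measure (levy_measure \<alpha>)"
  using levy_measure_nn_moment[OF assms, of 0] by (intro finite_measureI) simp

lemma sets_levy_measure [simp]: "sets (levy_measure \<alpha>) = sets borel"
  by (simp add: levy_measure_def)

lemma levy_measure_AE: assumes "\<alpha> > 0" shows "AE s in levy_measure \<alpha>. 0 \<le> s \<and> s \<le> \<alpha> * exp 1"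
  unfolding levy_measure_def
  by (subst AE_density[OF measurable_levy_density[OF assms]]) (auto simp: levy_density_def indicator_def)

lemma levy_measure_moment: assumes "\<alpha> > 0"
  shows "(\<integral>s. s ^ m \<partial>levy_measure \<alpha>) = tree_coeff \<alpha> (m + 2)"
proof -
  have "AE s in levy_measure \<alpha>. 0 \<le> s ^ m" using levy_measure_AE[OF assms] by (auto elim: eventually_mono)
  moreover have "(\<lambda>s. s ^ m) \<in> borel_measurable (levy_measure \<alpha>)"
    by (simp add: measurable_cong_sets[OF sets_levy_measure refl])
  ultimately have "(\<integral>s. s ^ m \<partial>levy_measure \<alpha>) = enn2real (\<integral>\<^sup>+s. ennreal (s ^ m) \<partial>levy_measure \<alpha>)"
    by (intro integral_eq_nn_integral)
  thus ?thesis using levy_measure_nn_moment[OF assms] tree_coeff_bound(1)[OF assms] by simp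
qed

text \<open>The drift 1 is the first free cumulant, and the Levy integral supplies all terms from
  z^2 on.\<close>

lemma levy_measure_transform:
  assumes \<alpha>: "\<alpha> > 0" and z: "cmod z < 1 / (\<alpha> * exp 1)"
  shows "z * (of_real 1 + (\<integral>t. z / (1 - of_real t * z) \<partial>levy_measure \<alpha>)) = tree_fun \<alpha> z"
proof -
  have kz: "\<alpha> * exp 1 * cmod z < 1" using z \<alpha> by (simp add: field_simps)
  have "(\<lambda>m. of_real (tree_coeff \<alpha> (m + 2)) * z ^ m) sums (\<integral>t. 1 / (1 - of_real t * z) \<partial>levy_measure \<alpha>)"
    using sums_integral_geometric[OF finite_levy_measure[OF \<alpha>] sets_levy_measure levy_measure_AE[OF \<alpha>] _ kz] \<alpha>
    by (simp add: levy_measure_moment)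
  from sums_mult[OF this, of "z\<^sup>2"]
  have s1: "(\<lambda>m. of_real (tree_coeff \<alpha> (m + 2)) * z ^ (m + 2)) sums (z\<^sup>2 * (\<integral>t. 1 / (1 - of_real t * z) \<partial>levy_measure \<alpha>))"
    by (simp add: power2_eq_square mult_ac)
  have s2: "(\<lambda>m. of_real (tree_coeff \<alpha> (m + 2)) * z ^ (m + 2)) sums (tree_fun \<alpha> z - (\<Sum>i<2. of_real (tree_coeff \<alpha> i) * z ^ i))"
    by (rule sums_split_initial_segment[OF tree_fun_sums[OF \<alpha> z]])
  have s3: "(\<Sum>i<2. of_real (tree_coeff \<alpha> i) * z ^ i) = z"
    by (simp add: numeral_2_eq_2 tree_coeff_def)
  have e: "tree_fun \<alpha> z = z + z\<^sup>2 * (\<integral>t. 1 / (1 - of_real t * z) \<partial>levy_measure \<alpha>)"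
    using sums_unique2[OF s1 s2] unfolding s3 by (simp only: diff_add_cancel add.commute[of z])
  have "(\<integral>t. z / (1 - of_real t * z) \<partial>levy_measure \<alpha>) = (\<integral>t. z * (1 / (1 - of_real t * z)) \<partial>levy_measure \<alpha>)" by simp
  also have "\<dots> = z * (\<integral>t. 1 / (1 - of_real t * z) \<partial>levy_measure \<alpha>)" by (rule integral_mult_right_zero)
  finally show ?thesis unfolding e by (simp only: power2_eq_square of_real_1 distrib_left mult_1_right mult.assoc)
qed

section \<open>Proof of the theorem\<close>

lemma upper_subset_slit: "Im v > 0 \<Longrightarrow> v \<in> slit_plane"
  by auto

text \<open>For the point mass at 0 one has v G(v) - 1 = 0, so the equation would force G = 0,
  whereas G(v) = 1/v.\<close>

lemma cauchy_fe_not_delta_0: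
  assumes "\<forall>v \<in> slit_plane. cauchy_fe_at \<beta> 1 \<mu> v" shows "\<mu> \<noteq> return borel 0"
proof
  assume \<mu>: "\<mu> = return borel 0"
  have "cauchy_transform \<mu> \<i> = 1 / \<i>" unfolding \<mu> cauchy_transform_def by (subst integral_return) auto
  moreover have "cauchy_fe_at \<beta> 1 \<mu> \<i>" using assms upper_subset_slit[of \<i>] by simp
  ultimately show False by (simp add: cauchy_fe_at_def Let_def)
qed

text \<open>The S in the definition of the power is tied to y only through values of Psi, so it is
  first replaced by the exponential on small negative arguments. Its values there are positive
  reals, for which the principal power satisfies (e^a)^t = e^(a t).\<close>

lemma free_mult_power_imp_fe:
  assumes y: "prob_on_Rplus y" "y \<noteq> return borel 0" "S_transform_rel y (\<lambda>w. exp (- of_real \<alpha> * w))"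
    and \<sigma>: "free_mult_power y t \<sigma>"
  shows "\<forall>v \<in> slit_plane. cauchy_fe_at (\<alpha> * t) 1 \<sigma> v"
proof
  fix v assume v: "v \<in> slit_plane"
  obtain S where S: "S_transform_rel y S" "S_transform_rel \<sigma> (\<lambda>w. S w powr of_real t)"
    and \<sigma>': "prob_on_Rplus \<sigma>" "\<sigma> \<noteq> return borel 0"
    using \<sigma> by (auto simp: free_mult_power_def)
  obtain \<delta> where \<delta>: "\<delta> > 0" "\<forall>p. 0 < p \<and> p < \<delta> \<longrightarrow> S (- of_real p) = exp (- of_real \<alpha> * - of_real p)"
    using S_transform_determined_on_negatives[OF y(1,2) S(1) y(3)] by blast
  show "cauchy_fe_at (\<alpha> * t) 1 \<sigma> v"
  proof (rule S_transform_imp_cauchy_fe[OF \<sigma>' S(2) \<delta>(1) _ v])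
    fix p :: real assume p: "0 < p" "p < \<delta>"
    hence "S (- of_real p) = exp (of_real (\<alpha> * p))" using \<delta>(2) by simp
    also have "\<dots> = of_real (exp (\<alpha> * p))" by (rule exp_of_real)
    also have "\<dots> powr of_real t = of_real (exp (\<alpha> * p) powr t)" by (rule powr_of_real) simp
    also have "\<dots> = exp (of_real (\<alpha> * t * p))" by (simp add: powr_def mult_ac exp_of_real[symmetric])
    finally show "S (- of_real p) powr of_real t = exp (of_real (\<alpha> * t * p))" .
  qed
qed

lemma fe_imp_free_mult_power:
  assumes S: "S_transform_rel y (\<lambda>w. exp (- of_real \<alpha> * w))"
    and \<sigma>: "prob_on_Rplus \<sigma>" "\<forall>v \<in> slit_plane. cauchy_fe_at (\<alpha> * t) 1 \<sigma> v" and \<alpha>: "\<alpha> > 0"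
  shows "free_mult_power y t \<sigma>"
  unfolding free_mult_power_def
proof (intro conjI exI)
  show "S_transform_rel y (\<lambda>w. exp (- of_real \<alpha> * w))" by (rule S)
  show "S_transform_rel \<sigma> (\<lambda>w. exp (- of_real \<alpha> * w) powr of_real t)"
  proof (rule cauchy_fe_imp_S_transform[OF \<sigma>(1)])
    \<comment> \<open>Within this radius |\<alpha> w| < 1 < pi, so Ln inverts exp and the principal
      power is again an exponential.\<close>
    show "1 / \<alpha> > 0" using \<alpha> by simp
    fix w assume w: "cmod w < 1 / \<alpha>"
    define z where "z = - of_real \<alpha> * w"
    have "cmod z < 1" using w \<alpha> by (simp add: z_def norm_mult field_simps)
    hence "\<bar>Im z\<bar> < 1" using abs_Im_le_cmod[of z] by linarith
    hence "Ln (exp z) = z" using pi_gt3 by (intro Ln_exp) auto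
    hence "exp z powr of_real t = exp (of_real t * z)" by (simp add: powr_def)
    thus "exp (- of_real \<alpha> * w) powr of_real t = exp (- of_real (\<alpha> * t) * w)" by (simp add: z_def mult_ac)
  qed (use \<sigma>(2) in blast)
qed (use \<sigma> cauchy_fe_not_delta_0 in auto)

lemma fe_imp_free_add_power:
  assumes y: "prob_on_R y" "\<forall>v. Im v > 0 \<longrightarrow> cauchy_fe_at \<alpha> 1 y v"
    and \<rho>: "prob_on_R \<rho>" "\<forall>v. Im v > 0 \<longrightarrow> cauchy_fe_at \<alpha> t \<rho> v" and "\<alpha> > 0" "t > 0"
  shows "free_add_power y t \<rho>"
  unfolding free_add_power_def
proof (intro conjI exI)
  show "R_transform_rel y (tree_fun \<alpha>)"
    by (rule R_transform_relI[OF y zero_less_one \<open>\<alpha> > 0\<close> zero_less_one]) simp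
  show "R_transform_rel \<rho> (\<lambda>z. of_real t * tree_fun \<alpha> z)"
    by (rule R_transform_relI[OF \<rho> \<open>t > 0\<close> \<open>\<alpha> > 0\<close> zero_less_one]) simp
qed (rule \<rho>)

lemma fe_dilate_upper:
  assumes "prob_on_R \<sigma>" "t > 0" "\<forall>v \<in> slit_plane. cauchy_fe_at (\<alpha> / t) 1 \<sigma> v"
  shows "\<forall>v. Im v > 0 \<longrightarrow> cauchy_fe_at \<alpha> t (dilate t \<sigma>) v"
proof (intro allI impI cauchy_fe_dilate assms(1,2))
  fix v assume "Im v > 0"
  hence "Im (v / of_real t) > 0" using assms(2) by (simp add: Im_divide_of_real)
  thus "cauchy_fe_at (\<alpha> / t) 1 \<sigma> (v / of_real t)" using assms(3) upper_subset_slit by blast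
qed

text \<open>Convolution powers are relations here, so the last part asserts that powers exist and
  then the identity for every pair of candidates, which contains their uniqueness.\<close>

theorem theorem11:
  fixes \<alpha> :: real and y :: "real measure"
  assumes "\<alpha> > 0"
    and "prob_on_Rplus y" and "y \<noteq> return borel 0"
    and "S_transform_rel y (\<lambda>w. exp (- complex_of_real \<alpha> * w))"
  shows
    "calR_transform_rel y (\<lambda>z. - LambertW0 (- complex_of_real \<alpha> * z) / (complex_of_real \<alpha> * z))
     \<and> R_transform_rel y (\<lambda>z. - LambertW0 (- complex_of_real \<alpha> * z) / complex_of_real \<alpha>)
     \<and> free_add_inf_div y \<and> free_mult_inf_div y
     \<and> free_cumulants_rel y (\<lambda>n. (\<alpha> * real n) ^ (n - 1) / fact n)
     \<and> levy_measure_rel y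
         (density lborel (\<lambda>s. ennreal (indicator {0..\<alpha> * exp 1} s * (s * f_inv (\<alpha> / s) / (\<alpha> * pi)))))
     \<and> (\<forall>t>0. (\<exists>\<rho>. free_add_power y t \<rho>) \<and> (\<exists>\<rho>. free_mult_power y t \<rho>)
          \<and> (\<forall>\<rho> \<sigma>. free_add_power y t \<rho> \<longrightarrow> free_mult_power y (1 / t) \<sigma> \<longrightarrow> \<rho> = dilate t \<sigma>)
          \<and> (\<forall>\<rho> \<sigma>. free_mult_power y t \<rho> \<longrightarrow> free_add_power y (1 / t) \<sigma> \<longrightarrow> \<rho> = dilate t \<sigma>))"
proof -
  note \<alpha> = assms(1) and y = assms(2) and S = assms(4)
  have yR: "prob_on_R y" by (rule prob_on_Rplus_imp_prob_on_R[OF y])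
  have "cauchy_fe_at \<alpha> 1 y v" if "v \<in> slit_plane" for v
    by (rule S_transform_imp_cauchy_fe[OF y assms(3) S zero_less_one _ that]) simp
  hence fe: "\<forall>v. Im v > 0 \<longrightarrow> cauchy_fe_at \<alpha> 1 y v" using upper_subset_slit by blast
  have R: "R_transform_rel y R" if "r > 0" "\<And>u. u \<noteq> 0 \<Longrightarrow> cmod u < r \<Longrightarrow> R u = tree_fun \<alpha> u" for R r
    by (rule R_transform_relI[OF yR fe zero_less_one \<alpha> that(1)]) (use that(2) in simp)
  obtain r where r: "r > 0" "\<And>u. cmod u < r \<Longrightarrow> (\<lambda>n. complex_of_real (tree_coeff \<alpha> n) * u ^ n) sums tree_fun \<alpha> u"
    "\<And>u. cmod u < r \<Longrightarrow> LambertW0 (- of_real \<alpha> * u) = - of_real \<alpha> * tree_fun \<alpha> u"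
    using tree_fun_eventually[OF \<alpha>] by metis
  have 1: "calR_transform_rel y (\<lambda>z. - LambertW0 (- complex_of_real \<alpha> * z) / (complex_of_real \<alpha> * z))"
    unfolding calR_transform_rel_def by (rule R[OF r(1)]) (use r(3) \<alpha> in simp)
  have 2: "R_transform_rel y (\<lambda>z. - LambertW0 (- complex_of_real \<alpha> * z) / complex_of_real \<alpha>)"
    by (rule R[OF r(1)]) (use r(3) \<alpha> in simp)
  have ex: "\<exists>\<sigma>. prob_on_Rplus \<sigma> \<and> (\<forall>v \<in> slit_plane. cauchy_fe_at (\<alpha> * t) 1 \<sigma> v)" if "t > 0" for t
    using that \<alpha> by (intro y_measure_exists) simp
  \<comment> \<open>The additive power with exponent t is the dilation by t of the measure with
    parameter \<alpha>/t, which in turn is the multiplicative power with exponent 1/t.\<close>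
  have add_ex: "\<exists>\<rho>. prob_on_R \<rho> \<and> (\<forall>v. Im v > 0 \<longrightarrow> cauchy_fe_at \<alpha> t \<rho> v)" if t: "t > 0" for t
  proof -
    obtain \<sigma> where "prob_on_Rplus \<sigma>" "\<forall>v \<in> slit_plane. cauchy_fe_at (\<alpha> / t) 1 \<sigma> v"
      using ex[of "1 / t"] t by auto
    thus ?thesis using fe_dilate_upper[OF _ t] prob_on_R_dilate prob_on_Rplus_imp_prob_on_R by metis
  qed
  have 3: "free_add_inf_div y" unfolding free_add_inf_div_def
  proof (intro allI impI)
    fix n :: nat assume n: "n \<ge> 1"
    obtain \<nu> where \<nu>: "prob_on_R \<nu>" "\<forall>v. Im v > 0 \<longrightarrow> cauchy_fe_at \<alpha> (1 / real n) \<nu> v"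
      using add_ex[of "1 / real n"] n by auto
    have "R_transform_rel \<nu> (\<lambda>u. of_real (1 / real n) * tree_fun \<alpha> u)"
      by (rule R_transform_relI[OF \<nu> _ \<alpha> zero_less_one]) (use n in auto)
    moreover have "R_transform_rel y (\<lambda>u. of_nat n * (of_real (1 / real n) * tree_fun \<alpha> u))"
      by (rule R[OF zero_less_one]) (use n in simp)
    ultimately show "\<exists>\<nu>. prob_on_R \<nu> \<and> (\<exists>R. R_transform_rel \<nu> R \<and> R_transform_rel y (\<lambda>z. of_nat n * R z))"
      using \<nu>(1) by blast
  qed
  have 4: "free_mult_inf_div y" unfolding free_mult_inf_div_def
  proof (intro allI impI)
    fix n :: nat assume n: "n \<ge> 1"
    obtain \<nu> where \<nu>: "prob_on_Rplus \<nu>" "\<forall>v \<in> slit_plane. cauchy_fe_at (\<alpha> / real n) 1 \<nu> v"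
      using ex[of "1 / real n"] n by auto
    have "S_transform_rel \<nu> (\<lambda>w. exp (- of_real (\<alpha> / real n) * w))"
      by (rule cauchy_fe_imp_S_transform[OF \<nu>(1) _ zero_less_one]) (use \<nu>(2) in auto)
    moreover have "(\<lambda>w. exp (- of_real (\<alpha> / real n) * w) ^ n) = (\<lambda>w. exp (- complex_of_real \<alpha> * w))"
      using n by (simp add: fun_eq_iff exp_of_nat_mult[symmetric])
    ultimately show "\<exists>\<nu>. prob_on_Rplus \<nu> \<and> \<nu> \<noteq> return borel 0 \<and> (\<exists>S. S_transform_rel \<nu> S \<and> S_transform_rel y (\<lambda>w. S w ^ n))"
      using \<nu> cauchy_fe_not_delta_0[OF \<nu>(2)] S by (intro exI[of _ \<nu>] conjI exI[of _ "\<lambda>w. exp (- of_real (\<alpha> / real n) * w)"]) simp_all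
  qed
  have 5: "free_cumulants_rel y (\<lambda>n. (\<alpha> * real n) ^ (n - 1) / fact n)" unfolding free_cumulants_rel_def
  proof (intro exI conjI allI impI)
    show "R_transform_rel y (tree_fun \<alpha>)" by (rule R[OF zero_less_one]) simp
    fix z assume "cmod z < r"
    hence "(\<lambda>n. complex_of_real (tree_coeff \<alpha> (Suc n)) * z ^ Suc n) sums tree_fun \<alpha> z"
      using r(2)[of z] by (subst sums_Suc_iff) (simp add: tree_coeff_def)
    thus "(\<lambda>n. complex_of_real ((\<alpha> * real (Suc n)) ^ (Suc n - 1) / fact (Suc n)) * z ^ Suc n) sums tree_fun \<alpha> z"
      unfolding tree_coeff_def by (simp only: nat.simps if_False)
  qed (rule r(1))
  have 6: "levy_measure_rel y (levy_measure \<alpha>)" unfolding levy_measure_rel_def calR_transform_rel_def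
    by (intro conjI finite_levy_measure \<alpha> sets_levy_measure exI[of _ 1] R[of "1 / (\<alpha> * exp 1)"] levy_measure_transform) (use \<alpha> in auto)
  have add_mult: "\<rho> = dilate t \<sigma>" if t: "t > 0" and \<rho>: "free_add_power y t \<rho>" and \<sigma>: "free_mult_power y (1 / t) \<sigma>" for t \<rho> \<sigma>
  proof -
    have \<sigma>R: "prob_on_R \<sigma>" using \<sigma> by (simp add: free_mult_power_def prob_on_Rplus_imp_prob_on_R)
    have "\<forall>v \<in> slit_plane. cauchy_fe_at (\<alpha> / t) 1 \<sigma> v"
      using free_mult_power_imp_fe[OF y assms(3) S \<sigma>] by simp
    thus ?thesis
      using free_add_power_unique[OF yR fe prob_on_R_dilate[OF \<sigma>R] fe_dilate_upper[OF \<sigma>R t] t \<alpha> \<rho>] by blast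
  qed
  \<comment> \<open>The first identity with 1/t in place of t, dilated back by t.\<close>
  have mult_add: "\<rho> = dilate t \<sigma>" if t: "t > 0" and \<rho>: "free_mult_power y t \<rho>" and \<sigma>: "free_add_power y (1 / t) \<sigma>" for t \<rho> \<sigma>
  proof -
    have \<rho>R: "prob_on_R \<rho>" using \<rho> by (simp add: free_mult_power_def prob_on_Rplus_imp_prob_on_R)
    have "\<sigma> = dilate (1 / t) \<rho>" using add_mult[of "1 / t" \<sigma> \<rho>] t \<rho> \<sigma> by simp
    hence "dilate t \<sigma> = dilate 1 \<rho>" using dilate_dilate[OF \<rho>R, of t "1 / t"] t by simp
    thus ?thesis using dilate_1[OF \<rho>R] by simp
  qed
  have "(\<exists>\<rho>. free_add_power y t \<rho>) \<and> (\<exists>\<rho>. free_mult_power y t \<rho>)" if t: "t > 0" for t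
    using add_ex[OF t] ex[OF t] fe_imp_free_add_power[OF yR fe _ _ \<alpha> t] fe_imp_free_mult_power[OF S _ _ \<alpha>] by blast
  thus ?thesis using 1 2 3 4 5 6 add_mult mult_add unfolding levy_measure_def levy_density_def by blast
qed

end
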